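(* Let $a>0$, $\eta>0$, $q<0$ and $c=-\tfrac12$. The value $K$ of the stopping rule $R(q)$ is given by $$K = \frac{A_0 + A_-(q)}{1-A_+(q)} = \frac{\nu_\alpha + (1-e^{-\eta a})\,\nu_a + \psi_0(q)}{\nu - 1 - \psi_1(q)}.$$ The denominator $\nu-1-\psi_1(q)$ is always positive.
   Context: Setting: $W=(W_t)_{t\ge0}$ is a standard Brownian motion started at $0$, $X_t = W_t+ct$ for $t\ge0$ with $c=-\tfrac12$, and $\bar X_t=\sup_{0\le u\le t}X_u$. The random variable $\alpha$ is exponentially distributed with rate $\eta$ (mean $1/\eta$) and independent of $W$. $\varphi$ and $\Phi$ denote the density and the distribution function of the standard normal distribution, and $E[Y;B]$ means $E[Y\,1_B]$. Let $$\tau_0=\inf\left\{t\ge a:\ \sup_{t-a\le u\le t}X_u = X_{t-a}\right\}.$$ The rule $R(q)$ (with threshold $q<0$): (i) wait until $\tau_0\wedge\alpha$; (ii) if $\alpha<\tau_0$, stop and receive $\exp(\bar X_\alpha)$; (iii.a) if $\tau_0<\alpha$ and $X_{\tau_0}-\bar X_{\tau_0}<q$, stop and receive $\exp(\bar X_{\tau_0})$; (iii.b) if $\tau_0<\alpha$ and $X_{\tau_0}-\bar X_{\tau_0}>q$, forget and continue: wipe away the whole path of $X$ on $[0,\tau_0)$, keep only the value $X_{\tau_0}$, and restart the rule from that point (with the same terminal time $\alpha$). Explicitly: put $\sigma_0=0$ and, for $k\ge0$, $\sigma_{k+1}=\inf\{t\ge\sigma_k+a:\ \sup_{t-a\le u\le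 t}X_u=X_{t-a}\}$ and $M_k(t)=\sup_{\sigma_k\le u\le t}X_u$ for $t\ge\sigma_k$. Let $N$ be the smallest $k\ge0$ such that $\alpha<\sigma_{k+1}$ or $X_{\sigma_{k+1}}-M_k(\sigma_{k+1})<q$. The reward of rule $R(q)$ is $\exp\left(M_N(\sigma_{N+1}\wedge\alpha)\right)$, and its value is the expected reward $K=E\left[\exp\left(M_N(\sigma_{N+1}\wedge\alpha)\right)\right]$. (Ties occur with probability zero.) The quantities $A_0$, $A_\pm(q)$ are $$A_0 = E\left[\exp(\bar X_\alpha);\ \alpha<\tau_0\right],$$ $$A_-(q) = E\left[\exp(\bar X_{\tau_0});\ \tau_0<\alpha,\ X_{\tau_0}-\bar X_{\tau_0}<q\right],$$ $$A_+(q) = E\left[\exp(X_{\tau_0});\ \tau_0<\alpha,\ X_{\tau_0}-\bar X_{\tau_0}>q\right].$$ The constants and functions are, with $\beta=\sqrt{c^2+2\eta}$ and $\bar c=1+c$, $$\nu = \frac{2}{\sqrt{a}}\,\varphi(\beta\sqrt a) + 2\beta\,\Phi(\beta\sqrt a) - c - \beta,$$ $$\nu_a = \frac{2}{\sqrt{a}}\,\varphi(c\sqrt{a}) - 2c\,\Phi(-c\sqrt a),$$ $$\nu_\alpha = 2\beta\left(\Phi(\beta\sqrt a) - \tfrac12\right) - 2c\left(\Phi(c\sqrt a) - \tfrac12\right) + \frac{2}{\sqrt a}\left\{\varphi(\beta\sqrt a) - \varphi(c\sqrt a)\right\},$$ $$\psi_0(q) = e^{-\eta a}\left\{\frac{2}{\sqrt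 a}\,\varphi\left(\frac{q-ca}{\sqrt a}\right) - 2c\,\Phi\left(\frac{q-ca}{\sqrt a}\right)\right\},$$ $$\psi_1(q) = e^{(c+\frac12-\eta)a}\left[\frac{2}{\sqrt a}\left\{\varphi(\bar c\sqrt a) - \varphi\left(\frac{q-\bar c a}{\sqrt a}\right)\right\} + 2\bar c\left\{\Phi(\bar c\sqrt a) - \Phi\left(-\frac{q-\bar c a}{\sqrt a}\right)\right\}\right].$$ *)

theory Defs
  imports "HOL-Probability.Probability"
begin

(* All paths are continuous, not only almost all: M need not be complete, so path suprema and
   hitting times would otherwise not have to be measurable. *)
definition standard_brownian_motion :: "'a measure \<Rightarrow> (real \<Rightarrow> 'a \<Rightarrow> real) \<Rightarrow> bool" where
  "standard_brownian_motion M W \<longleftrightarrow>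
     prob_space M \<and>
     (\<forall>t\<ge>0. W t \<in> borel_measurable M) \<and>
     (AE \<omega> in M. W 0 \<omega> = 0) \<and>
     (\<forall>\<omega>\<in>space M. continuous_on {0..} (\<lambda>t. W t \<omega>)) \<and>
     (\<forall>s t. 0 \<le> s \<and> s < t \<longrightarrow>
        distributed M lborel (\<lambda>\<omega>. W t \<omega> - W s \<omega>) (normal_density 0 (sqrt (t - s)))) \<and>
     (\<forall>(n::nat) t. 0 \<le> t 0 \<and> (\<forall>i<n. t i \<le> t (Suc i)) \<longrightarrow>
        prob_space.indep_vars M (\<lambda>_. borel) (\<lambda>i \<omega>. W (t (Suc i)) \<omega> - W (t i) \<omega>) {..<n})"

(* Independence of the sigma-algebras generated by Y and by the whole path (W t), t \<ge> 0;
   indep_var is not applicable since the two value spaces have different types. *)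
definition indep_of_process :: "'a measure \<Rightarrow> ('a \<Rightarrow> real) \<Rightarrow> (real \<Rightarrow> 'a \<Rightarrow> real) \<Rightarrow> bool" where
  "indep_of_process M Y W \<longleftrightarrow>
     prob_space.indep_set M
       (sets (vimage_algebra (space M) Y borel))
       (sets (vimage_algebra (space M) (\<lambda>\<omega>. \<lambda>t\<in>{0..}. W t \<omega>) (\<Pi>\<^sub>M t\<in>{0..}. borel)))"

definition running_max :: "(real \<Rightarrow> real) \<Rightarrow> real \<Rightarrow> real \<Rightarrow> real" where
  "running_max x s t = (SUP u\<in>{s..t}. x u)"

(* The first t \<ge> s + a with max of x on [t - a, t] equal to x (t - a); infinite if there is none.
   The time tau_0 is the case s = 0. *)
definition lag_time :: "real \<Rightarrow> (real \<Rightarrow> real) \<Rightarrow> ereal \<Rightarrow> ereal" where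
  "lag_time a x s =
     Inf {ereal t | t. s + ereal a \<le> ereal t \<and> running_max x (t - a) t = x (t - a)}"

primrec restart_time :: "real \<Rightarrow> (real \<Rightarrow> real) \<Rightarrow> nat \<Rightarrow> ereal" where
  "restart_time a x 0 = 0"
| "restart_time a x (Suc k) = lag_time a x (restart_time a x k)"

definition max_since_restart :: "real \<Rightarrow> (real \<Rightarrow> real) \<Rightarrow> nat \<Rightarrow> real \<Rightarrow> real" where
  "max_since_restart a x k t = running_max x (real_of_ereal (restart_time a x k)) t"

(* The least k always exists when a > 0, because restart_time a x k \<ge> k * a. If
   restart_time a x (Suc k) is infinite, the first disjunct holds, so the arbitrary value
   real_of_ereal \<infinity> = 0 in the second one is harmless. *)
definition stop_index :: "real \<Rightarrow> real \<Rightarrow> (real \<Rightarrow> real) \<Rightarrow> real \<Rightarrow> nat" where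
  "stop_index a q x T =
     (LEAST k. ereal T < restart_time a x (Suc k) \<or>
        (let \<sigma> = real_of_ereal (restart_time a x (Suc k))
         in x \<sigma> - max_since_restart a x k \<sigma> < q))"

(* Payoff of the rule with threshold q along the path x with terminal time T. *)
definition reward :: "real \<Rightarrow> real \<Rightarrow> (real \<Rightarrow> real) \<Rightarrow> real \<Rightarrow> real" where
  "reward a q x T =
     (let N = stop_index a q x T
      in exp (max_since_restart a x N
           (real_of_ereal (min (restart_time a x (Suc N)) (ereal T)))))"

context
  fixes M :: "'a measure" and X :: "real \<Rightarrow> 'a \<Rightarrow> real" and \<alpha> :: "'a \<Rightarrow> real" and a :: real
begin

definition tau0 :: "'a \<Rightarrow> ereal" where
  "tau0 \<omega> = lag_time a (\<lambda>t. X t \<omega>) 0"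

definition X_tau0 :: "'a \<Rightarrow> real" where
  "X_tau0 \<omega> = X (real_of_ereal (tau0 \<omega>)) \<omega>"

definition Xmax :: "real \<Rightarrow> 'a \<Rightarrow> real" where
  "Xmax t \<omega> = running_max (\<lambda>u. X u \<omega>) 0 t"

definition Xmax_tau0 :: "'a \<Rightarrow> real" where
  "Xmax_tau0 \<omega> = Xmax (real_of_ereal (tau0 \<omega>)) \<omega>"

definition event_0 :: "'a set" where
  "event_0 = {\<omega>\<in>space M. ereal (\<alpha> \<omega>) < tau0 \<omega>}"

definition event_minus :: "real \<Rightarrow> 'a set" where
  "event_minus q = {\<omega>\<in>space M. tau0 \<omega> < ereal (\<alpha> \<omega>) \<and> X_tau0 \<omega> - Xmax_tau0 \<omega> < q}"

definition event_plus :: "real \<Rightarrow> 'a set" where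
  "event_plus q = {\<omega>\<in>space M. tau0 \<omega> < ereal (\<alpha> \<omega>) \<and> X_tau0 \<omega> - Xmax_tau0 \<omega> > q}"

definition A_0 :: real where
  "A_0 = (LINT \<omega>:event_0|M. exp (Xmax (\<alpha> \<omega>) \<omega>))"

definition A_minus :: "real \<Rightarrow> real" where
  "A_minus q = (LINT \<omega>:event_minus q|M. exp (Xmax_tau0 \<omega>))"

definition A_plus :: "real \<Rightarrow> real" where
  "A_plus q = (LINT \<omega>:event_plus q|M. exp (X_tau0 \<omega>))"

definition rule_value :: "real \<Rightarrow> real" where
  "rule_value q = (LINT \<omega>|M. reward a q (\<lambda>t. X t \<omega>) (\<alpha> \<omega>))"

(* Finiteness of the four expectations; without it a Bochner integral defaults to 0. *)
definition expectations_exist :: "real \<Rightarrow> bool" where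
  "expectations_exist q \<longleftrightarrow>
     set_integrable M event_0 (\<lambda>\<omega>. exp (Xmax (\<alpha> \<omega>) \<omega>)) \<and>
     set_integrable M (event_minus q) (\<lambda>\<omega>. exp (Xmax_tau0 \<omega>)) \<and>
     set_integrable M (event_plus q) (\<lambda>\<omega>. exp (X_tau0 \<omega>)) \<and>
     integrable M (\<lambda>\<omega>. reward a q (\<lambda>t. X t \<omega>) (\<alpha> \<omega>))"

end

abbreviation std_normal_cdf :: "real \<Rightarrow> real" where
  "std_normal_cdf \<equiv> cdf std_normal_distribution"

context
  fixes c \<eta> a :: real
begin

definition beta_const :: real where
  "beta_const = sqrt (c\<^sup>2 + 2 * \<eta>)"

definition nu :: real where
  "nu = 2 / sqrt a * std_normal_density (beta_const * sqrt a)
        + 2 * beta_const * std_normal_cdf (beta_const * sqrt a) - c - beta_const"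

definition nu_a :: real where
  "nu_a = 2 / sqrt a * std_normal_density (c * sqrt a) - 2 * c * std_normal_cdf (- c * sqrt a)"

definition nu_alpha :: real where
  "nu_alpha =
     2 * beta_const * (std_normal_cdf (beta_const * sqrt a) - 1 / 2)
     - 2 * c * (std_normal_cdf (c * sqrt a) - 1 / 2)
     + 2 / sqrt a * (std_normal_density (beta_const * sqrt a) - std_normal_density (c * sqrt a))"

definition psi_0 :: "real \<Rightarrow> real" where
  "psi_0 q =
     exp (- \<eta> * a) *
       (2 / sqrt a * std_normal_density ((q - c * a) / sqrt a)
        - 2 * c * std_normal_cdf ((q - c * a) / sqrt a))"

definition psi_1 :: "real \<Rightarrow> real" where
  "psi_1 q =
     (let cbar = 1 + c in
      exp ((c + 1 / 2 - \<eta>) * a) *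
        (2 / sqrt a * (std_normal_density (cbar * sqrt a)
                       - std_normal_density ((q - cbar * a) / sqrt a))
         + 2 * cbar * (std_normal_cdf (cbar * sqrt a)
                       - std_normal_cdf (- ((q - cbar * a) / sqrt a)))))"

end

end

(* Cut the range of the running maximum into levels of width e. By the strong Markov property the
   blocks between successive first passages of the levels k * e are i.i.d., and tau_0 falls, up to
   discretisation, a time a after the start of the first block that lasts longer than a. Expected rewards therefore solve one-step renewal equations
   E V = E R + F * E V, where F = E[exp (e - eta * T_e); T_e <= a]. The reflection principle, with the
   drift absorbed as a factor exp (- 2 * c * z) that does not depend on time, gives the density of X_s
   on {T_e > s}, hence E R and 1 - F to first order in e. A compactness argument shows that the
   discretised times converge to tau_0 on every continuous path, and dominated convergence gives
   A_0, A_- and A_+ as quotients with denominator nu - 1. Restarting at tau_0 by the strong Markov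
   property makes the value a geometric series with ratio A_+.

   No path measure is constructed: everything is computed under the image measure of M on the space
   of continuous paths. *)
theory Submission
  imports Defs "HOL-Real_Asymp.Real_Asymp"
begin

section \<open>Path space\<close>

text \<open>Heuristically, excursions below the running maximum form a Poisson process with the
  level as its time. Per unit of level, an excursion outlives age \<open>a\<close> before the clock
  \<open>\<alpha>\<close> rings at rate \<open>exp (- \<eta> * a) * nu_a\<close>, and the clock
  rings during an excursion of age below \<open>a\<close> at rate
  \<open>nu_alpha + (1 - exp (- \<eta> * a)) * nu_a\<close>. The sum is \<open>nu\<close>; the
  payoff grows like exp of the level, and this growth subtracts the 1 in \<open>nu - 1\<close>. The
  obstacle is integrability. At drift -1/2 exp of the path is a martingale, and exp of its overall
  maximum has infinite mean. The discount has to make up for this: E[exp (- \<eta> * T_1)] lies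
  strictly below exp (- 1), and passage times are additive over levels, so a geometric series
  supplies one integrable majorant for all times and level widths. The threshold \<open>q\<close>
  makes the rewards discontinuous in the drop at tau_0. Limits are therefore taken for continuous
  functions of the drop, which identifies the law of the drop and so covers indicators as
  well.\<close>

text \<open>Paths are extended by \<open>0\<close> to negative times, so that continuity needs no domain restriction.\<close>

definition paths :: "(real \<Rightarrow> real) set" where
  "paths = {x. continuous_on UNIV x \<and> (\<forall>t\<le>0. x t = 0)}"

text \<open>The set of continuous paths is not measurable in a product over uncountably many times;
  \<open>restrict_space\<close> takes the trace of the sigma-algebra on it. On this trace,
  evaluation at random times is measurable.\<close>

definition path_space :: "(real \<Rightarrow> real) measure" where
  "path_space = restrict_space (\<Pi>\<^sub>M t\<in>UNIV. borel) paths"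

text \<open>The clamp \<open>max 0 s\<close> makes the shifted path vanish at negative times and
  hence stay in \<open>paths\<close>.\<close>

definition shift :: "real \<Rightarrow> (real \<Rightarrow> real) \<Rightarrow> real \<Rightarrow> real" where
  "shift t x = (\<lambda>s. x (t + max 0 s) - x t)"

definition stopped :: "real \<Rightarrow> (real \<Rightarrow> real) \<Rightarrow> real \<Rightarrow> real" where
  "stopped t x = (\<lambda>s. x (min s t))"

text \<open>Finitely many dyadic times lie on a common equidistant grid, on which the increments are
  i.i.d.; there the Markov property can be read off. Density of the dyadics and continuity recover
  all other times.\<close>

definition dyadics :: "real set" where
  "dyadics = {real i / 2 ^ n | i n. True}"

definition cylinder :: "(real \<times> real) set \<Rightarrow> (real \<Rightarrow> real) set" where
  "cylinder F = {x\<in>paths. \<forall>p\<in>F. x (fst p) < snd p}"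

lemma space_path_space [simp]: "space path_space = paths"
  by (simp add: path_space_def space_restrict_space space_PiM)

lemma pathsD:
  assumes "x \<in> paths"
  shows "continuous_on A x" "isCont x t" "t \<le> 0 \<Longrightarrow> x t = 0"
  using assms continuous_on_subset[of UNIV x A]
  by (auto simp: paths_def continuous_on_eq_continuous_at)

lemma path_0 [simp]: "x \<in> paths \<Longrightarrow> x 0 = 0"
  by (simp add: paths_def)

lemma measurable_path_spaceI:
  assumes "\<And>w. w \<in> space N \<Longrightarrow> f w \<in> paths"
    and "\<And>t. (\<lambda>w. f w t) \<in> borel_measurable N"
  shows "f \<in> N \<rightarrow>\<^sub>M path_space"
proof -
  have "(\<lambda>w t. f w t) \<in> N \<rightarrow>\<^sub>M (\<Pi>\<^sub>M t\<in>UNIV. borel)"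
    by (rule measurable_PiM_single') (use assms in auto)
  then show ?thesis
    unfolding path_space_def using assms(1) by (intro measurable_restrict_space2) auto
qed

lemma measurable_path_eval_const:
  assumes "f \<in> N \<rightarrow>\<^sub>M path_space"
  shows "(\<lambda>w. f w t) \<in> borel_measurable N"
proof -
  have "(\<lambda>x. x t) \<in> borel_measurable path_space"
    unfolding path_space_def by (intro measurable_restrict_space1) simp
  from measurable_compose[OF assms this] show ?thesis .
qed

text \<open>The lower approximation serves measurability. The upper one is strictly larger than
  \<open>t\<close>, as the approximation of a stopping time requires: the decision to stop has to be
  known by then.\<close>

lemma floor_approx_tendsto:
  fixes t :: real
  shows "(\<lambda>n. real_of_int \<lfloor>t * 2 ^ n\<rfloor> / 2 ^ n) \<longlonglongrightarrow> t"
    "(\<lambda>n. real_of_int (\<lfloor>t * 2 ^ n\<rfloor> + 1) / 2 ^ n) \<longlonglongrightarrow> t"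
proof -
  have lim: "(\<lambda>n. (1 / 2 :: real) ^ n) \<longlonglongrightarrow> 0"
    by (intro LIMSEQ_power_zero) auto
  have l1: "t - (1 / 2) ^ n \<le> real_of_int \<lfloor>t * 2 ^ n\<rfloor> / 2 ^ n" for n
  proof -
    have "t * 2 ^ n - 1 \<le> real_of_int \<lfloor>t * 2 ^ n\<rfloor>" by linarith
    then have "(t * 2 ^ n - 1) / 2 ^ n \<le> real_of_int \<lfloor>t * 2 ^ n\<rfloor> / 2 ^ n"
      by (simp add: divide_right_mono)
    then show ?thesis by (simp add: diff_divide_distrib power_one_over)
  qed
  have l2: "real_of_int \<lfloor>t * 2 ^ n\<rfloor> / 2 ^ n \<le> t" for n
    by (simp add: divide_le_eq)
  show 1: "(\<lambda>n. real_of_int \<lfloor>t * 2 ^ n\<rfloor> / 2 ^ n) \<longlonglongrightarrow> t"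
    by (rule real_tendsto_sandwich[OF _ _ _ tendsto_const])
       (use l1 l2 tendsto_diff[OF tendsto_const lim, of t] in auto)
  show "(\<lambda>n. real_of_int (\<lfloor>t * 2 ^ n\<rfloor> + 1) / 2 ^ n) \<longlonglongrightarrow> t"
    using tendsto_add[OF 1 lim] by (simp add: add_divide_distrib power_one_over)
qed

text \<open>The rounded time takes countably many values, and evaluation at each of them is
  measurable; continuity of the path passes to the limit.\<close>

lemma measurable_path_eval:
  assumes f: "f \<in> N \<rightarrow>\<^sub>M path_space" and [measurable]: "T \<in> borel_measurable N"
  shows "(\<lambda>w. f w (T w :: real)) \<in> borel_measurable N"
proof (rule borel_measurable_LIMSEQ_real)
  fix w assume "w \<in> space N"
  then have "f w \<in> paths" using measurable_space[OF f] by simp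
  then have "isCont (f w) (T w)" by (rule pathsD)
  then show "(\<lambda>n. f w (real_of_int \<lfloor>T w * 2 ^ n\<rfloor> / 2 ^ n)) \<longlonglongrightarrow> f w (T w)"
    using isCont_tendsto_compose floor_approx_tendsto(1) by blast
next
  fix n
  have [measurable]: "(\<lambda>w. \<lfloor>T w * 2 ^ n\<rfloor>) \<in> N \<rightarrow>\<^sub>M count_space UNIV" by measurable
  show "(\<lambda>w. f w (real_of_int \<lfloor>T w * 2 ^ n\<rfloor> / 2 ^ n)) \<in> borel_measurable N"
    by (rule measurable_compose_countable[where f="\<lambda>i w. f w (real_of_int i / 2 ^ n)"])
       (use measurable_path_eval_const[OF f] in measurable)
qed

lemma measurable_eval [measurable (raw)]:
  assumes "T \<in> borel_measurable path_space"
  shows "(\<lambda>x. x (T x :: real)) \<in> borel_measurable path_space"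
  by (rule measurable_path_eval[OF measurable_ident assms, simplified])

lemma shift_paths [simp, intro]: "x \<in> paths \<Longrightarrow> shift t x \<in> paths"
  unfolding paths_def shift_def
  by (auto intro!: continuous_intros continuous_on_compose2[of UNIV x])

lemma stopped_paths [simp, intro]: "x \<in> paths \<Longrightarrow> stopped t x \<in> paths"
  unfolding paths_def stopped_def
  by (auto intro!: continuous_intros continuous_on_compose2[of UNIV x])

lemma measurable_shift [measurable (raw)]:
  assumes f: "f \<in> N \<rightarrow>\<^sub>M path_space" and [measurable]: "T \<in> borel_measurable N"
  shows "(\<lambda>w. shift (T w) (f w)) \<in> N \<rightarrow>\<^sub>M path_space"
proof (rule measurable_path_spaceI)
  fix w assume "w \<in> space N"
  then show "shift (T w) (f w) \<in> paths" using measurable_space[OF f] by auto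
next
  fix t show "(\<lambda>w. shift (T w) (f w) t) \<in> borel_measurable N"
    unfolding shift_def by (intro borel_measurable_diff measurable_path_eval[OF f]) measurable
qed

lemma measurable_stopped [measurable (raw)]:
  assumes f: "f \<in> N \<rightarrow>\<^sub>M path_space" and [measurable]: "T \<in> borel_measurable N"
  shows "(\<lambda>w. stopped (T w) (f w)) \<in> N \<rightarrow>\<^sub>M path_space"
proof (rule measurable_path_spaceI)
  fix w assume "w \<in> space N"
  then show "stopped (T w) (f w) \<in> paths" using measurable_space[OF f] by auto
next
  fix t show "(\<lambda>w. stopped (T w) (f w) t) \<in> borel_measurable N"
    unfolding stopped_def by (intro measurable_path_eval[OF f]) measurable
qed

lemma dyadics_floor: "(t::real) \<ge> 0 \<Longrightarrow> real_of_int \<lfloor>t * 2 ^ n\<rfloor> / 2 ^ n \<in> dyadics"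
  unfolding dyadics_def
  by (rule CollectI, intro exI[of _ "nat \<lfloor>t * 2 ^ n\<rfloor>"] exI[of _ n]) (simp add: of_nat_nat)

section \<open>Dyadic cylinders as a generating pi-system\<close>

lemma cylinder_sets [measurable]: "finite F \<Longrightarrow> cylinder F \<in> sets path_space"
proof -
  assume F: "finite F"
  have "{x\<in>space path_space. \<forall>p\<in>F. x (fst p) < snd p} \<in> sets path_space"
    using F by measurable
  then show ?thesis by (simp add: cylinder_def)
qed

text \<open>The nontrivial inclusion is measurability of every coordinate with respect to the dyadic
  ones: a coordinate vanishes at nonpositive times and is a limit of dyadic coordinates
  otherwise.\<close>

lemma sets_path_space_generated:
  "sets path_space = sigma_sets paths {cylinder F |F. finite F \<and> fst ` F \<subseteq> dyadics}"
    (is "_ = sigma_sets paths ?E")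
proof
  have E: "?E \<subseteq> Pow paths" by (auto simp: cylinder_def)
  let ?N = "sigma paths ?E"
  have spN: "space ?N = paths" by (simp add: E space_measure_of_conv)
  have dy: "(\<lambda>x. x t) \<in> borel_measurable ?N" if "t \<in> dyadics" for t
  proof (subst borel_measurable_iff_less, safe)
    fix b
    have "{w \<in> space ?N. w t < b} = cylinder {(t, b)}"
      by (simp only: spN) (simp add: cylinder_def)
    also have "\<dots> \<in> sets ?N"
      using that E by (auto simp: sets_measure_of intro!: sigma_sets.Basic exI[of _ "{(t,b)}"])
    finally show "{w \<in> space ?N. w t < b} \<in> sets ?N" .
  qed
  have "(\<lambda>x. x) \<in> ?N \<rightarrow>\<^sub>M path_space"
  proof (rule measurable_path_spaceI)
    fix t :: real
    show "(\<lambda>x. x t) \<in> borel_measurable ?N"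
    proof (cases "t \<le> 0")
      case True
      then have "(\<lambda>x. x t) \<in> borel_measurable ?N \<longleftrightarrow> (\<lambda>x::real\<Rightarrow>real. 0::real) \<in> borel_measurable ?N"
        by (intro measurable_cong) (simp add: spN pathsD)
      then show ?thesis by simp
    next
      case False
      show ?thesis
      proof (rule borel_measurable_LIMSEQ_real)
        fix w assume "w \<in> space ?N"
        then have "isCont w t" using spN pathsD by blast
        then show "(\<lambda>n. w (real_of_int \<lfloor>t * 2 ^ n\<rfloor> / 2 ^ n)) \<longlonglongrightarrow> w t"
          using isCont_tendsto_compose floor_approx_tendsto(1) by blast
      qed (use False in \<open>auto intro!: dy dyadics_floor\<close>)
    qed
  qed (simp add: spN)
  from measurable_sets[OF this] show "sets path_space \<subseteq> sigma_sets paths ?E"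
    using E sets.sets_into_space[of _ path_space]
    by (auto simp: spN sets_measure_of dest!: subsetD Int_absorb2[symmetric])
       (metis (no_types, lifting) Int_absorb2 PowD space_path_space sets.sets_into_space vimage_ident)
  show "sigma_sets paths ?E \<subseteq> sets path_space"
    by (rule sets.sigma_sets_subset[of ?E path_space, simplified space_path_space])
       (auto intro: cylinder_sets)
qed

lemma measure_eqI_path_space:
  assumes sets: "sets N1 = sets path_space" "sets N2 = sets path_space"
    and fin: "emeasure N1 paths \<noteq> \<infinity>"
    and eq: "\<And>F. finite F \<Longrightarrow> fst ` F \<subseteq> dyadics \<Longrightarrow> emeasure N1 (cylinder F) = emeasure N2 (cylinder F)"
  shows "N1 = N2"
proof (rule measure_eqI_generator_eq[where A="\<lambda>_. paths" and \<Omega>=paths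
      and E="{cylinder F |F. finite F \<and> fst ` F \<subseteq> dyadics}"])
  show "Int_stable {cylinder F |F. finite F \<and> fst ` F \<subseteq> dyadics}"
  proof (rule Int_stableI, clarify)
    fix F G :: "(real \<times> real) set"
    assume "finite F" "finite G" "fst ` F \<subseteq> dyadics" "fst ` G \<subseteq> dyadics"
    then show "\<exists>H. cylinder F \<inter> cylinder G = cylinder H \<and> finite H \<and> fst ` H \<subseteq> dyadics"
      by (intro exI[of _ "F \<union> G"]) (auto simp: cylinder_def)
  qed
  show "range (\<lambda>_. paths) \<subseteq> {cylinder F |F. finite F \<and> fst ` F \<subseteq> dyadics}"
    by (auto simp: cylinder_def intro!: exI[of _ "{}"])
qed (use assms sets_path_space_generated in \<open>auto simp: cylinder_def\<close>)

lemma shift_0 [simp]: "x \<in> paths \<Longrightarrow> shift 0 x = x"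
  by (rule ext) (simp add: shift_def max_def pathsD)

lemma shift_shift: "0 \<le> s \<Longrightarrow> shift s (shift t x) = shift (t + s) x"
  by (rule ext) (simp add: shift_def algebra_simps)

section \<open>The strong Markov property\<close>

lemma emeasure_distr_density:
  assumes [measurable]: "f \<in> borel_measurable M" "g \<in> M \<rightarrow>\<^sub>M N" "A \<in> sets N"
  shows "emeasure (distr (density M f) N g) A = (\<integral>\<^sup>+x. f x * indicator A (g x) \<partial>M)"
proof -
  have "emeasure (distr (density M f) N g) A = emeasure (density M f) (g -` A \<inter> space M)"
    by (subst emeasure_distr) auto
  also have "\<dots> = (\<integral>\<^sup>+x. f x * indicator (g -` A \<inter> space M) x \<partial>M)"
    by (rule emeasure_density) measurable
  also have "\<dots> = (\<integral>\<^sup>+x. f x * indicator A (g x) \<partial>M)"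
    by (intro nn_integral_cong) (auto simp: indicator_def)
  finally show ?thesis .
qed

text \<open>Galmarino's criterion instead of a filtration: where \<open>Z\<close> does not vanish, the path up to any time
  after \<open>T\<close> determines both \<open>Z\<close> and \<open>T\<close>. The values of \<open>T\<close> where \<open>Z\<close> vanishes are irrelevant, so a
  stopping time that may be infinite is represented by a real \<open>T\<close> and the event \<open>Z \<noteq> 0\<close>.\<close>

definition adapted :: "((real \<Rightarrow> real) \<Rightarrow> ennreal) \<Rightarrow> ((real \<Rightarrow> real) \<Rightarrow> real) \<Rightarrow> bool" where
  "adapted Z T \<longleftrightarrow> (\<forall>x\<in>paths. \<forall>y\<in>paths. \<forall>t. (\<forall>s\<le>t. x s = y s) \<longrightarrow> Z x \<noteq> 0 \<longrightarrow> T x < t \<longrightarrow>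
     Z y = Z x \<and> T y = T x)"

lemma adaptedD:
  assumes "adapted Z T" "x \<in> paths" "y \<in> paths" "\<And>s. s \<le> t \<Longrightarrow> x s = y s" "Z x \<noteq> 0" "T x < t"
  shows "Z y = Z x" "T y = T x"
  using assms unfolding adapted_def by blast+

text \<open>On the event that \<open>T\<close> lies before \<open>t\<close>, the weight is a
  function of the path stopped at \<open>t\<close>. Adaptedness is applied in both directions: from
  \<open>x\<close> to the stopped path, and back, to exclude that stopping creates an early
  \<open>T\<close>.\<close>

lemma adapted_stopped:
  assumes "adapted Z T" "x \<in> paths"
  shows "(if T x < t \<and> Q (T x) then Z x else 0) =
    (if T (stopped t x) < t \<and> Q (T (stopped t x)) then Z (stopped t x) else 0)"
proof -
  have 1: "s \<le> t \<Longrightarrow> x s = stopped t x s" for s by (simp add: stopped_def)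
  have 2: "s \<le> t \<Longrightarrow> stopped t x s = x s" for s by (simp add: stopped_def)
  let ?y = "stopped t x"
  have y: "?y \<in> paths" using assms(2) by simp
  show ?thesis
  proof (cases "Z x \<noteq> 0 \<and> T x < t")
    case True
    then show ?thesis using adaptedD[OF assms y 1] by simp
  next
    case False
    have "\<not> (Z ?y \<noteq> 0 \<and> T ?y < t)"
    proof
      assume "Z ?y \<noteq> 0 \<and> T ?y < t"
      then show False using False adaptedD[OF assms(1) y assms(2) 2] by simp
    qed
    with False show ?thesis by auto
  qed
qed

text \<open>The Markov property is assumed for dyadic times and cylinders only, since this is what
  grid increments of Brownian motion yield directly. \<open>distr_eval\<close> adds the
  one-dimensional laws, from which all explicit densities are computed.\<close>

locale markov_path = prob_space P for P :: "(real \<Rightarrow> real) measure" +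
  fixes c :: real
  assumes sets_P [measurable_cong]: "sets P = sets path_space"
    and markov_cylinder:
      "\<lbrakk>t \<in> dyadics; finite F; finite G; fst ` F \<subseteq> dyadics; fst ` G \<subseteq> dyadics\<rbrakk> \<Longrightarrow>
        emeasure P {x\<in>paths. stopped t x \<in> cylinder F \<and> shift t x \<in> cylinder G} =
        emeasure P {x\<in>paths. stopped t x \<in> cylinder F} * emeasure P (cylinder G)"
    and distr_eval: "0 < s \<Longrightarrow> distr P borel (\<lambda>x. x s) = density lborel (normal_density (c * s) (sqrt s))"
begin

lemma space_P [simp]: "space P = paths"
  using sets_eq_imp_space_eq[OF sets_P] by simp

lemma emeasure_paths [simp]: "emeasure P paths = 1"
  using emeasure_space_1 by simp

text \<open>Two uniqueness arguments for finite measures: with a cylinder as future, the past is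
  extended from cylinders to all measurable sets; then the past is fixed and the future is
  extended.\<close>

lemma markov_sets:
  assumes t: "t \<in> dyadics" and A: "A \<in> sets path_space" and B: "B \<in> sets path_space"
  shows "emeasure P {x\<in>paths. stopped t x \<in> A \<and> shift t x \<in> B} =
        emeasure P {x\<in>paths. stopped t x \<in> A} * emeasure P B"
proof -
  have 1: "emeasure P {x\<in>paths. stopped t x \<in> A \<and> shift t x \<in> cylinder G} =
        emeasure P {x\<in>paths. stopped t x \<in> A} * emeasure P (cylinder G)"
    if G: "finite G" "fst ` G \<subseteq> dyadics" for G
  proof -
    let ?f = "\<lambda>x. indicator (cylinder G) (shift t x) :: ennreal"
    let ?N1 = "distr (density P ?f) path_space (stopped t)"
    let ?N2 = "scale_measure (emeasure P (cylinder G)) (distr P path_space (stopped t))"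
    have [measurable]: "cylinder G \<in> sets path_space" using G by simp
    have e1: "emeasure ?N1 A = emeasure P {x\<in>paths. stopped t x \<in> A \<and> shift t x \<in> cylinder G}"
      if [measurable]: "A \<in> sets path_space" for A
    proof -
      have "emeasure ?N1 A = (\<integral>\<^sup>+x. ?f x * indicator A (stopped t x) \<partial>P)"
        by (rule emeasure_distr_density) measurable
      also have "\<dots> = (\<integral>\<^sup>+x. indicator {x\<in>space P. stopped t x \<in> A \<and> shift t x \<in> cylinder G} x \<partial>P)"
        by (intro nn_integral_cong) (auto simp: indicator_def)
      also have "\<dots> = emeasure P {x\<in>space P. stopped t x \<in> A \<and> shift t x \<in> cylinder G}"
        by (rule nn_integral_indicator) measurable
      finally show ?thesis by simp
    qed
    have e2: "emeasure ?N2 A = emeasure P {x\<in>paths. stopped t x \<in> A} * emeasure P (cylinder G)"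
      if [measurable]: "A \<in> sets path_space" for A
    proof -
      have "stopped t -` A \<inter> paths = {x\<in>paths. stopped t x \<in> A}" by auto
      then show ?thesis
        by (simp add: emeasure_distr mult.commute)
    qed
    have "?N1 = ?N2"
    proof (rule measure_eqI_path_space)
      show "emeasure ?N1 paths \<noteq> \<infinity>"
        using e1[OF sets.top[of path_space, simplified]] by (simp add: emeasure_eq_measure)
      fix F :: "(real \<times> real) set" assume F: "finite F" "fst ` F \<subseteq> dyadics"
      show "emeasure ?N1 (cylinder F) = emeasure ?N2 (cylinder F)"
        unfolding e1[OF cylinder_sets[OF F(1)]] e2[OF cylinder_sets[OF F(1)]]
        by (rule markov_cylinder[OF t F(1) G(1) F(2) G(2)])
    qed auto
    with e1[OF A] e2[OF A] show ?thesis by simp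
  qed
  let ?f = "\<lambda>x. indicator A (stopped t x) :: ennreal"
  let ?N1 = "distr (density P ?f) path_space (shift t)"
  let ?N2 = "scale_measure (emeasure P {x\<in>paths. stopped t x \<in> A}) P"
  have [measurable]: "A \<in> sets path_space" by fact
  have e1: "emeasure ?N1 B = emeasure P {x\<in>paths. stopped t x \<in> A \<and> shift t x \<in> B}"
    if [measurable]: "B \<in> sets path_space" for B
  proof -
    have "emeasure ?N1 B = (\<integral>\<^sup>+x. ?f x * indicator B (shift t x) \<partial>P)"
      by (rule emeasure_distr_density) measurable
    also have "\<dots> = (\<integral>\<^sup>+x. indicator {x\<in>space P. stopped t x \<in> A \<and> shift t x \<in> B} x \<partial>P)"
      by (intro nn_integral_cong) (auto simp: indicator_def)
    also have "\<dots> = emeasure P {x\<in>space P. stopped t x \<in> A \<and> shift t x \<in> B}"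
      by (rule nn_integral_indicator) measurable
    finally show ?thesis by simp
  qed
  have "?N1 = ?N2"
  proof (rule measure_eqI_path_space)
    show "emeasure ?N1 paths \<noteq> \<infinity>"
      using e1[OF sets.top[of path_space, simplified]] by (simp add: emeasure_eq_measure)
    fix F :: "(real \<times> real) set" assume F: "finite F" "fst ` F \<subseteq> dyadics"
    show "emeasure ?N1 (cylinder F) = emeasure ?N2 (cylinder F)"
      using 1[OF F] F by (simp add: e1)
  qed (auto simp: sets_P)
  with e1[OF B] show ?thesis by simp
qed

text \<open>Stopped and shifted path are independent and the shifted one has law \<open>P\<close>
  again, so their joint law is a product measure.\<close>

lemma markov_nn_integral:
  assumes t: "t \<in> dyadics"
    and [measurable]: "\<Phi> \<in> borel_measurable path_space" "g \<in> borel_measurable path_space"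
  shows "(\<integral>\<^sup>+x. \<Phi> (stopped t x) * g (shift t x) \<partial>P) = (\<integral>\<^sup>+x. \<Phi> (stopped t x) \<partial>P) * (\<integral>\<^sup>+x. g x \<partial>P)"
proof -
  let ?S = "distr P path_space (stopped t)"
  interpret S: prob_space ?S by (rule prob_space_distr) measurable
  have eq: "?S \<Otimes>\<^sub>M P = distr P (path_space \<Otimes>\<^sub>M path_space) (\<lambda>x. (stopped t x, shift t x))"
  proof (rule pair_measure_eqI)
    show "sets (?S \<Otimes>\<^sub>M P) = sets (distr P (path_space \<Otimes>\<^sub>M path_space) (\<lambda>x. (stopped t x, shift t x)))"
      by (simp add: sets_P cong: sets_pair_measure_cong)
    fix A B assume AB: "A \<in> sets ?S" "B \<in> sets P"
    then have [measurable]: "A \<in> sets path_space" "B \<in> sets path_space" by (auto simp: sets_P)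
    have "(\<lambda>x. (stopped t x, shift t x)) -` (A \<times> B) \<inter> space P = {x\<in>paths. stopped t x \<in> A \<and> shift t x \<in> B}"
      "stopped t -` A \<inter> space P = {x\<in>paths. stopped t x \<in> A}"
      by auto
    then show "emeasure ?S A * emeasure P B =
        emeasure (distr P (path_space \<Otimes>\<^sub>M path_space) (\<lambda>x. (stopped t x, shift t x))) (A \<times> B)"
      using markov_sets[OF t, of A B] by (simp add: emeasure_distr)
  qed (unfold_locales)
  have "(\<integral>\<^sup>+x. \<Phi> (stopped t x) * g (shift t x) \<partial>P) =
     (\<integral>\<^sup>+p. \<Phi> (fst p) * g (snd p) \<partial>distr P (path_space \<Otimes>\<^sub>M path_space) (\<lambda>x. (stopped t x, shift t x)))"
    by (subst nn_integral_distr) auto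
  also have "\<dots> = (\<integral>\<^sup>+u. \<integral>\<^sup>+v. \<Phi> u * g v \<partial>P \<partial>?S)"
    by (subst eq[symmetric], subst nn_integral_fst[symmetric]) auto
  also have "\<dots> = (\<integral>\<^sup>+u. \<Phi> u \<partial>?S) * (\<integral>\<^sup>+x. g x \<partial>P)"
    by (simp add: nn_integral_cmult nn_integral_multc)
  also have "(\<integral>\<^sup>+u. \<Phi> u \<partial>?S) = (\<integral>\<^sup>+x. \<Phi> (stopped t x) \<partial>P)"
    by (subst nn_integral_distr) auto
  finally show ?thesis .
qed

text \<open>\<open>T\<close> is replaced by a dyadic approximation from above, the Markov property
  at a fixed time is used for each of its countably many values, and continuity of \<open>g\<close>
  along shifts passes to the limit. The bound on \<open>g\<close> makes \<open>Z\<close> a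
  majorant.\<close>

lemma strong_markov_continuous:
  assumes [measurable]: "Z \<in> borel_measurable path_space" "T \<in> borel_measurable path_space"
      "g \<in> borel_measurable path_space"
    and T: "\<And>x. x \<in> paths \<Longrightarrow> 0 \<le> T x"
    and ad: "adapted Z T" and fin: "(\<integral>\<^sup>+x. Z x \<partial>P) < \<infinity>"
    and g: "\<And>x. g x \<le> 1" "\<And>x t. x \<in> paths \<Longrightarrow> isCont (\<lambda>s. g (shift s x)) t"
  shows "(\<integral>\<^sup>+x. Z x * g (shift (T x) x) \<partial>P) = (\<integral>\<^sup>+x. Z x \<partial>P) * (\<integral>\<^sup>+x. g x \<partial>P)"
proof -
  \<comment> \<open>Adding 1 makes \<open>D j x\<close> strictly larger than \<open>T x\<close>, so
    that adaptedness applies; \<open>z j k\<close> restricts \<open>Z\<close> to the event that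
    \<open>D j\<close> equals \<open>(k + 1) / 2 ^ j\<close>.\<close>
  define D where "D j x = real_of_int (\<lfloor>T x * 2 ^ j\<rfloor> + 1) / 2 ^ j" for j x
  define z where "z j k x = (if T x < real (Suc k) / 2 ^ j \<and> real k / 2 ^ j \<le> T x then Z x else 0)" for j k x
  have [measurable]: "z j k \<in> borel_measurable path_space" "D j \<in> borel_measurable path_space" for j k
    unfolding z_def[abs_def] D_def[abs_def] by measurable
  have iff: "T x < real (Suc k) / 2 ^ j \<and> real k / 2 ^ j \<le> T x \<longleftrightarrow> k = nat \<lfloor>T x * 2 ^ j\<rfloor>"
    if "x \<in> paths" for j k x
  proof -
    have "T x < real (Suc k) / 2 ^ j \<and> real k / 2 ^ j \<le> T x \<longleftrightarrow>
       T x * 2 ^ j < real_of_int (int k) + 1 \<and> real_of_int (int k) \<le> T x * 2 ^ j"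
      by (simp add: field_simps)
    also have "\<dots> \<longleftrightarrow> \<lfloor>T x * 2 ^ j\<rfloor> = int k"
      by (subst floor_eq_iff) auto
    also have "\<dots> \<longleftrightarrow> k = nat \<lfloor>T x * 2 ^ j\<rfloor>"
      using T[OF that] by (auto simp: nat_eq_iff)
    finally show ?thesis .
  qed
  have dec: "Z x * G (D j x) = (\<Sum>k. z j k x * G (real (Suc k) / 2 ^ j))" if x: "x \<in> paths"
    for x j and G :: "real \<Rightarrow> ennreal"
  proof -
    let ?k = "nat \<lfloor>T x * 2 ^ j\<rfloor>"
    have "D j x = real (Suc ?k) / 2 ^ j" using T[OF x] by (simp add: D_def of_nat_nat)
    then have "(\<lambda>k. z j k x * G (real (Suc k) / 2 ^ j)) = (\<lambda>k. if k = ?k then Z x * G (D j x) else 0)"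
      using iff[OF x, of _ j] unfolding z_def by (intro ext) auto
    then show ?thesis using sums_unique[OF sums_single[of ?k "\<lambda>_. Z x * G (D j x)"]] by simp
  qed
  have eq: "(\<integral>\<^sup>+x. Z x * g (shift (D j x) x) \<partial>P) = (\<integral>\<^sup>+x. Z x \<partial>P) * (\<integral>\<^sup>+x. g x \<partial>P)" for j
  proof -
    have k: "(\<integral>\<^sup>+x. z j k x * g (shift (real (Suc k) / 2 ^ j) x) \<partial>P) = (\<integral>\<^sup>+x. z j k x \<partial>P) * (\<integral>\<^sup>+x. g x \<partial>P)" for k
    proof -
      let ?t = "real (Suc k) / 2 ^ j"
      have st: "z j k x = z j k (stopped ?t x)" if "x \<in> paths" for x
        using adapted_stopped[OF ad that, where Q="\<lambda>u. real k / 2 ^ j \<le> u" and t="?t"] by (simp only: z_def)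
      have t: "?t \<in> dyadics" unfolding dyadics_def by (rule CollectI, intro exI[of _ "Suc k"] exI[of _ j]) simp
      have "(\<integral>\<^sup>+x. z j k x * g (shift ?t x) \<partial>P) = (\<integral>\<^sup>+x. z j k (stopped ?t x) * g (shift ?t x) \<partial>P)"
        by (intro nn_integral_cong arg_cong2[where f=times] st refl) simp
      also have "\<dots> = (\<integral>\<^sup>+x. z j k (stopped ?t x) \<partial>P) * (\<integral>\<^sup>+x. g x \<partial>P)"
        by (rule markov_nn_integral[OF t]) measurable
      also have "(\<integral>\<^sup>+x. z j k (stopped ?t x) \<partial>P) = (\<integral>\<^sup>+x. z j k x \<partial>P)"
        by (intro nn_integral_cong st[symmetric]) simp
      finally show ?thesis .
    qed
    have "(\<integral>\<^sup>+x. Z x * g (shift (D j x) x) \<partial>P) = (\<integral>\<^sup>+x. (\<Sum>k. z j k x * g (shift (real (Suc k) / 2 ^ j) x)) \<partial>P)"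
      by (intro nn_integral_cong dec) simp
    also have "\<dots> = (\<Sum>k. \<integral>\<^sup>+x. z j k x * g (shift (real (Suc k) / 2 ^ j) x) \<partial>P)"
      by (rule nn_integral_suminf) measurable
    also have "\<dots> = (\<Sum>k. \<integral>\<^sup>+x. z j k x \<partial>P) * (\<integral>\<^sup>+x. g x \<partial>P)"
      unfolding k by simp
    also have "(\<Sum>k. \<integral>\<^sup>+x. z j k x \<partial>P) = (\<integral>\<^sup>+x. (\<Sum>k. z j k x) \<partial>P)"
      by (rule nn_integral_suminf[symmetric]) measurable
    also have "\<dots> = (\<integral>\<^sup>+x. Z x \<partial>P)"
      by (intro nn_integral_cong) (simp add: dec[of _ "\<lambda>_. 1" j, simplified])
    finally show ?thesis .
  qed
  have "(\<lambda>j. \<integral>\<^sup>+x. Z x * g (shift (D j x) x) \<partial>P) \<longlonglongrightarrow> (\<integral>\<^sup>+x. Z x * g (shift (T x) x) \<partial>P)"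
  proof (rule nn_integral_dominated_convergence[where w=Z])
    show "AE x in P. Z x * g (shift (D j x) x) \<le> Z x" for j
      using mult_left_mono[OF g(1), of "Z _"] by (intro AE_I2) simp
    have "AE x in P. Z x \<noteq> \<infinity>" by (rule nn_integral_PInf_AE) (use fin in auto)
    moreover have "AE x in P. x \<in> paths" by (rule AE_I2) simp
    ultimately show "AE x in P. (\<lambda>j. Z x * g (shift (D j x) x)) \<longlonglongrightarrow> Z x * g (shift (T x) x)"
    proof eventually_elim
      case (elim x)
      have "(\<lambda>j. g (shift (D j x) x)) \<longlonglongrightarrow> g (shift (T x) x)"
        unfolding D_def by (intro isCont_tendsto_compose[OF g(2)] floor_approx_tendsto(2) elim)
      then show ?case using elim by (intro ennreal_tendsto_cmult) (auto simp: less_top)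
    qed
  qed (use fin in auto)
  then show ?thesis unfolding eq by (simp add: LIMSEQ_const_iff)
qed

text \<open>Indicators of cylinders are not continuous along shifts. Being given by finitely many
  strict inequalities, they are limits of products of ramps \<open>min 1 (n * max 0 d)\<close>,
  which are continuous.\<close>

lemma strong_markov_set:
  assumes [measurable]: "Z \<in> borel_measurable path_space" "T \<in> borel_measurable path_space"
    and T: "\<And>x. x \<in> paths \<Longrightarrow> 0 \<le> T x"
    and ad: "adapted Z T" and fin: "(\<integral>\<^sup>+x. Z x \<partial>P) < \<infinity>"
    and B [measurable]: "B \<in> sets path_space"
  shows "(\<integral>\<^sup>+x. Z x * indicator B (shift (T x) x) \<partial>P) = (\<integral>\<^sup>+x. Z x \<partial>P) * emeasure P B"
proof -
  let ?N1 = "distr (density P Z) path_space (\<lambda>x. shift (T x) x)"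
  let ?N2 = "scale_measure (\<integral>\<^sup>+x. Z x \<partial>P) P"
  have e1: "emeasure ?N1 B = (\<integral>\<^sup>+x. Z x * indicator B (shift (T x) x) \<partial>P)"
    if [measurable]: "B \<in> sets path_space" for B
    by (rule emeasure_distr_density) measurable
  have "?N1 = ?N2"
  proof (rule measure_eqI_path_space)
    have "emeasure ?N1 paths = (\<integral>\<^sup>+x. Z x * indicator paths (shift (T x) x) \<partial>P)"
      by (rule e1) (metis sets.top space_path_space)
    also have "\<dots> = (\<integral>\<^sup>+x. Z x \<partial>P)"
      by (intro nn_integral_cong) simp
    finally show "emeasure ?N1 paths \<noteq> \<infinity>" using fin by simp
    fix F :: "(real \<times> real) set" assume F: "finite F"
    define g where "g n y = ennreal (\<Prod>p\<in>F. min 1 (real n * max 0 (snd p - y (fst p))))"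
      for n and y :: "real \<Rightarrow> real"
    have [measurable]: "g n \<in> borel_measurable path_space" for n
      unfolding g_def[abs_def] using F by measurable
    have [measurable]: "cylinder F \<in> sets path_space" using F by simp
    have g1: "g n y \<le> 1" for n y
      unfolding g_def ennreal_le_1 by (intro prod_le_1) auto
    have lim: "(\<lambda>n. g n y) \<longlonglongrightarrow> indicator (cylinder F) y" if "y \<in> paths" for y
    proof -
      have 1: "(\<lambda>n. min 1 (real n * max 0 d)) \<longlonglongrightarrow> of_bool (d > 0)" for d :: real
      proof (cases "d > 0")
        case True
        have "eventually (\<lambda>n. real n \<ge> 1 / d) sequentially"
          using filterlim_real_sequentially unfolding filterlim_at_top by blast
        then have "eventually (\<lambda>n. min 1 (real n * max 0 d) = 1) sequentially"
          by eventually_elim (use True in \<open>auto simp: field_simps min_def\<close>)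
        then show ?thesis using True by (simp add: tendsto_eventually)
      qed auto
      have "(\<lambda>n. \<Prod>p\<in>F. min 1 (real n * max 0 (snd p - y (fst p)))) \<longlonglongrightarrow>
          (\<Prod>p\<in>F. of_bool (snd p - y (fst p) > 0))"
        by (intro tendsto_prod 1)
      then have "(\<lambda>n. g n y) \<longlonglongrightarrow> ennreal (\<Prod>p\<in>F. of_bool (snd p - y (fst p) > 0))"
        unfolding g_def by (rule tendsto_ennrealI)
      also have "(\<Prod>p\<in>F. of_bool (snd p - y (fst p) > 0)) = (of_bool (\<forall>p\<in>F. y (fst p) < snd p) :: real)"
        using F by (induction F) auto
      also have "ennreal \<dots> = indicator (cylinder F) y"
        using that by (simp add: cylinder_def indicator_def)
      finally show ?thesis .
    qed
    have lim1: "(\<lambda>n. \<integral>\<^sup>+x. Z x * g n (shift (T x) x) \<partial>P) \<longlonglongrightarrow> (\<integral>\<^sup>+x. Z x * indicator (cylinder F) (shift (T x) x) \<partial>P)"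
    proof (rule nn_integral_dominated_convergence[where w=Z])
      show "AE x in P. Z x * g n (shift (T x) x) \<le> Z x" for n
        using mult_left_mono[OF g1, of "Z _"] by (intro AE_I2) simp
      have "AE x in P. Z x \<noteq> \<infinity>" by (rule nn_integral_PInf_AE) (use fin in auto)
      moreover have "AE x in P. x \<in> paths" by (rule AE_I2) simp
      ultimately show "AE x in P. (\<lambda>n. Z x * g n (shift (T x) x)) \<longlonglongrightarrow> Z x * indicator (cylinder F) (shift (T x) x)"
        by eventually_elim (intro ennreal_tendsto_cmult lim, auto simp: less_top)
    qed (use fin in auto)
    have eq: "(\<integral>\<^sup>+x. Z x * g n (shift (T x) x) \<partial>P) = (\<integral>\<^sup>+x. Z x \<partial>P) * (\<integral>\<^sup>+x. g n x \<partial>P)" for n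
    proof (rule strong_markov_continuous[OF _ _ _ T ad fin g1])
      fix x t assume x: "x \<in> paths"
      have "isCont (\<lambda>s. x (s + r)) t" for r
        by (rule isCont_o2[where g=x]) (auto intro!: continuous_intros pathsD(2)[OF x])
      then show "isCont (\<lambda>s. g n (shift s x)) t"
        unfolding g_def shift_def isCont_def
        by (intro tendsto_intros) (auto simp: isCont_def intro!: tendsto_intros pathsD(2)[OF x, unfolded isCont_def])
    qed measurable
    have lim2: "(\<lambda>n. (\<integral>\<^sup>+x. Z x \<partial>P) * (\<integral>\<^sup>+x. g n x \<partial>P)) \<longlonglongrightarrow> (\<integral>\<^sup>+x. Z x \<partial>P) * (\<integral>\<^sup>+x. indicator (cylinder F) x \<partial>P)"
    proof (intro ennreal_tendsto_cmult nn_integral_dominated_convergence[where w="\<lambda>_. 1"])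
      show "AE x in P. (\<lambda>n. g n x) \<longlonglongrightarrow> indicator (cylinder F) x"
        using lim by (intro AE_I2) simp
    qed (use fin g1 in \<open>auto simp: less_top emeasure_space_1\<close>)
    have "(\<integral>\<^sup>+x. Z x * indicator (cylinder F) (shift (T x) x) \<partial>P) =
        (\<integral>\<^sup>+x. Z x \<partial>P) * (\<integral>\<^sup>+x. indicator (cylinder F) x \<partial>P)"
      by (rule LIMSEQ_unique[OF lim1[unfolded eq] lim2])
    then show "emeasure ?N1 (cylinder F) = emeasure ?N2 (cylinder F)"
      by (subst e1) (auto simp: sets_P)
  qed (auto simp: sets_P)
  with e1[OF B] show ?thesis by simp
qed

text \<open>An indicator of \<open>T\<close> can be absorbed into the weight without losing
  adaptedness. Hence \<open>T\<close> and the shifted path are independent under the density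
  \<open>Z\<close>, and Fubini covers a \<open>G\<close> that depends on both, such as the restarted
  path at the remaining time \<open>s - T\<close>.\<close>

theorem strong_markov:
  assumes [measurable]: "Z \<in> borel_measurable path_space" "T \<in> borel_measurable path_space"
    and T: "\<And>x. x \<in> paths \<Longrightarrow> 0 \<le> T x"
    and ad: "adapted Z T" and fin: "(\<integral>\<^sup>+x. Z x \<partial>P) < \<infinity>"
    and [measurable]: "G \<in> borel_measurable (borel \<Otimes>\<^sub>M path_space)"
  shows "(\<integral>\<^sup>+x. Z x * G (T x, shift (T x) x) \<partial>P) = (\<integral>\<^sup>+x. Z x * (\<integral>\<^sup>+y. G (T x, y) \<partial>P) \<partial>P)"
proof -
  let ?D = "density P Z"
  let ?S = "distr ?D borel T"
  let ?R = "distr ?D (borel \<Otimes>\<^sub>M path_space) (\<lambda>x. (T x, shift (T x) x))"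
  have eS: "emeasure ?S A = (\<integral>\<^sup>+x. Z x * indicator A (T x) \<partial>P)" if "A \<in> sets borel" for A
    using that by (intro emeasure_distr_density) auto
  interpret S: finite_measure ?S
  proof
    show "emeasure ?S (space ?S) \<noteq> \<infinity>" using eS[of UNIV] fin by simp
  qed
  have eq: "?S \<Otimes>\<^sub>M P = ?R"
  proof (rule pair_measure_eqI)
    show "sets (?S \<Otimes>\<^sub>M P) = sets ?R"
      by (simp add: sets_P cong: sets_pair_measure_cong)
    fix A B assume AB: "A \<in> sets ?S" "B \<in> sets P"
    then have [measurable]: "A \<in> sets borel" "B \<in> sets path_space" by (auto simp: sets_P)
    let ?Z = "\<lambda>x. Z x * indicator A (T x)"
    have "(\<integral>\<^sup>+x. ?Z x \<partial>P) \<le> (\<integral>\<^sup>+x. Z x \<partial>P)"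
      by (intro nn_integral_mono) (auto simp: indicator_def)
    then have "(\<integral>\<^sup>+x. ?Z x \<partial>P) < \<infinity>" using fin by (rule le_less_trans)
    moreover have "adapted ?Z T"
      using ad unfolding adapted_def by (fastforce simp: indicator_def split: if_splits)
    ultimately have "(\<integral>\<^sup>+x. ?Z x * indicator B (shift (T x) x) \<partial>P) = (\<integral>\<^sup>+x. ?Z x \<partial>P) * emeasure P B"
      by (intro strong_markov_set T) auto
    moreover have "emeasure ?R (A \<times> B) = (\<integral>\<^sup>+x. Z x * indicator (A \<times> B) (T x, shift (T x) x) \<partial>P)"
      by (rule emeasure_distr_density) measurable
    moreover have "\<dots> = (\<integral>\<^sup>+x. ?Z x * indicator B (shift (T x) x) \<partial>P)"
      by (intro nn_integral_cong) (auto simp: indicator_def)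
    ultimately show "emeasure ?S A * emeasure P B = emeasure ?R (A \<times> B)"
      by (simp add: eS)
  qed unfold_locales
  have "(\<integral>\<^sup>+x. Z x * G (T x, shift (T x) x) \<partial>P) = (\<integral>\<^sup>+x. G (T x, shift (T x) x) \<partial>?D)"
    by (subst nn_integral_density) auto
  also have "\<dots> = (\<integral>\<^sup>+p. G p \<partial>?R)"
    by (subst nn_integral_distr) auto
  also have "\<dots> = (\<integral>\<^sup>+t. \<integral>\<^sup>+y. G (t, y) \<partial>P \<partial>?S)"
    unfolding eq[symmetric] by (subst nn_integral_fst[symmetric]) auto
  also have "\<dots> = (\<integral>\<^sup>+x. \<integral>\<^sup>+y. G (T x, y) \<partial>P \<partial>?D)"
    by (subst nn_integral_distr) auto
  also have "\<dots> = (\<integral>\<^sup>+x. Z x * (\<integral>\<^sup>+y. G (T x, y) \<partial>P) \<partial>P)"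
    by (subst nn_integral_density) auto
  finally show ?thesis .
qed

corollary strong_markov_mult:
  assumes [measurable]: "Z \<in> borel_measurable path_space" "T \<in> borel_measurable path_space"
    and T: "\<And>x. x \<in> paths \<Longrightarrow> 0 \<le> T x"
    and ad: "adapted Z T" and fin: "(\<integral>\<^sup>+x. Z x \<partial>P) < \<infinity>"
    and [measurable]: "g \<in> borel_measurable path_space"
  shows "(\<integral>\<^sup>+x. Z x * g (shift (T x) x) \<partial>P) = (\<integral>\<^sup>+x. Z x \<partial>P) * (\<integral>\<^sup>+y. g y \<partial>P)"
  using strong_markov[OF assms(1,2) T ad fin, of "\<lambda>p. g (snd p)"]
  by (simp add: nn_integral_multc)

end

section \<open>Running maximum, hitting times and the reflection principle\<close>

lemma running_max_attained:
  assumes "continuous_on {s..t} x" "s \<le> t"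
  obtains u where "u \<in> {s..t}" "x u = running_max x s t" "\<And>v. v \<in> {s..t} \<Longrightarrow> x v \<le> x u"
proof -
  obtain u where u: "u \<in> {s..t}" "\<forall>v\<in>{s..t}. x v \<le> x u"
    using continuous_attains_sup[of "{s..t}" x] assms by (auto simp: compact_Icc)
  then have "running_max x s t = x u"
    unfolding running_max_def by (intro cSup_eq_maximum) auto
  with u that show ?thesis by auto
qed

lemma running_max_upper:
  assumes "continuous_on {s..t} x" "u \<in> {s..t}"
  shows "x u \<le> running_max x s t"
  using running_max_attained[OF assms(1)] assms(2) by (metis atLeastAtMost_iff order_trans)

lemma running_max_le_iff:
  assumes "continuous_on {s..t} x" "s \<le> t"
  shows "running_max x s t \<le> b \<longleftrightarrow> (\<forall>u\<in>{s..t}. x u \<le> b)"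
  using running_max_attained[OF assms] by (metis order_trans)

lemma running_max_eqI:
  assumes "u \<in> {s..t}" "\<And>v. v \<in> {s..t} \<Longrightarrow> x v \<le> x u"
  shows "running_max x s t = x u"
  unfolding running_max_def by (intro cSup_eq_maximum) (use assms in auto)

text \<open>The interval is parametrised by \<open>r\<close> in [0, 1], so that its random endpoints
  enter through evaluation at a random time; by continuity, rational \<open>r\<close> detect the
  maximum. For \<open>T w < S w\<close> the value is the default \<open>Sup {}\<close>.\<close>

lemma measurable_running_max [measurable (raw)]:
  assumes f: "f \<in> N \<rightarrow>\<^sub>M path_space" and [measurable]: "S \<in> borel_measurable N" "T \<in> borel_measurable N"
  shows "(\<lambda>w. running_max (f w) (S w) (T w)) \<in> borel_measurable N"
proof -
  let ?R = "\<lambda>w. running_max (f w) (S w) (max (S w) (T w))"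
  have "?R \<in> borel_measurable N"
  proof (subst borel_measurable_iff_le, safe)
    fix b :: real
    let ?l = "\<lambda>w r. S w + min 1 (max 0 r) * (max (S w) (T w) - S w)"
    have eq: "running_max (f w) (S w) (max (S w) (T w)) \<le> b \<longleftrightarrow> (\<forall>r. f w (?l w (real_of_rat r)) \<le> b)"
      if w: "w \<in> space N" for w
    proof -
      have x: "f w \<in> paths" using measurable_space[OF f w] by simp
      let ?m = "max (S w) (T w)"
      have "(\<forall>r. f w (?l w (real_of_rat r)) \<le> b) \<longleftrightarrow> \<rat> \<subseteq> {r. f w (?l w r) \<le> b}"
        by (auto simp: Rats_def)
      also have "\<dots> \<longleftrightarrow> {r. f w (?l w r) \<le> b} = UNIV"
      proof -
        have "closed {r. f w (?l w r) \<le> b}"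
          by (intro closed_Collect_le continuous_intros continuous_on_compose2[OF pathsD(1)[OF x, of UNIV]]) auto
        then show ?thesis
          using closure_minimal[of \<rat> "{r. f w (?l w r) \<le> b}"] Rats_closure_real by auto
      qed
      also have "\<dots> \<longleftrightarrow> (\<forall>u\<in>{S w..?m}. f w u \<le> b)"
      proof safe
        fix u assume "{r. f w (?l w r) \<le> b} = UNIV" and u: "u \<in> {S w..?m}"
        then have all: "f w (?l w r) \<le> b" for r by auto
        show "f w u \<le> b"
        proof (cases "?m = S w")
          case True with u all[of 0] show ?thesis by auto
        next
          case False
          then have "?m - S w > 0" by auto
          then have "?l w ((u - S w) / (?m - S w)) = u" using u by (auto simp: min_def max_def field_simps)
          then show ?thesis using all[of "(u - S w) / (?m - S w)"] by simp
        qed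
      next
        fix r assume *: "\<forall>u\<in>{S w..?m}. f w u \<le> b"
        have "0 \<le> min 1 (max 0 r) * (?m - S w)" by (intro mult_nonneg_nonneg) auto
        moreover have "min 1 (max 0 r) * (?m - S w) \<le> 1 * (?m - S w)" by (intro mult_right_mono) auto
        ultimately have "?l w r \<in> {S w..?m}" by simp
        with * show "f w (?l w r) \<le> b" by blast
      qed simp
      finally show ?thesis using running_max_le_iff[of "S w" ?m "f w" b] pathsD(1)[OF x] by simp
    qed
    have [measurable]: "(\<lambda>w. f w (?l w (real_of_rat r))) \<in> borel_measurable N" for r
      by (intro measurable_path_eval[OF f]) measurable
    have "{w \<in> space N. \<forall>r. f w (?l w (real_of_rat r)) \<le> b} \<in> sets N" by measurable
    then show "{w \<in> space N. running_max (f w) (S w) (max (S w) (T w)) \<le> b} \<in> sets N"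
      using eq by (simp cong: conj_cong)
  qed
  then have [measurable]: "?R \<in> borel_measurable N" .
  have "(\<lambda>w. running_max (f w) (S w) (T w)) = (\<lambda>w. if S w \<le> T w then ?R w else Sup {})"
    by (rule ext) (auto simp: running_max_def max_def)
  also have "\<dots> \<in> borel_measurable N" by measurable
  finally show ?thesis .
qed

section \<open>First passage times of a level\<close>

definition reaches :: "real \<Rightarrow> (real \<Rightarrow> real) \<Rightarrow> bool" where
  "reaches e x \<longleftrightarrow> (\<exists>t\<ge>0. e \<le> x t)"

text \<open>The value 0 on paths that never reach \<open>e\<close> is a default; wherever the strong
  Markov property is applied, the weight vanishes on these paths.\<close>

definition hit_time :: "real \<Rightarrow> (real \<Rightarrow> real) \<Rightarrow> real" where
  "hit_time e x = (if reaches e x then Inf {t. 0 \<le> t \<and> e \<le> x t} else 0)"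

lemma hit_time:
  assumes x: "x \<in> paths" and e: "0 < e" and r: "reaches e x"
  shows "x (hit_time e x) = e" "0 < hit_time e x" "t < hit_time e x \<Longrightarrow> x t < e"
    and "e \<le> x t \<Longrightarrow> hit_time e x \<le> t"
proof -
  let ?A = "{t. 0 \<le> t \<and> e \<le> x t}"
  have eq: "hit_time e x = Inf ?A" using r by (simp add: hit_time_def)
  have bdd: "bdd_below ?A" by (auto intro!: bdd_belowI[of _ 0])
  have "closed ?A"
    by (intro closed_Collect_conj closed_Collect_le continuous_intros pathsD(1)[OF x])
  moreover have "?A \<noteq> {}" using r by (auto simp: reaches_def)
  ultimately have inA: "hit_time e x \<in> ?A"
    unfolding eq using bdd by (intro closed_contains_Inf)
  have neg: "e \<le> x t \<Longrightarrow> 0 \<le> t" for t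
    using pathsD(3)[OF x, of t] e by (cases "t \<le> 0") auto
  show le: "e \<le> x t \<Longrightarrow> hit_time e x \<le> t" for t
    unfolding eq using neg by (intro cInf_lower bdd) auto
  show "t < hit_time e x \<Longrightarrow> x t < e" using le[of t] by linarith
  obtain u where u: "0 \<le> u" "u \<le> hit_time e x" "x u = e"
    using IVT[of x 0 e "hit_time e x"] inA x e pathsD(2)[OF x] by auto
  with le[of u] show eq: "x (hit_time e x) = e" by simp
  show "0 < hit_time e x" using inA eq e x by (cases "hit_time e x = 0") auto
qed

lemma hit_time_nonneg: "x \<in> paths \<Longrightarrow> 0 < e \<Longrightarrow> 0 \<le> hit_time e x"
  using hit_time(2)[of x e] by (cases "reaches e x") (auto simp: hit_time_def)

lemma reaches_by_iff:
  assumes x: "x \<in> paths" and e: "0 < e"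
  shows "reaches e x \<and> hit_time e x \<le> s \<longleftrightarrow> 0 \<le> s \<and> e \<le> running_max x 0 s"
proof safe
  assume r: "reaches e x" and s: "hit_time e x \<le> s"
  with hit_time(1,2)[OF x e r] running_max_upper[OF pathsD(1)[OF x], of "hit_time e x" 0 s]
  show "0 \<le> s" "e \<le> running_max x 0 s" by auto
next
  assume s: "0 \<le> s" "e \<le> running_max x 0 s"
  then obtain u where "u \<in> {0..s}" "e \<le> x u"
    using running_max_attained[OF pathsD(1)[OF x] s(1)] by metis
  then show r: "reaches e x" by (auto simp: reaches_def)
  show "hit_time e x \<le> s"
    using hit_time(4)[OF x e r, of u] \<open>u \<in> {0..s}\<close> \<open>e \<le> x u\<close> by simp
qed

lemma reaches_iff:
  assumes x: "x \<in> paths" and e: "0 < e"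
  shows "reaches e x \<longleftrightarrow> (\<exists>n::nat. e \<le> running_max x 0 (real n))"
proof
  assume r: "reaches e x"
  obtain n where "hit_time e x \<le> real n" using real_arch_simple by blast
  with r show "\<exists>n. e \<le> running_max x 0 (real n)" using reaches_by_iff[OF x e] by blast
next
  assume "\<exists>n::nat. e \<le> running_max x 0 (real n)"
  then obtain n :: nat where "e \<le> running_max x 0 (real n)" by blast
  then show "reaches e x" using reaches_by_iff[OF x e, of "real n"] by simp
qed

lemma measurable_reaches [measurable]:
  assumes e: "0 < e" shows "Measurable.pred path_space (reaches e)"
proof -
  have "Measurable.pred path_space (reaches e) \<longleftrightarrow>
      Measurable.pred path_space (\<lambda>x. \<exists>n::nat. e \<le> running_max x 0 (real n))"
    by (rule measurable_cong) (simp add: reaches_iff[OF _ e])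
  also have "\<dots>" by measurable
  finally show ?thesis .
qed

lemma measurable_hit_time [measurable]:
  assumes e: "0 < e" shows "hit_time e \<in> borel_measurable path_space"
proof (subst borel_measurable_iff_le, safe)
  fix b :: real
  note [measurable] = measurable_reaches[OF e]
  have "{x \<in> space path_space. (reaches e x \<and> 0 \<le> b \<and> e \<le> running_max x 0 b) \<or> (\<not> reaches e x \<and> 0 \<le> b)} \<in> sets path_space"
    by measurable
  also have "{x \<in> space path_space. (reaches e x \<and> 0 \<le> b \<and> e \<le> running_max x 0 b) \<or> (\<not> reaches e x \<and> 0 \<le> b)} =
     {x \<in> space path_space. hit_time e x \<le> b}"
  proof -
    have "hit_time e x = 0" if "\<not> reaches e x" for x
      using that by (simp add: hit_time_def)
    then have "(reaches e x \<and> 0 \<le> b \<and> e \<le> running_max x 0 b) \<or> (\<not> reaches e x \<and> 0 \<le> b) \<longleftrightarrow>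
        hit_time e x \<le> b" if "x \<in> paths" for x
      using reaches_by_iff[OF that e, of b] by (cases "reaches e x") auto
    then show ?thesis by auto
  qed
  finally show "{x \<in> space path_space. hit_time e x \<le> b} \<in> sets path_space" .
qed

text \<open>A first passage is visible at the moment it happens, so two paths that agree beyond the
  passage of one of them both reach \<open>e\<close>, and each passage time bounds the
  other.\<close>

lemma adapted_hit_time:
  assumes e: "0 < e"
  shows "adapted (\<lambda>x. if reaches e x then k (hit_time e x) else 0) (hit_time e)"
  unfolding adapted_def
proof safe
  fix x y t
  assume x: "x \<in> paths" and y: "y \<in> paths" and xy: "\<forall>s\<le>t. x s = y s"
    and "(if reaches e x then k (hit_time e x) else 0) \<noteq> 0" and t: "hit_time e x < t"
  then have r: "reaches e x" by (auto split: if_splits)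
  note hx = hit_time[OF x e r]
  have "e \<le> y (hit_time e x)" using hx(1) xy t by simp
  then have r': "reaches e y" using hx(2) by (auto simp: reaches_def intro: less_imp_le)
  note hy = hit_time[OF y e r']
  have "hit_time e y \<le> hit_time e x" using hy(4)[of "hit_time e x"] hx(1) xy t by simp
  moreover from this have "hit_time e x \<le> hit_time e y"
    using hx(4)[of "hit_time e y"] hy(1) xy t by simp
  ultimately show "hit_time e y = hit_time e x" by simp
  then show "(if reaches e y then k (hit_time e y) else 0) = (if reaches e x then k (hit_time e x) else 0)"
    using r r' by simp
qed

section \<open>The reflection principle with drift\<close>

lemma normal_density_reflect:
  assumes "0 < u"
  shows "normal_density (c * u) (sqrt u) (- z) = exp (- 2 * c * z) * normal_density (c * u) (sqrt u) z"
proof -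
  have "- (- z - c * u)\<^sup>2 / (2 * u) = - 2 * c * z + (- (z - c * u)\<^sup>2 / (2 * u))"
    using assms by (simp add: field_simps power2_eq_square)
  then show ?thesis
    using assms by (simp add: normal_density_def exp_add[symmetric] mult_ac)
qed

text \<open>Density of the path at time \<open>s\<close> on the event that level \<open>e\<close>
  has not been reached. The factor \<open>1 - exp (- 2 * e * (e - y) / s)\<close> is the probability
  that a Brownian bridge from 0 to \<open>y\<close> over time \<open>s\<close> stays below
  \<open>e\<close>; it does not involve the drift.\<close>

definition killed_density :: "real \<Rightarrow> real \<Rightarrow> real \<Rightarrow> real \<Rightarrow> real" where
  "killed_density c e s y =
     (if y < e then (1 - exp (- 2 * e * (e - y) / s)) * normal_density (c * s) (sqrt s) y else 0)"

lemma killed_density_nonneg: "0 < e \<Longrightarrow> 0 < s \<Longrightarrow> 0 \<le> killed_density c e s y"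
  by (auto simp: killed_density_def)

lemma measurable_killed_density [measurable]: "killed_density c e s \<in> borel_measurable borel"
  unfolding killed_density_def[abs_def] by measurable

context markov_path
begin

lemma nn_integral_eval:
  assumes "0 < s" and [measurable]: "h \<in> borel_measurable borel"
  shows "(\<integral>\<^sup>+x. h (x s) \<partial>P) = (\<integral>\<^sup>+y. h y * normal_density (c * s) (sqrt s) y \<partial>lborel)"
proof -
  have "(\<integral>\<^sup>+x. h (x s) \<partial>P) = (\<integral>\<^sup>+y. h y \<partial>distr P borel (\<lambda>x. x s))"
    by (subst nn_integral_distr) auto
  also have "\<dots> = (\<integral>\<^sup>+y. h y * normal_density (c * s) (sqrt s) y \<partial>lborel)"
    unfolding distr_eval[OF assms(1)] by (subst nn_integral_density) (auto simp: mult.commute)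
  finally show ?thesis .
qed

text \<open>Reflecting an increment of the drifted process multiplies its density by \<open>exp (- 2 c z)\<close>. This
  factor does not depend on the remaining time, so it passes through the random hitting time and no
  change of measure is needed.\<close>

lemma reflection:
  assumes s: "0 < s" and e: "0 < e" and [measurable]: "h \<in> borel_measurable borel"
  shows "(\<integral>\<^sup>+x. (if e \<le> running_max x 0 s \<and> x s < e then h (x s) else 0) \<partial>P) =
    (\<integral>\<^sup>+x. (if e < x s then h (2 * e - x s) * exp (- 2 * c * (x s - e)) else 0) \<partial>P)"
proof -
  define Z :: "(real \<Rightarrow> real) \<Rightarrow> ennreal" where
    "Z x = (if reaches e x then (if hit_time e x \<le> s then 1 else 0) else 0)" for x
  define G :: "real \<times> (real \<Rightarrow> real) \<Rightarrow> ennreal" where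
    "G = (\<lambda>(t, y). if y (s - t) < 0 then h (e + y (s - t)) else 0)"
  define G' :: "real \<times> (real \<Rightarrow> real) \<Rightarrow> ennreal" where
    "G' = (\<lambda>(t, y). if 0 < y (s - t) then h (e - y (s - t)) * exp (- 2 * c * y (s - t)) else 0)"
  note [measurable] = measurable_reaches[OF e] measurable_hit_time[OF e]
  have ev [measurable]: "(\<lambda>p. snd p (s - fst p)) \<in> borel_measurable (borel \<Otimes>\<^sub>M path_space)"
    by (rule measurable_path_eval) measurable
  have [measurable]: "Z \<in> borel_measurable path_space"
    unfolding Z_def[abs_def] by measurable
  have [measurable]: "G \<in> borel_measurable (borel \<Otimes>\<^sub>M path_space)" "G' \<in> borel_measurable (borel \<Otimes>\<^sub>M path_space)"
    unfolding G_def G'_def split_beta' by measurable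
  have ad: "adapted Z (hit_time e)"
    unfolding Z_def by (rule adapted_hit_time[OF e, where k="\<lambda>t. if t \<le> s then 1 else 0"])
  have "(\<integral>\<^sup>+x. Z x \<partial>P) \<le> (\<integral>\<^sup>+x. 1 \<partial>P)"
    by (intro nn_integral_mono) (simp add: Z_def)
  then have fin: "(\<integral>\<^sup>+x. Z x \<partial>P) < \<infinity>"
    by (rule le_less_trans) simp
  note T0 = hit_time_nonneg[OF _ e]
  have Z_iff: "Z x = (if e \<le> running_max x 0 s then 1 else 0)" if "x \<in> paths" for x
    using reaches_by_iff[OF that e, of s] s by (auto simp: Z_def)
  have sh: "shift (hit_time e x) x (s - hit_time e x) = x s - e" if x: "x \<in> paths" and "Z x \<noteq> 0" for x
  proof -
    have r: "reaches e x" "hit_time e x \<le> s" using that by (auto simp: Z_def split: if_splits)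
    then show ?thesis using hit_time(1)[OF x e r(1)] by (simp add: shift_def)
  qed
  have GG: "(\<integral>\<^sup>+y. G (t, y) \<partial>P) = (\<integral>\<^sup>+y. G' (t, y) \<partial>P)" if "t \<le> s" for t
  proof (cases "t = s")
    \<comment> \<open>At \<open>t = s\<close> the remaining increment is 0 and both indicators
      vanish; the normal law of the increment is available for a positive remaining time
      only.\<close>
    case True
    have "(\<integral>\<^sup>+y. G (t, y) \<partial>P) = (\<integral>\<^sup>+y. 0 \<partial>P)" "(\<integral>\<^sup>+y. G' (t, y) \<partial>P) = (\<integral>\<^sup>+y. 0 \<partial>P)"
      by (intro nn_integral_cong; simp add: G_def G'_def True)+
    then show ?thesis by simp
  next
    case False
    define u where "u = s - t"
    have u: "0 < u" using False that by (simp add: u_def)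
    have "(\<integral>\<^sup>+y. G (t, y) \<partial>P) = (\<integral>\<^sup>+y. (\<lambda>z. if z < 0 then h (e + z) else 0) (y u) \<partial>P)"
      by (simp only: G_def u_def prod.case)
    also have "\<dots> = (\<integral>\<^sup>+z. (if z < 0 then h (e + z) else 0) * normal_density (c * u) (sqrt u) z \<partial>lborel)"
      by (rule nn_integral_eval[OF u]) measurable
    also have "\<dots> = (\<integral>\<^sup>+z. (if - z < 0 then h (e - z) else 0) * normal_density (c * u) (sqrt u) (- z) \<partial>lborel)"
      by (subst nn_integral_real_affine[where c="-1" and t=0]) (auto cong: if_cong)
    also have "\<dots> = (\<integral>\<^sup>+z. (if 0 < z then h (e - z) * exp (- 2 * c * z) else 0) * normal_density (c * u) (sqrt u) z \<partial>lborel)"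
      unfolding normal_density_reflect[OF u]
      by (intro nn_integral_cong) (simp add: ennreal_mult mult_ac)
    also have "\<dots> = (\<integral>\<^sup>+y. (\<lambda>z. if 0 < z then h (e - z) * exp (- 2 * c * z) else 0) (y u) \<partial>P)"
      by (rule nn_integral_eval[OF u, symmetric]) measurable
    also have "\<dots> = (\<integral>\<^sup>+y. G' (t, y) \<partial>P)"
      by (simp only: G'_def u_def prod.case)
    finally show ?thesis .
  qed
  have "(\<integral>\<^sup>+x. (if e \<le> running_max x 0 s \<and> x s < e then h (x s) else 0) \<partial>P) =
      (\<integral>\<^sup>+x. Z x * G (hit_time e x, shift (hit_time e x) x) \<partial>P)"
  proof (intro nn_integral_cong)
    fix x assume "x \<in> space P" then have x: "x \<in> paths" by simp
    show "(if e \<le> running_max x 0 s \<and> x s < e then h (x s) else 0) = Z x * G (hit_time e x, shift (hit_time e x) x)"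
      using Z_iff[OF x] sh[OF x] by (auto simp: G_def)
  qed
  also have "\<dots> = (\<integral>\<^sup>+x. Z x * (\<integral>\<^sup>+y. G (hit_time e x, y) \<partial>P) \<partial>P)"
    by (rule strong_markov) (use T0 ad fin in auto)
  also have "\<dots> = (\<integral>\<^sup>+x. Z x * (\<integral>\<^sup>+y. G' (hit_time e x, y) \<partial>P) \<partial>P)"
    by (intro nn_integral_cong) (auto simp: Z_def GG)
  also have "\<dots> = (\<integral>\<^sup>+x. Z x * G' (hit_time e x, shift (hit_time e x) x) \<partial>P)"
    by (rule strong_markov[symmetric]) (use T0 ad fin in auto)
  also have "\<dots> = (\<integral>\<^sup>+x. (if e < x s then h (2 * e - x s) * exp (- 2 * c * (x s - e)) else 0) \<partial>P)"
  proof (intro nn_integral_cong)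
    fix x assume "x \<in> space P" then have x: "x \<in> paths" by simp
    have "e \<le> running_max x 0 s" if "e < x s"
      using running_max_upper[OF pathsD(1)[OF x], of s 0 s] s that by simp
    moreover have "e - (x s - e) = 2 * e - x s" by simp
    ultimately show "Z x * G' (hit_time e x, shift (hit_time e x) x) =
        (if e < x s then h (2 * e - x s) * exp (- 2 * c * (x s - e)) else 0)"
      using Z_iff[OF x] sh[OF x] by (auto simp: G'_def)
  qed
  finally show ?thesis .
qed

text \<open>Paths that end below \<open>e\<close> either have reached \<open>e\<close> before, which
  \<open>reflection\<close> and the substitution of \<open>2 * e - y\<close> for \<open>y\<close>
  evaluate, or have not. The bound on \<open>h\<close> keeps the first part finite, so that it can
  be cancelled.\<close>

lemma nn_integral_killed:
  assumes s: "0 < s" and e: "0 < e" and [measurable]: "h \<in> borel_measurable borel"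
    and bd: "\<And>y. h y \<le> ennreal C"
  shows "(\<integral>\<^sup>+x. (if running_max x 0 s < e then h (x s) else 0) \<partial>P) =
    (\<integral>\<^sup>+y. h y * killed_density c e s y \<partial>lborel)"
proof -
  let ?\<phi> = "normal_density (c * s) (sqrt s)"
  let ?E = "\<lambda>y. exp (- 2 * e * (e - y) / s)"
  let ?hit = "\<integral>\<^sup>+x. (if e \<le> running_max x 0 s \<and> x s < e then h (x s) else 0) \<partial>P"
  have "?hit = (\<integral>\<^sup>+x. (\<lambda>y. if e < y then h (2 * e - y) * exp (- 2 * c * (y - e)) else 0) (x s) \<partial>P)"
    by (rule reflection) fact+
  also have "\<dots> = (\<integral>\<^sup>+y. (if e < y then h (2 * e - y) * exp (- 2 * c * (y - e)) else 0) * ?\<phi> y \<partial>lborel)"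
    by (rule nn_integral_eval[OF s]) measurable
  also have "\<dots> = (\<integral>\<^sup>+y. (if e < 2 * e - y then h (2 * e - (2 * e - y)) * exp (- 2 * c * ((2 * e - y) - e)) else 0) * ?\<phi> (2 * e - y) \<partial>lborel)"
    by (subst nn_integral_real_affine[where c="-1" and t="2 * e"]) (auto cong: if_cong)
  also have "\<dots> = (\<integral>\<^sup>+y. h y * ennreal (if y < e then ?E y * ?\<phi> y else 0) \<partial>lborel)"
  proof (intro nn_integral_cong)
    fix y :: real
    \<comment> \<open>Completing squares: the drift factor from the reflection and the density at
      the reflected point combine to a factor free of \<open>c\<close>.\<close>
    have "exp (- 2 * c * ((2 * e - y) - e)) * ?\<phi> (2 * e - y) = ?E y * ?\<phi> y"
    proof -
      have "- 2 * c * ((2 * e - y) - e) + (- ((2 * e - y) - c * s)\<^sup>2 / (2 * s)) = - 2 * e * (e - y) / s + (- (y - c * s)\<^sup>2 / (2 * s))"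
        using s by (simp add: field_simps power2_eq_square)
      then show ?thesis
        using s by (simp add: normal_density_def exp_add[symmetric] mult_ac)
    qed
    then have "h y * ennreal (exp (- 2 * c * ((2 * e - y) - e))) * ennreal (?\<phi> (2 * e - y)) = h y * ennreal (?E y * ?\<phi> y)"
      by (simp add: mult.assoc ennreal_mult''[symmetric] del: ennreal_mult'')
    then show "(if e < 2 * e - y then h (2 * e - (2 * e - y)) * exp (- 2 * c * ((2 * e - y) - e)) else 0) * ?\<phi> (2 * e - y) =
        h y * ennreal (if y < e then ?E y * ?\<phi> y else 0)"
      by (cases "y < e") auto
  qed
  finally have hit: "?hit = (\<integral>\<^sup>+y. h y * ennreal (if y < e then ?E y * ?\<phi> y else 0) \<partial>lborel)" .
  have "?hit \<le> (\<integral>\<^sup>+x. ennreal C \<partial>P)"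
    using bd by (intro nn_integral_mono) auto
  then have fin: "?hit \<noteq> \<infinity>" by (auto simp: top_unique)
  have "(\<integral>\<^sup>+x. (if running_max x 0 s < e then h (x s) else 0) \<partial>P) + ?hit =
      (\<integral>\<^sup>+x. (if running_max x 0 s < e then h (x s) else 0) + (if e \<le> running_max x 0 s \<and> x s < e then h (x s) else 0) \<partial>P)"
    by (rule nn_integral_add[symmetric]) measurable
  also have "\<dots> = (\<integral>\<^sup>+x. (\<lambda>y. if y < e then h y else 0) (x s) \<partial>P)"
  proof (intro nn_integral_cong)
    fix x assume "x \<in> space P" then have x: "x \<in> paths" by simp
    show "(if running_max x 0 s < e then h (x s) else 0) + (if e \<le> running_max x 0 s \<and> x s < e then h (x s) else 0) =
       (\<lambda>y. if y < e then h y else 0) (x s)"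
      using running_max_upper[OF pathsD(1)[OF x], of s 0 s] s by auto
  qed
  also have "\<dots> = (\<integral>\<^sup>+y. (if y < e then h y else 0) * ?\<phi> y \<partial>lborel)"
    by (rule nn_integral_eval[OF s]) measurable
  also have "\<dots> = (\<integral>\<^sup>+y. h y * killed_density c e s y + h y * ennreal (if y < e then ?E y * ?\<phi> y else 0) \<partial>lborel)"
  proof (intro nn_integral_cong)
    fix y :: real
    show "(if y < e then h y else 0) * ?\<phi> y = h y * killed_density c e s y + h y * ennreal (if y < e then ?E y * ?\<phi> y else 0)"
      using killed_density_nonneg[OF e s, of c y]
      by (auto simp: distrib_left[symmetric] ennreal_plus[symmetric] killed_density_def algebra_simps
               simp del: ennreal_plus)
  qed
  also have "\<dots> = (\<integral>\<^sup>+y. h y * killed_density c e s y \<partial>lborel) + ?hit"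
    unfolding hit by (rule nn_integral_add) measurable
  finally show ?thesis using fin by (simp add: ennreal_add_left_cancel add.commute[of _ ?hit])
qed

end

section \<open>Hitting times under drift minus one half\<close>

text \<open>Passage times are additive over levels: \<open>e + h\<close> cannot be reached before
  \<open>e\<close>, and from the passage of \<open>e\<close> on the path has to climb a further
  \<open>h\<close>.\<close>

lemma reaches_shift:
  assumes x: "x \<in> paths" and e: "0 < e" and h: "0 < h" and r: "reaches e x"
  shows "reaches h (shift (hit_time e x) x) \<longleftrightarrow> reaches (e + h) x"
    and "reaches (e + h) x \<Longrightarrow> hit_time (e + h) x = hit_time e x + hit_time h (shift (hit_time e x) x)"
proof -
  let ?T = "hit_time e x" and ?y = "shift (hit_time e x) x"
  note hx = hit_time[OF x e r]
  have y: "?y \<in> paths" using x by simp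
  have val: "?y t = x (?T + t) - e" if "0 \<le> t" for t using that hx(1) by (simp add: shift_def)
  have after: "?T \<le> t" if "e + h \<le> x t" for t using hx(4)[of t] that h by simp
  show iff: "reaches h ?y \<longleftrightarrow> reaches (e + h) x"
  proof
    assume "reaches h ?y"
    then obtain t where "0 \<le> t" "h \<le> ?y t" by (auto simp: reaches_def)
    then show "reaches (e + h) x" unfolding reaches_def
      using val[of t] hx(2) by (intro exI[of _ "?T + t"]) auto
  next
    assume "reaches (e + h) x"
    then obtain t where "e + h \<le> x t" by (auto simp: reaches_def)
    then show "reaches h ?y" unfolding reaches_def
      using val[of "t - ?T"] after[of t] by (intro exI[of _ "t - ?T"]) auto
  qed
  assume r2: "reaches (e + h) x"
  have eh: "0 < e + h" using e h by simp
  note hx2 = hit_time[OF x eh r2] and hy = hit_time[OF y h iff[THEN iffD2, OF r2]]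
  show "hit_time (e + h) x = ?T + hit_time h ?y"
  proof (rule antisym)
    show "hit_time (e + h) x \<le> ?T + hit_time h ?y"
      using hy(1,2) val[of "hit_time h ?y"] by (intro hx2(4)) auto
    have "hit_time h ?y \<le> hit_time (e + h) x - ?T"
      using hx2(1) val[of "hit_time (e + h) x - ?T"] after[of "hit_time (e + h) x"] by (intro hy(4)) auto
    then show "?T + hit_time h ?y \<le> hit_time (e + h) x" by simp
  qed
qed

definition hit_discount :: "real \<Rightarrow> real \<Rightarrow> (real \<Rightarrow> real) \<Rightarrow> real" where
  "hit_discount \<eta> e x = (if reaches e x then exp (- \<eta> * hit_time e x) else 0)"

lemma measurable_hit_discount [measurable]:
  assumes e: "0 < e" shows "hit_discount \<eta> e \<in> borel_measurable path_space"
proof -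
  note [measurable] = measurable_reaches[OF e] measurable_hit_time[OF e]
  show ?thesis unfolding hit_discount_def[abs_def] by measurable
qed

lemma adapted_hit_discount:
  assumes "0 < e" shows "adapted (\<lambda>x. ennreal (hit_discount \<eta> e x)) (hit_time e)"
proof -
  have "(\<lambda>x. ennreal (hit_discount \<eta> e x)) = (\<lambda>x. if reaches e x then ennreal (exp (- \<eta> * hit_time e x)) else 0)"
    by (rule ext) (simp add: hit_discount_def)
  then show ?thesis using adapted_hit_time[OF assms, of "\<lambda>t. ennreal (exp (- \<eta> * t))"] by simp
qed

locale half_drift = markov_path P "- 1 / 2" for P
begin

text \<open>Multiplying the normal density by \<open>exp y\<close> moves its mean by the variance
  \<open>u\<close>, from \<open>- u / 2\<close> to \<open>u / 2\<close>; at this drift no constant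
  factor remains.\<close>

lemma exp_martingale:
  assumes "0 \<le> u"
  shows "(\<integral>\<^sup>+x. exp (x u) \<partial>P) = 1"
proof (cases "u = 0")
  case True
  have "(\<integral>\<^sup>+x. exp (x u) \<partial>P) = (\<integral>\<^sup>+x. 1 \<partial>P)"
    using True by (intro nn_integral_cong) simp
  then show ?thesis by simp
next
  case False
  with assms have u: "0 < u" by simp
  have "(\<integral>\<^sup>+x. exp (x u) \<partial>P) = (\<integral>\<^sup>+y. ennreal (exp y) * normal_density (- 1 / 2 * u) (sqrt u) y \<partial>lborel)"
    by (rule nn_integral_eval[OF u, of "\<lambda>y. ennreal (exp y)"]) measurable
  also have "\<dots> = (\<integral>\<^sup>+y. normal_density (u / 2) (sqrt u) y \<partial>lborel)"
  proof (intro nn_integral_cong)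
    fix y
    have "y + (- (y - - 1 / 2 * u)\<^sup>2 / (2 * u)) = - (y - u / 2)\<^sup>2 / (2 * u)"
      using u by (simp add: field_simps power2_eq_square)
    then have "exp y * normal_density (- 1 / 2 * u) (sqrt u) y = normal_density (u / 2) (sqrt u) y"
      using u by (simp add: normal_density_def exp_add[symmetric] mult_ac)
    then show "ennreal (exp y) * normal_density (- 1 / 2 * u) (sqrt u) y = normal_density (u / 2) (sqrt u) y"
      by (simp add: ennreal_mult[symmetric])
  qed
  also have "\<dots> = 1"
  proof -
    interpret N: prob_space "density lborel (normal_density (u / 2) (sqrt u))"
      by (rule prob_space_normal_density) (use u in simp)
    show ?thesis using N.emeasure_space_1 by (simp add: emeasure_density)
  qed
  finally show ?thesis .
qed

text \<open>Doob's maximal inequality by hand: on the event, \<open>exp (x s)\<close> is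
  \<open>exp e\<close> times exp of the restarted path at the remaining time, which has mean 1 by
  the strong Markov property. So \<open>exp e\<close> times the probability is at most the mean 1 of
  \<open>exp (x s)\<close>.\<close>

lemma emeasure_reaches_by_le:
  assumes e: "0 < e"
  shows "emeasure P {x\<in>paths. reaches e x \<and> hit_time e x \<le> s} \<le> exp (- e)"
proof (cases "0 \<le> s")
  case False
  then have "{x\<in>paths. reaches e x \<and> hit_time e x \<le> s} = {}"
    using reaches_by_iff[OF _ e, of _ s] by auto
  then show ?thesis by (simp only: emeasure_empty) simp
next
  case True
  define Z :: "(real \<Rightarrow> real) \<Rightarrow> ennreal" where
    "Z x = (if reaches e x then (if hit_time e x \<le> s then 1 else 0) else 0)" for x
  note [measurable] = measurable_reaches[OF e] measurable_hit_time[OF e]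
  have [measurable]: "Z \<in> borel_measurable path_space"
    unfolding Z_def[abs_def] by measurable
  have ev [measurable]: "(\<lambda>p. snd p (s - fst p)) \<in> borel_measurable (borel \<Otimes>\<^sub>M path_space)"
    by (rule measurable_path_eval) measurable
  have [measurable]: "(\<lambda>x. shift (hit_time e x) x (s - hit_time e x)) \<in> borel_measurable P"
    by (rule measurable_path_eval) measurable
  have ad: "adapted Z (hit_time e)"
    unfolding Z_def by (rule adapted_hit_time[OF e, where k="\<lambda>t. if t \<le> s then 1 else 0"])
  have "(\<integral>\<^sup>+x. Z x \<partial>P) \<le> (\<integral>\<^sup>+x. 1 \<partial>P)"
    by (intro nn_integral_mono) (simp add: Z_def)
  then have fin: "(\<integral>\<^sup>+x. Z x \<partial>P) < \<infinity>"
    by (rule le_less_trans) simp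
  have "emeasure P {x\<in>paths. reaches e x \<and> hit_time e x \<le> s} = (\<integral>\<^sup>+x. indicator {x\<in>space P. reaches e x \<and> hit_time e x \<le> s} x \<partial>P)"
    unfolding space_P[symmetric] by (rule nn_integral_indicator[symmetric]) measurable
  also have "\<dots> = (\<integral>\<^sup>+x. Z x \<partial>P)"
    by (intro nn_integral_cong) (auto simp: Z_def)
  finally have 1: "emeasure P {x\<in>paths. reaches e x \<and> hit_time e x \<le> s} = (\<integral>\<^sup>+x. Z x \<partial>P)" .
  have "ennreal (exp e) * (\<integral>\<^sup>+x. Z x \<partial>P) = ennreal (exp e) * (\<integral>\<^sup>+x. Z x * (\<integral>\<^sup>+y. exp (y (s - hit_time e x)) \<partial>P) \<partial>P)"
    by (intro arg_cong2[where f=times] nn_integral_cong refl) (auto simp: Z_def exp_martingale)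
  also have "\<dots> = ennreal (exp e) * (\<integral>\<^sup>+x. Z x * exp (shift (hit_time e x) x (s - hit_time e x)) \<partial>P)"
    using strong_markov[of Z "hit_time e" "\<lambda>p. ennreal (exp (snd p (s - fst p)))"] hit_time_nonneg[OF _ e] ad fin
    by simp
  also have "\<dots> = (\<integral>\<^sup>+x. ennreal (exp e) * (Z x * exp (shift (hit_time e x) x (s - hit_time e x))) \<partial>P)"
    by (rule nn_integral_cmult[symmetric]) measurable
  also have "\<dots> \<le> (\<integral>\<^sup>+x. exp (x s) \<partial>P)"
  proof (intro nn_integral_mono)
    fix x assume "x \<in> space P" then have x: "x \<in> paths" by simp
    show "ennreal (exp e) * (Z x * exp (shift (hit_time e x) x (s - hit_time e x))) \<le> exp (x s)"
      using hit_time(1)[OF x e] by (auto simp: Z_def shift_def ennreal_mult[symmetric] exp_add[symmetric])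
  qed
  also have "\<dots> = 1" using exp_martingale[OF True] .
  finally have "ennreal (exp (- e)) * (ennreal (exp e) * (\<integral>\<^sup>+x. Z x \<partial>P)) \<le> ennreal (exp (- e)) * 1"
    by (rule mult_left_mono) simp
  then show ?thesis
    unfolding 1 by (simp add: mult.assoc[symmetric] ennreal_mult[symmetric] exp_add[symmetric])
qed

lemma emeasure_reaches_le:
  assumes e: "0 < e"
  shows "emeasure P {x\<in>paths. reaches e x} \<le> exp (- e)"
proof -
  note [measurable] = measurable_reaches[OF e] measurable_hit_time[OF e]
  have "(SUP n::nat. emeasure P {x\<in>paths. reaches e x \<and> hit_time e x \<le> real n}) =
      emeasure P (\<Union>n::nat. {x\<in>paths. reaches e x \<and> hit_time e x \<le> real n})"
  proof (rule SUP_emeasure_incseq)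
    have "{x\<in>space P. reaches e x \<and> hit_time e x \<le> real n} \<in> sets P" for n by measurable
    then show "range (\<lambda>n. {x\<in>paths. reaches e x \<and> hit_time e x \<le> real n}) \<subseteq> sets P" by auto
    show "incseq (\<lambda>n. {x\<in>paths. reaches e x \<and> hit_time e x \<le> real n})"
      by (auto simp: incseq_def intro: order_trans)
  qed
  also have "(\<Union>n::nat. {x\<in>paths. reaches e x \<and> hit_time e x \<le> real n}) = {x\<in>paths. reaches e x}"
    using real_arch_simple by auto
  finally have eq: "(SUP n::nat. emeasure P {x\<in>paths. reaches e x \<and> hit_time e x \<le> real n}) =
    emeasure P {x\<in>paths. reaches e x}" .
  show ?thesis unfolding eq[symmetric] by (rule SUP_least) (rule emeasure_reaches_by_le[OF e])
qed

text \<open>The strict inequality is the purpose: passage times are positive, so the discount is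
  strictly below 1 wherever \<open>e\<close> is reached; if \<open>e\<close> is almost never
  reached, the integral is 0.\<close>

lemma hit_discount_less:
  assumes e: "0 < e" and \<eta>: "0 < \<eta>"
  shows "(\<integral>\<^sup>+x. hit_discount \<eta> e x \<partial>P) < exp (- e)"
proof -
  note [measurable] = measurable_reaches[OF e] measurable_hit_time[OF e] measurable_hit_discount[OF e]
  let ?R = "{x\<in>space P. reaches e x}"
  have R [measurable]: "?R \<in> sets P" by measurable
  have le: "ennreal (hit_discount \<eta> e x) \<le> indicator ?R x" if "x \<in> paths" for x
    using hit_time_nonneg[OF that e] \<eta> that by (auto simp: hit_discount_def)
  have int: "(\<integral>\<^sup>+x. indicator ?R x \<partial>P) = emeasure P ?R"
    by (rule nn_integral_indicator[OF R])
  have Rle: "emeasure P ?R \<le> exp (- e)" using emeasure_reaches_le[OF e] by simp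
  show ?thesis
  proof (cases "emeasure P ?R = 0")
    case True
    have "(\<integral>\<^sup>+x. hit_discount \<eta> e x \<partial>P) \<le> (\<integral>\<^sup>+x. indicator ?R x \<partial>P)"
      using le by (intro nn_integral_mono) simp
    then show ?thesis using True unfolding int by simp
  next
    case False
    have "(\<integral>\<^sup>+x. hit_discount \<eta> e x \<partial>P) < (\<integral>\<^sup>+x. indicator ?R x \<partial>P)"
    proof (rule nn_integral_less)
      have "(\<integral>\<^sup>+x. hit_discount \<eta> e x \<partial>P) \<le> (\<integral>\<^sup>+x. indicator ?R x \<partial>P)"
        using le by (intro nn_integral_mono) simp
      also have "\<dots> < \<infinity>" unfolding int by (simp add: emeasure_eq_measure)
      finally show "(\<integral>\<^sup>+x. hit_discount \<eta> e x \<partial>P) \<noteq> \<infinity>" by simp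
      show "\<not> (AE x in P. indicator ?R x \<le> ennreal (hit_discount \<eta> e x))"
      proof
        assume "AE x in P. indicator ?R x \<le> ennreal (hit_discount \<eta> e x)"
        then have "AE x in P. x \<notin> ?R"
        proof (eventually_elim, safe)
          fix x assume x: "x \<in> space P" "reaches e x" and "indicator ?R x \<le> ennreal (hit_discount \<eta> e x)"
          then have "1 \<le> exp (- \<eta> * hit_time e x)" by (simp add: hit_discount_def)
          then show False using hit_time(2)[of x e] x e \<eta> by (simp add: mult_le_0_iff)
        qed
        moreover have "{x\<in>space P. \<not> x \<notin> ?R} = ?R" by auto
        ultimately show False using False AE_iff_measurable[OF R, of "\<lambda>x. x \<notin> ?R"] by blast
      qed
    qed (use le R in \<open>auto intro!: borel_measurable_indicator\<close>)
    then show ?thesis using Rle unfolding int by (rule less_le_trans)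
  qed
qed

text \<open>Additivity of passage times becomes multiplicativity under the strong Markov property,
  so the transform at integer levels is a power.\<close>

lemma hit_discount_mult:
  assumes e: "0 < e" and h: "0 < h" and \<eta>: "0 < \<eta>"
  shows "(\<integral>\<^sup>+x. hit_discount \<eta> (e + h) x \<partial>P) = (\<integral>\<^sup>+x. hit_discount \<eta> e x \<partial>P) * (\<integral>\<^sup>+x. hit_discount \<eta> h x \<partial>P)"
proof -
  note [measurable] = measurable_hit_time[OF e] measurable_hit_discount[OF e] measurable_hit_discount[OF h]
  have "(\<integral>\<^sup>+x. hit_discount \<eta> (e + h) x \<partial>P) =
      (\<integral>\<^sup>+x. ennreal (hit_discount \<eta> e x) * ennreal (hit_discount \<eta> h (shift (hit_time e x) x)) \<partial>P)"
  proof (intro nn_integral_cong)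
    fix x assume "x \<in> space P" then have x: "x \<in> paths" by simp
    have "reaches (e + h) x \<Longrightarrow> reaches e x" using h by (force simp: reaches_def)
    then show "ennreal (hit_discount \<eta> (e + h) x) = ennreal (hit_discount \<eta> e x) * ennreal (hit_discount \<eta> h (shift (hit_time e x) x))"
      using reaches_shift[OF x e h]
      by (auto simp: hit_discount_def ennreal_mult[symmetric] exp_add[symmetric] algebra_simps)
  qed
  also have "\<dots> = (\<integral>\<^sup>+x. hit_discount \<eta> e x \<partial>P) * (\<integral>\<^sup>+x. hit_discount \<eta> h x \<partial>P)"
  proof (rule strong_markov_mult)
    show "(\<integral>\<^sup>+x. hit_discount \<eta> e x \<partial>P) < \<infinity>"
      by (rule less_trans[OF hit_discount_less[OF e \<eta>]]) simp
  qed (use hit_time_nonneg[OF _ e] adapted_hit_discount[OF e] in auto)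
  finally show ?thesis .
qed

text \<open>An integrable majorant that is uniform in time. If \<open>x t\<close> lies between
  \<open>k + 1\<close> and \<open>k + 2\<close>, level \<open>k + 1\<close> has been passed by time
  \<open>t\<close>, so the discounted value is at most \<open>exp (k + 2)\<close> times the discount
  at that passage. The expected series is geometric with ratio \<open>exp 1 * l\<close>, which
  \<open>hit_discount_less\<close> puts below 1.\<close>

lemma discounted_exp_dominated:
  assumes \<eta>: "0 < \<eta>"
  obtains D where "D \<in> borel_measurable path_space" "(\<integral>\<^sup>+x. D x \<partial>P) < \<infinity>"
    "\<And>x t. x \<in> paths \<Longrightarrow> 0 \<le> t \<Longrightarrow> ennreal (exp (x t - \<eta> * t)) \<le> D x"
proof -
  define D where "D x = ennreal (exp 1) + (\<Sum>k. ennreal (exp (real k + 2)) * ennreal (hit_discount \<eta> (real (Suc k)) x))" for x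
  let ?L = "\<lambda>e. \<integral>\<^sup>+x. hit_discount \<eta> e x \<partial>P"
  obtain l where l: "?L 1 = ennreal l" "0 \<le> l"
    using hit_discount_less[of 1 \<eta>] \<eta> by (cases "?L 1") auto
  have l1: "l < exp (- 1)"
    using hit_discount_less[of 1 \<eta>] \<eta> l by (simp add: ennreal_less_iff)
  have pow: "?L (real (Suc k)) = ennreal (l ^ Suc k)" for k
  proof (induction k)
    case (Suc k)
    have "?L (real (Suc (Suc k))) = ?L (real (Suc k)) * ?L 1"
      using hit_discount_mult[of "real (Suc k)" 1 \<eta>] \<eta> by (simp add: algebra_simps)
    then show ?case using Suc l by (simp add: ennreal_mult[symmetric] mult_ac)
  qed (use l in simp)
  have [measurable]: "hit_discount \<eta> (real (Suc k)) \<in> borel_measurable path_space" for k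
    by (rule measurable_hit_discount) simp
  have meas: "D \<in> borel_measurable path_space" unfolding D_def[abs_def] by measurable
  have "(\<integral>\<^sup>+x. D x \<partial>P) = ennreal (exp 1) + (\<Sum>k. ennreal (exp (real k + 2)) * ?L (real (Suc k)))"
    unfolding D_def
    by (simp add: nn_integral_add nn_integral_suminf nn_integral_cmult)
  also have "(\<Sum>k. ennreal (exp (real k + 2)) * ?L (real (Suc k))) = (\<Sum>k. ennreal (exp 1 * (exp 1 * l) ^ Suc k))"
  proof (intro suminf_cong)
    fix k
    have "exp (real k + 2) = exp 1 * exp 1 ^ Suc k"
      by (simp add: exp_of_nat_mult[symmetric] exp_add[symmetric] del: power_Suc)
    then show "ennreal (exp (real k + 2)) * ?L (real (Suc k)) = ennreal (exp 1 * (exp 1 * l) ^ Suc k)"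
      unfolding pow using l(2) by (simp add: ennreal_mult[symmetric] power_mult_distrib mult_ac)
  qed
  also have "\<dots> < \<infinity>"
  proof -
    have "exp 1 * l < exp 1 * exp (- 1 :: real)" using l1 by (intro mult_strict_left_mono) auto
    also have "\<dots> = 1" by (simp add: exp_add[symmetric])
    finally have "summable (\<lambda>k. exp 1 * (exp 1 * l) ^ Suc k)"
      using l(2) by (intro summable_mult) (simp add: summable_Suc_iff del: power_Suc)
    then show ?thesis using l(2)
      by (subst suminf_ennreal2) (auto simp: zero_le_mult_iff)
  qed
  finally have fin: "(\<integral>\<^sup>+x. D x \<partial>P) < \<infinity>" by simp
  have "ennreal (exp (x t - \<eta> * t)) \<le> D x" if x: "x \<in> paths" and t: "0 \<le> t" for x t
  proof (cases "x t < 1")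
    case True
    then have "x t - \<eta> * t \<le> 1" using t \<eta> by (smt (verit) mult_nonneg_nonneg)
    then have "ennreal (exp (x t - \<eta> * t)) \<le> ennreal (exp 1)" by (intro ennreal_leI) simp
    also have "\<dots> \<le> D x" unfolding D_def by simp
    finally show ?thesis .
  next
    case False
    define k where "k = nat \<lfloor>x t\<rfloor> - 1"
    have k: "real (Suc k) \<le> x t" "x t < real k + 2"
      using False unfolding k_def by linarith+
    have r: "reaches (real (Suc k)) x" using k t by (auto simp: reaches_def)
    have h: "hit_time (real (Suc k)) x \<le> t" using hit_time(4)[OF x _ r, of t] k by simp
    have "x t - \<eta> * t \<le> (real k + 2) + - \<eta> * hit_time (real (Suc k)) x"
      using k(2) mult_left_mono[OF h less_imp_le[OF \<eta>]] by linarith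
    then have "exp (x t - \<eta> * t) \<le> exp (real k + 2) * exp (- \<eta> * hit_time (real (Suc k)) x)"
      by (simp add: exp_add[symmetric])
    then have "ennreal (exp (x t - \<eta> * t)) \<le> ennreal (exp (real k + 2)) * ennreal (hit_discount \<eta> (real (Suc k)) x)"
      using r by (simp add: hit_discount_def ennreal_mult[symmetric])
    also have "\<dots> \<le> (\<Sum>k. ennreal (exp (real k + 2)) * ennreal (hit_discount \<eta> (real (Suc k)) x))"
      using sum_le_suminf[of "\<lambda>k. ennreal (exp (real k + 2)) * ennreal (hit_discount \<eta> (real (Suc k)) x)" "{k}"]
      by simp
    also have "\<dots> \<le> D x" unfolding D_def by (simp add: add_increasing)
    finally show ?thesis .
  qed
  with meas fin that show thesis by blast
qed

end

section \<open>Discretised levels\<close>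

text \<open>Block \<open>k\<close> runs from the first passage of level \<open>k e\<close> to that of level \<open>(k + 1) e\<close> and starts at
  \<open>start e k x\<close>; the path stalls at the first block that is not over after time \<open>a\<close>.\<close>

definition fast :: "real \<Rightarrow> real \<Rightarrow> (real \<Rightarrow> real) \<Rightarrow> bool" where
  "fast e a x \<longleftrightarrow> reaches e x \<and> hit_time e x \<le> a"

definition restart :: "real \<Rightarrow> (real \<Rightarrow> real) \<Rightarrow> real \<Rightarrow> real" where
  "restart e x = shift (hit_time e x) x"

definition start :: "real \<Rightarrow> nat \<Rightarrow> (real \<Rightarrow> real) \<Rightarrow> real" where
  "start e k x = (\<Sum>i<k. hit_time e ((restart e ^^ i) x))"

definition stalls :: "real \<Rightarrow> real \<Rightarrow> (real \<Rightarrow> real) \<Rightarrow> bool" where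
  "stalls e a x \<longleftrightarrow> (\<exists>k. \<not> fast e a ((restart e ^^ k) x))"

definition stall_start :: "real \<Rightarrow> real \<Rightarrow> (real \<Rightarrow> real) \<Rightarrow> real" where
  "stall_start e a x = start e (LEAST k. \<not> fast e a ((restart e ^^ k) x)) x"

text \<open>The lag condition is indexed by the start of its window; the corresponding candidate for
  tau_0 is the end \<open>s + a\<close>.\<close>

definition lag_at :: "real \<Rightarrow> (real \<Rightarrow> real) \<Rightarrow> real \<Rightarrow> bool" where
  "lag_at a x s \<longleftrightarrow> 0 \<le> s \<and> (\<forall>u\<in>{s..s+a}. x u \<le> x s)"

definition first_lag :: "real \<Rightarrow> (real \<Rightarrow> real) \<Rightarrow> real" where
  "first_lag a x = Inf {s. lag_at a x s}"

lemma restart_paths [simp, intro]: "x \<in> paths \<Longrightarrow> restart e x \<in> paths"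
  by (simp add: restart_def)

lemma restart_pow_paths [simp, intro]: "x \<in> paths \<Longrightarrow> (restart e ^^ k) x \<in> paths"
  by (induction k) auto

lemma measurable_restart [measurable]:
  assumes "0 < e" shows "restart e \<in> path_space \<rightarrow>\<^sub>M path_space"
proof -
  note [measurable] = measurable_hit_time[OF assms]
  show ?thesis unfolding restart_def[abs_def] by measurable
qed

lemma measurable_restart_pow [measurable]:
  assumes "0 < e" shows "(restart e ^^ k) \<in> path_space \<rightarrow>\<^sub>M path_space"
proof -
  note [measurable] = measurable_restart[OF assms]
  show ?thesis by (induction k) (auto intro: measurable_comp)
qed

lemma fast_iff: "x \<in> paths \<Longrightarrow> 0 < e \<Longrightarrow> fast e a x \<longleftrightarrow> 0 \<le> a \<and> e \<le> running_max x 0 a"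
  using reaches_by_iff by (simp add: fast_def)

lemma measurable_fast [measurable]:
  assumes "0 < e" shows "Measurable.pred path_space (fast e a)"
proof -
  note [measurable] = measurable_hit_time[OF assms] measurable_reaches[OF assms]
  show ?thesis unfolding fast_def[abs_def] by measurable
qed

lemma measurable_stalls [measurable]:
  assumes "0 < e" shows "Measurable.pred path_space (stalls e a)"
proof -
  note [measurable] = measurable_fast[OF assms] measurable_restart_pow[OF assms]
  show ?thesis unfolding stalls_def[abs_def] by measurable
qed

lemma measurable_stall_start [measurable]:
  assumes "0 < e" shows "stall_start e a \<in> borel_measurable path_space"
proof -
  note [measurable] = measurable_fast[OF assms] measurable_restart_pow[OF assms] measurable_hit_time[OF assms]
  have [measurable]: "start e k \<in> borel_measurable path_space" for k
    unfolding start_def[abs_def] by measurable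
  have [measurable]: "(\<lambda>x. LEAST k. \<not> fast e a ((restart e ^^ k) x)) \<in> path_space \<rightarrow>\<^sub>M count_space UNIV"
    by measurable
  have "(\<lambda>x. start e (LEAST k. \<not> fast e a ((restart e ^^ k) x)) x) \<in> borel_measurable path_space"
    by (rule measurable_compose_countable) measurable
  then show ?thesis unfolding stall_start_def[abs_def] .
qed

lemma start_Suc_restart: "start e (Suc k) x = hit_time e x + start e k (restart e x)"
  unfolding start_def by (subst sum.lessThan_Suc_shift) (simp add: funpow_swap1)

lemma stalls_rec:
  assumes "fast e a x"
  shows "stalls e a x \<longleftrightarrow> stalls e a (restart e x)"
    and "stalls e a x \<Longrightarrow> stall_start e a x = hit_time e x + stall_start e a (restart e x)"
proof -
  show iff: "stalls e a x \<longleftrightarrow> stalls e a (restart e x)"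
  proof
    assume "stalls e a x"
    then obtain k where k: "\<not> fast e a ((restart e ^^ k) x)" by (auto simp: stalls_def)
    with assms obtain j where "k = Suc j" by (cases k) auto
    with k show "stalls e a (restart e x)" by (auto simp: stalls_def funpow_swap1)
  next
    assume "stalls e a (restart e x)"
    then obtain k where "\<not> fast e a ((restart e ^^ k) (restart e x))" by (auto simp: stalls_def)
    then have "\<not> fast e a ((restart e ^^ Suc k) x)" by (simp add: funpow_swap1)
    then show "stalls e a x" unfolding stalls_def by blast
  qed
  assume "stalls e a x"
  then obtain k where k: "\<not> fast e a ((restart e ^^ k) x)" by (auto simp: stalls_def)
  have "(LEAST k. \<not> fast e a ((restart e ^^ k) x)) = Suc (LEAST k. \<not> fast e a ((restart e ^^ Suc k) x))"
    by (rule Least_Suc[where P="\<lambda>k. \<not> fast e a ((restart e ^^ k) x)", OF k]) (use assms in simp)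
  then show "stall_start e a x = hit_time e x + stall_start e a (restart e x)"
    by (simp add: stall_start_def start_Suc_restart funpow_swap1)
qed

lemma stalls_not_fast:
  assumes "\<not> fast e a x"
  shows "stalls e a x" "stall_start e a x = 0"
proof -
  show "stalls e a x" unfolding stalls_def using assms by (intro exI[of _ 0]) simp
  have "(LEAST k. \<not> fast e a ((restart e ^^ k) x)) = 0" using assms by (intro Least_eq_0) simp
  then show "stall_start e a x = 0" by (simp add: stall_start_def start_def)
qed

text \<open>Successive restarts compose to a single shift, and by continuity each block ends exactly
  at the next level, without overshoot.\<close>

lemma start_facts:
  assumes x: "x \<in> paths" and e: "0 < e" and "\<And>i. i < k \<Longrightarrow> fast e a ((restart e ^^ i) x)"
  shows "0 \<le> start e k x" "(restart e ^^ k) x = shift (start e k x) x" "x (start e k x) = real k * e"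
proof -
  have "0 \<le> start e k x \<and> (restart e ^^ k) x = shift (start e k x) x \<and> x (start e k x) = real k * e"
    using assms(3)
  proof (induction k)
    case 0
    then show ?case using x by (simp add: start_def)
  next
    case (Suc k)
    let ?y = "(restart e ^^ k) x"
    have IH: "0 \<le> start e k x" "?y = shift (start e k x) x" "x (start e k x) = real k * e"
      using Suc by auto
    have y: "?y \<in> paths" using x by simp
    have f: "reaches e ?y" using Suc.prems[of k] by (simp add: fast_def)
    note h = hit_time[OF y e f]
    have eq: "start e (Suc k) x = start e k x + hit_time e ?y" by (simp add: start_def)
    have "(restart e ^^ Suc k) x = shift (hit_time e ?y) ?y" by (simp add: restart_def)
    also have "\<dots> = shift (start e k x + hit_time e ?y) x"
      using h(2) unfolding IH(2) by (intro shift_shift) simp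
    finally have 1: "(restart e ^^ Suc k) x = shift (start e (Suc k) x) x" unfolding eq .
    have "?y (hit_time e ?y) = x (start e k x + hit_time e ?y) - x (start e k x)"
      using h(2) by (subst IH(2)) (simp add: shift_def)
    then have "x (start e (Suc k) x) = real (Suc k) * e"
      using h(1) IH(3) eq by (simp add: algebra_simps)
    with 1 show ?case using IH(1) h(2) eq by simp
  qed
  then show "0 \<le> start e k x" "(restart e ^^ k) x = shift (start e k x) x" "x (start e k x) = real k * e" by auto
qed

text \<open>Induction on blocks: a block that starts no later than \<open>s\<close> and lasts at
  most \<open>a\<close> ends inside the window on which \<open>x s\<close> is maximal. Its final
  level is thus at most \<open>x s\<close> and has been passed by time \<open>s\<close>.\<close>

lemma start_le_lag:
  assumes x: "x \<in> paths" and e: "0 < e" and s: "0 \<le> s" and mx: "\<And>u. u \<in> {0..s+a} \<Longrightarrow> x u \<le> x s"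
  shows "(\<And>i. i < k \<Longrightarrow> fast e a ((restart e ^^ i) x)) \<Longrightarrow> start e k x \<le> s"
proof (induction k)
  case 0
  then show ?case using s by (simp add: start_def)
next
  case (Suc k)
  let ?y = "(restart e ^^ k) x"
  have le: "start e k x \<le> s" using Suc by auto
  have f: "\<And>i. i < k \<Longrightarrow> fast e a ((restart e ^^ i) x)" using Suc.prems by simp
  have y: "?y \<in> paths" using x by simp
  have fk: "reaches e ?y" "hit_time e ?y \<le> a" using Suc.prems[of k] by (auto simp: fast_def)
  note h = hit_time[OF y e fk(1)]
  have eq: "start e (Suc k) x = start e k x + hit_time e ?y" by (simp add: start_def)
  have st2: "0 \<le> start e k x" "?y = shift (start e k x) x"
    using start_facts[OF x e, of k a] f by auto
  have val: "?y u = x (start e k x + u) - x (start e k x)" if "0 \<le> u" for u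
    using that by (subst st2(2)) (simp add: shift_def)
  have "x (start e k x + hit_time e ?y) \<le> x s"
    using h(2) st2 le fk(2) by (intro mx) auto
  then have "e \<le> ?y (s - start e k x)"
    using val[of "hit_time e ?y"] val[of "s - start e k x"] h(1,2) le by simp
  from h(4)[OF this] show ?case using eq by simp
qed

text \<open>Without a stall the path would attain every level \<open>k * e\<close> by time
  \<open>s\<close>, although \<open>x s\<close> is an upper bound there.\<close>

lemma stalls_if_lag:
  assumes x: "x \<in> paths" and e: "0 < e" and s: "0 \<le> s" and mx: "\<And>u. u \<in> {0..s+a} \<Longrightarrow> x u \<le> x s"
  shows "stalls e a x" "stall_start e a x \<le> s"
proof -
  show st: "stalls e a x"
  proof (rule ccontr)
    assume "\<not> stalls e a x"
    then have f: "fast e a ((restart e ^^ i) x)" for i by (auto simp: stalls_def)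
    obtain k where k: "x s < real k * e" using e reals_Archimedean3 by blast
    have "0 \<le> a" using f[of 0] hit_time_nonneg[OF x e] by (auto simp: fast_def)
    have "x (start e k x) \<le> x s"
      using start_facts(1)[OF x e f, of k] start_le_lag[OF x e s mx f, of k] \<open>0 \<le> a\<close> by (intro mx) auto
    then show False using start_facts(3)[OF x e f, of k] k by simp
  qed
  show "stall_start e a x \<le> s"
    unfolding stall_start_def
    by (rule start_le_lag[OF x e s mx]) (auto dest: not_less_Least)
qed

text \<open>A stalled block satisfies the lag condition up to an error of \<open>e\<close>; this is
  the form that can be passed to the limit.\<close>

lemma stall_start_facts:
  assumes x: "x \<in> paths" and e: "0 < e" and st: "stalls e a x"
  shows "0 \<le> stall_start e a x" "u \<in> {stall_start e a x..stall_start e a x + a} \<Longrightarrow> x u < x (stall_start e a x) + e"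
proof -
  let ?k = "LEAST k. \<not> fast e a ((restart e ^^ k) x)"
  have f: "\<And>i. i < ?k \<Longrightarrow> fast e a ((restart e ^^ i) x)" by (auto dest: not_less_Least)
  have nf: "\<not> fast e a ((restart e ^^ ?k) x)" using st unfolding stalls_def by (rule LeastI_ex)
  have sf: "0 \<le> stall_start e a x" "(restart e ^^ ?k) x = shift (stall_start e a x) x"
    unfolding stall_start_def by (rule start_facts[OF x e]; erule f)+
  show "0 \<le> stall_start e a x" by (rule sf(1))
  let ?s = "stall_start e a x" and ?y = "shift (stall_start e a x) x"
  assume u: "u \<in> {?s..?s + a}"
  then have "0 \<le> a" by simp
  then have "running_max ?y 0 a < e" using nf fast_iff[OF _ e, of ?y a] x unfolding sf(2) by auto
  then have "?y (u - ?s) < e"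
    using running_max_upper[OF pathsD(1)[of ?y], of "u - ?s" 0 a] x u by auto
  then show "x u < x ?s + e" using u by (simp add: shift_def)
qed

text \<open>Closedness turns the infimum in \<open>first_lag\<close> into a minimum. Written with
  offsets \<open>v\<close> that do not depend on \<open>s\<close>, the condition is an intersection
  of closed conditions.\<close>

lemma closed_lag: "x \<in> paths \<Longrightarrow> 0 \<le> a \<Longrightarrow> closed {s. lag_at a x s}"
proof -
  assume x: "x \<in> paths" and a: "0 \<le> a"
  have "{s. lag_at a x s} = {s. 0 \<le> s} \<inter> (\<Inter>v\<in>{0..a}. {s. x (s + v) \<le> x s})"
  proof (intro set_eqI iffI)
    fix s assume "s \<in> {s. lag_at a x s}"
    then show "s \<in> {s. 0 \<le> s} \<inter> (\<Inter>v\<in>{0..a}. {s. x (s + v) \<le> x s})" by (auto simp: lag_at_def)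
  next
    fix s assume s: "s \<in> {s. 0 \<le> s} \<inter> (\<Inter>v\<in>{0..a}. {s. x (s + v) \<le> x s})"
    have "x u \<le> x s" if "u \<in> {s..s+a}" for u
    proof -
      have "u - s \<in> {0..a}" using that by simp
      with s have "x (s + (u - s)) \<le> x s" by blast
      then show ?thesis by simp
    qed
    with s show "s \<in> {s. lag_at a x s}" by (auto simp: lag_at_def)
  qed
  moreover have "closed {s. x (s + v) \<le> x s}" for v
    by (intro closed_Collect_le continuous_on_compose2[OF pathsD(1)[OF x, of UNIV]] continuous_intros) (auto intro: pathsD(1)[OF x])
  moreover have "closed {s::real. 0 \<le> s}" by (simp add: closed_Collect_le)
  ultimately show ?thesis by (simp add: closed_INT closed_Int)
qed

text \<open>The last claim extends maximality from the window to all times since 0: a strictly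
  higher earlier maximum would itself satisfy the lag condition and contradict minimality. Hence the
  running maximum at tau_0 is the value at the start of the window.\<close>

lemma first_lag:
  assumes x: "x \<in> paths" and a: "0 \<le> a" and ex: "\<exists>s. lag_at a x s"
  shows "lag_at a x (first_lag a x)" "lag_at a x s \<Longrightarrow> first_lag a x \<le> s"
    "0 \<le> first_lag a x" "u \<in> {0..first_lag a x + a} \<Longrightarrow> x u \<le> x (first_lag a x)"
proof -
  have bdd: "bdd_below {s. lag_at a x s}" by (auto simp: lag_at_def intro!: bdd_belowI[of _ 0])
  have "first_lag a x \<in> {s. lag_at a x s}"
    unfolding first_lag_def by (intro closed_contains_Inf closed_lag x a bdd) (use ex in auto)
  then show l: "lag_at a x (first_lag a x)" by simp
  then show s0: "0 \<le> first_lag a x" by (simp add: lag_at_def)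
  show le: "lag_at a x s \<Longrightarrow> first_lag a x \<le> s" for s
    unfolding first_lag_def by (intro cInf_lower bdd) simp
  let ?s = "first_lag a x"
  assume u: "u \<in> {0..?s + a}"
  obtain m where m: "m \<in> {0..?s}" "\<And>v. v \<in> {0..?s} \<Longrightarrow> x v \<le> x m"
    using running_max_attained[OF pathsD(1)[OF x] s0] by metis
  have "x m \<le> x ?s"
  proof (rule ccontr)
    assume *: "\<not> x m \<le> x ?s"
    have "lag_at a x m"
      unfolding lag_at_def
    proof safe
      fix v assume v: "v \<in> {m..m + a}"
      show "x v \<le> x m"
      proof (cases "v \<le> ?s")
        case True with v m show ?thesis by auto
      next
        case False
        with v m have "v \<in> {?s..?s + a}" by auto
        with l have "x v \<le> x ?s" by (auto simp: lag_at_def)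
        with * show ?thesis by simp
      qed
    qed (use m in auto)
    from le[OF this] m(1) have "m = ?s" by simp
    with * show False by simp
  qed
  then show "x u \<le> x ?s"
    using m(2)[of u] l u by (cases "u \<le> ?s") (auto simp: lag_at_def)
qed

text \<open>Otherwise, by compactness, a subsequence of the stall starts would converge to a time in \<open>[0, B]\<close>
  at which the lag condition holds.\<close>

lemma stall_start_eventually_greater:
  fixes e :: "nat \<Rightarrow> real"
  assumes x: "x \<in> paths" and e: "\<And>n. 0 < e n" "e \<longlonglongrightarrow> 0" and no: "\<And>s. s \<in> {0..B} \<Longrightarrow> \<not> lag_at a x s"
  shows "eventually (\<lambda>n. stalls (e n) a x \<longrightarrow> B < stall_start (e n) a x) sequentially"
proof (rule ccontr)
  let ?s = "\<lambda>n. stall_start (e n) a x"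
  assume "\<not> ?thesis"
  then have "\<exists>\<^sub>F n in sequentially. stalls (e n) a x \<and> ?s n \<le> B"
    by (simp add: frequently_def not_le)
  then have "infinite {n. stalls (e n) a x \<and> ?s n \<le> B}"
    by (simp add: frequently_cofinite[symmetric] cofinite_eq_sequentially)
  then obtain r :: "nat \<Rightarrow> nat" where r: "strict_mono r" "\<And>n. stalls (e (r n)) a x \<and> ?s (r n) \<le> B"
    using infinite_enumerate by force
  have "?s (r n) \<in> {0..B}" for n using r(2)[of n] stall_start_facts(1)[OF x e(1)] by auto
  then obtain l r' where l: "l \<in> {0..B}" "strict_mono r'" "((\<lambda>n. ?s (r n)) \<circ> r') \<longlonglongrightarrow> l"
    using seq_compactE[OF compact_imp_seq_compact[OF compact_Icc], of "\<lambda>n. ?s (r n)" 0 B] by blast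
  define \<sigma> where "\<sigma> n = ?s (r (r' n))" for n
  have lim: "\<sigma> \<longlonglongrightarrow> l" using l(3) by (simp add: \<sigma>_def[abs_def] o_def)
  have lime: "(\<lambda>n. e (r (r' n))) \<longlonglongrightarrow> 0"
    using LIMSEQ_subseq_LIMSEQ[OF e(2) strict_mono_o[OF r(1) l(2)]] by (simp add: o_def)
  have "x (l + v) \<le> x l" if v: "v \<in> {0..a}" for v
  proof (rule tendsto_le[OF sequentially_bot])
    show "(\<lambda>n. x (\<sigma> n + v)) \<longlonglongrightarrow> x (l + v)"
      by (intro isCont_tendsto_compose[OF pathsD(2)[OF x]] tendsto_intros lim)
    have "(\<lambda>n. x (\<sigma> n) + e (r (r' n))) \<longlonglongrightarrow> x l + 0"
      by (intro tendsto_intros isCont_tendsto_compose[OF pathsD(2)[OF x]] lim lime)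
    then show "(\<lambda>n. x (\<sigma> n) + e (r (r' n))) \<longlonglongrightarrow> x l" by simp
    show "\<forall>\<^sub>F n in sequentially. x (\<sigma> n + v) \<le> x (\<sigma> n) + e (r (r' n))"
      using stall_start_facts(2)[OF x e(1)] r(2) v
      by (intro always_eventually allI less_imp_le) (auto simp: \<sigma>_def)
  qed
  then have "x u \<le> x l" if "u \<in> {l..l+a}" for u
    using that by (metis add_diff_cancel_left' atLeastAtMost_iff diff_add_cancel add.commute diff_ge_0_iff_ge le_diff_eq)
  then have "lag_at a x l" using l(1) by (simp add: lag_at_def)
  with no l(1) show False by blast
qed

text \<open>Stall starts never exceed the first lag time, and they eventually exceed every smaller
  bound since no lag condition holds before it.\<close>

lemma stall_start_tendsto:
  fixes e :: "nat \<Rightarrow> real"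
  assumes x: "x \<in> paths" and a: "0 \<le> a" and e: "\<And>n. 0 < e n" "e \<longlonglongrightarrow> 0" and ex: "\<exists>s. lag_at a x s"
  shows "stalls (e n) a x" "stall_start (e n) a x \<le> first_lag a x" "(\<lambda>n. stall_start (e n) a x) \<longlonglongrightarrow> first_lag a x"
proof -
  note fl = first_lag[OF x a ex]
  show st: "stalls (e n) a x" and le: "stall_start (e n) a x \<le> first_lag a x" for n
    using stalls_if_lag[OF x e(1) fl(3,4)] by auto
  show "(\<lambda>n. stall_start (e n) a x) \<longlonglongrightarrow> first_lag a x"
  proof (rule increasing_tendsto)
    show "\<forall>\<^sub>F n in sequentially. stall_start (e n) a x \<le> first_lag a x" using le by simp
    fix B assume B: "B < first_lag a x"
    have "\<not> lag_at a x s" if "s \<in> {0..B}" for s using fl(2)[of s] that B by auto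
    from stall_start_eventually_greater[OF x e this] show "\<forall>\<^sub>F n in sequentially. B < stall_start (e n) a x"
      using st by simp
  qed
qed

section \<open>Renewal equations for discretised levels\<close>

lemma nn_integral_exp_Ico:
  assumes "0 < \<eta>" "0 \<le> T"
  shows "(\<integral>\<^sup>+t. (if 0 \<le> t \<and> t < T then ennreal (\<eta> * exp (- \<eta> * t)) else 0) \<partial>lborel) = ennreal (1 - exp (- \<eta> * T))"
proof -
  have "(\<integral>\<^sup>+t. (if 0 \<le> t \<and> t < T then ennreal (\<eta> * exp (- \<eta> * t)) else 0) \<partial>lborel) =
      (\<integral>\<^sup>+t. ennreal (\<eta> * exp (- \<eta> * t)) * indicator {0..T} t \<partial>lborel)"
  proof (rule nn_integral_cong_AE)
    show "AE t in lborel. (if 0 \<le> t \<and> t < T then ennreal (\<eta> * exp (- \<eta> * t)) else 0) =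
        ennreal (\<eta> * exp (- \<eta> * t)) * indicator {0..T} t"
      using AE_lborel_singleton[of T] by eventually_elim auto
  qed
  also have "\<dots> = (- exp (- \<eta> * T)) - (- exp (- \<eta> * 0))"
  proof (rule nn_integral_FTC_Icc)
    show "DERIV (\<lambda>t. - exp (- \<eta> * t)) x :> \<eta> * exp (- \<eta> * x)" for x
      by (auto intro!: derivative_eq_intros)
  qed (use assms in auto)
  finally show ?thesis by simp
qed

text \<open>Clock rate and decay rate are separate parameters because the domination argument
  integrates the clock at half its decay rate.\<close>

lemma nn_integral_exp_atLeast:
  assumes "0 < \<kappa>" "0 \<le> \<eta>"
  shows "(\<integral>\<^sup>+t. (if 0 \<le> t then ennreal (\<eta> * exp (- \<kappa> * t)) else 0) \<partial>lborel) = ennreal (\<eta> / \<kappa>)"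
proof -
  have "(\<integral>\<^sup>+t. (if 0 \<le> t then ennreal (\<eta> * exp (- \<kappa> * t)) else 0) \<partial>lborel) =
      (\<integral>\<^sup>+t. ennreal (\<eta> * exp (- \<kappa> * t)) * indicator {0..} t \<partial>lborel)"
    by (intro nn_integral_cong) auto
  also have "\<dots> = ennreal (0 - (- (\<eta> / \<kappa>) * exp (- \<kappa> * 0)))"
  proof (rule nn_integral_FTC_atLeast)
    show "DERIV (\<lambda>t. - (\<eta> / \<kappa>) * exp (- \<kappa> * t)) x :> \<eta> * exp (- \<kappa> * x)" for x
      using assms by (auto intro!: derivative_eq_intros)
    have "((\<lambda>t. exp (- \<kappa> * t)) \<longlongrightarrow> 0) at_top"
      using assms by (intro filterlim_compose[OF exp_at_bot] filterlim_tendsto_neg_mult_at_bot[OF tendsto_const _ filterlim_ident]) auto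
    from tendsto_mult[OF tendsto_const this, of "- (\<eta> / \<kappa>)"]
    show "((\<lambda>t. - (\<eta> / \<kappa>) * exp (- \<kappa> * t)) \<longlongrightarrow> 0) at_top" by simp
  qed (use assms in auto)
  finally show ?thesis by simp
qed

text \<open>Reward at the end of the stall window: \<open>h\<close> of the drop, times exp of the
  level at the start, times the probability \<open>exp (- \<eta> * (s + a))\<close> that the clock
  has not rung. Stopping and continuing at tau_0 are two choices of \<open>h\<close>.\<close>

definition lag_value :: "real \<Rightarrow> real \<Rightarrow> real \<Rightarrow> (real \<Rightarrow> ennreal) \<Rightarrow> (real \<Rightarrow> real) \<Rightarrow> ennreal" where
  "lag_value e a \<eta> h x =
    (if stalls e a x then (let s = stall_start e a x in h (x (s + a) - x s) * ennreal (exp (x s - \<eta> * (s + a)))) else 0)"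

text \<open>Expected payoff if the clock rings before the stall window ends, for a fixed path and
  with the exponential clock integrated out.\<close>

definition occupation :: "real \<Rightarrow> real \<Rightarrow> real \<Rightarrow> (real \<Rightarrow> real) \<Rightarrow> ennreal" where
  "occupation e a \<eta> x =
    (\<integral>\<^sup>+t. (if 0 \<le> t \<and> (stalls e a x \<longrightarrow> t < stall_start e a x + a)
       then ennreal (\<eta> * exp (running_max x 0 t - \<eta> * t)) else 0) \<partial>lborel)"

definition block_occupation :: "real \<Rightarrow> real \<Rightarrow> real \<Rightarrow> (real \<Rightarrow> real) \<Rightarrow> ennreal" where
  "block_occupation e a \<eta> x =
    (\<integral>\<^sup>+t. (if 0 \<le> t \<and> t < a \<and> running_max x 0 t < e
       then ennreal (\<eta> * exp (running_max x 0 t - \<eta> * t)) else 0) \<partial>lborel)"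

definition block_factor :: "real \<Rightarrow> real \<Rightarrow> real \<Rightarrow> (real \<Rightarrow> real) \<Rightarrow> ennreal" where
  "block_factor e a \<eta> x = (if fast e a x then ennreal (exp (e - \<eta> * hit_time e x)) else 0)"

section \<open>Pathwise recursions over the first block\<close>

lemma lag_value_rec:
  assumes x: "x \<in> paths" and e: "0 < e"
  shows "lag_value e a \<eta> h x = (if fast e a x then 0 else h (x a) * ennreal (exp (- \<eta> * a))) +
    block_factor e a \<eta> x * lag_value e a \<eta> h (restart e x)"
proof (cases "fast e a x")
  case False
  then show ?thesis
    using stalls_not_fast[OF False] x by (simp add: lag_value_def block_factor_def)
next
  case True
  show ?thesis
  proof (cases "stalls e a x")
    case False
    then show ?thesis using True stalls_rec(1)[OF True] by (simp add: lag_value_def block_factor_def)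
  next
    case st: True
    have r: "reaches e x" using True by (simp add: fast_def)
    note h = hit_time[OF x e r]
    let ?s = "stall_start e a (restart e x)" and ?T = "hit_time e x"
    have st': "stalls e a (restart e x)" using st stalls_rec(1)[OF True] by simp
    have s0: "0 \<le> ?s" using stall_start_facts(1)[OF _ e st'] x by simp
    have eq: "stall_start e a x = ?T + ?s" by (rule stalls_rec(2)[OF True st])
    have v1: "restart e x ?s = x (?T + ?s) - e" using s0 h(1) by (simp add: restart_def shift_def)
    show ?thesis
    proof (cases "0 \<le> a")
      case a: True
      have v2: "restart e x (?s + a) = x (?T + ?s + a) - e"
        using s0 a h(1) by (simp add: restart_def shift_def add.assoc)
      have "exp (x (?T + ?s) - \<eta> * (?T + ?s + a)) = exp (e - \<eta> * ?T) * exp (x (?T + ?s) - e - \<eta> * (?s + a))"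
        by (simp add: exp_add[symmetric] algebra_simps)
      then show ?thesis using True st st' v1 v2
        by (simp add: lag_value_def block_factor_def eq Let_def ennreal_mult mult_ac)
    next
      case False
      then show ?thesis using True h(2) by (simp add: fast_def)
    qed
  qed
qed

text \<open>Before the passage the path is below \<open>e\<close>, and the restarted path starts at
  0, so the maximum is attained after the passage.\<close>

lemma running_max_restart:
  assumes x: "x \<in> paths" and e: "0 < e" and r: "reaches e x" and u: "0 \<le> u"
  shows "running_max x 0 (hit_time e x + u) = e + running_max (restart e x) 0 u"
proof -
  let ?T = "hit_time e x" and ?y = "restart e x"
  note h = hit_time[OF x e r]
  have val: "?y v = x (?T + v) - e" if "0 \<le> v" for v
    using that h(1) by (simp add: restart_def shift_def)
  have y: "?y \<in> paths" using x by simp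
  obtain v where v: "v \<in> {0..u}" "?y v = running_max ?y 0 u" "\<And>w. w \<in> {0..u} \<Longrightarrow> ?y w \<le> ?y v"
    using running_max_attained[OF pathsD(1)[OF y] u] by metis
  have "running_max x 0 (?T + u) = x (?T + v)"
  proof (rule running_max_eqI)
    show "?T + v \<in> {0..?T + u}" using v(1) h(2) by auto
    fix w assume w: "w \<in> {0..?T + u}"
    show "x w \<le> x (?T + v)"
    proof (cases "?T \<le> w")
      case True
      then have "?y (w - ?T) \<le> ?y v" using w by (intro v(3)) auto
      then show ?thesis using val[of v] val[of "w - ?T"] True v(1) by simp
    next
      case False
      then have "x w < e" using h(3)[of w] by simp
      moreover have "0 \<le> ?y v" using v(3)[of 0] u y by simp
      ultimately show ?thesis using val[of v] v(1) by simp
    qed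
  qed
  then show ?thesis using v(1,2) val[of v] by simp
qed

lemma measurable_running_max_time:
  assumes "x \<in> paths" shows "(\<lambda>t. running_max x 0 t) \<in> borel_measurable borel"
  by (rule measurable_running_max) (use assms in auto)

text \<open>If the first block is completed, the clock rings either before the passage of
  \<open>e\<close>, where the maximum is still below \<open>e\<close>, or after it. A passage within
  \<open>a\<close> lies before the end of the stall window, so the second part is the restarted
  occupation, translated by the passage time.\<close>

lemma occupation_rec:
  assumes x: "x \<in> paths" and e: "0 < e" and a: "0 \<le> a"
  shows "occupation e a \<eta> x = block_occupation e a \<eta> x + block_factor e a \<eta> x * occupation e a \<eta> (restart e x)"
proof (cases "fast e a x")
  case False
  then have "running_max x 0 a < e" using fast_iff[OF x e] a by simp
  then have "running_max x 0 t < e" if "0 \<le> t" "t < a" for t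
  proof -
    have "running_max x 0 t \<le> running_max x 0 a"
      using running_max_le_iff[OF pathsD(1)[OF x] that(1)] running_max_upper[OF pathsD(1)[OF x], of _ 0 a] that by simp
    then show ?thesis using \<open>running_max x 0 a < e\<close> by simp
  qed
  then have "occupation e a \<eta> x = block_occupation e a \<eta> x"
    unfolding occupation_def block_occupation_def using stalls_not_fast[OF False]
    by (intro nn_integral_cong) auto
  then show ?thesis using False by (simp add: block_factor_def)
next
  case True
  let ?T = "hit_time e x" and ?y = "restart e x" and ?s = "stall_start e a x" and ?s' = "stall_start e a (restart e x)"
  let ?w = "\<lambda>x t. ennreal (\<eta> * exp (running_max x 0 t - \<eta> * t))"
  have r: "reaches e x" and Ta: "?T \<le> a" using True by (auto simp: fast_def)
  note h = hit_time[OF x e r]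
  have y: "?y \<in> paths" using x by simp
  have s: "?s = ?T + ?s'" "0 \<le> ?s'" if "stalls e a x"
    using stalls_rec[OF True] stall_start_facts(1)[OF y e] that by auto
  have iff: "running_max x 0 t < e \<longleftrightarrow> t < ?T" if "0 \<le> t" for t
    using reaches_by_iff[OF x e, of t] r that by auto
  note [measurable] = measurable_running_max_time[OF x] measurable_running_max_time[OF y]
  let ?B = "\<lambda>t. if ?T \<le> t \<and> (stalls e a x \<longrightarrow> t < ?s + a) then ?w x t else 0"
  have "occupation e a \<eta> x = (\<integral>\<^sup>+t. (if 0 \<le> t \<and> t < a \<and> running_max x 0 t < e then ?w x t else 0) + ?B t \<partial>lborel)"
    unfolding occupation_def
  proof (intro nn_integral_cong)
    fix t
    show "(if 0 \<le> t \<and> (stalls e a x \<longrightarrow> t < ?s + a) then ?w x t else 0) =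
      (if 0 \<le> t \<and> t < a \<and> running_max x 0 t < e then ?w x t else 0) + ?B t"
    proof (cases "0 \<le> t")
      case t: True
      show ?thesis
      proof (cases "t < ?T")
        case True
        then have "t < a" "stalls e a x \<longrightarrow> t < ?s + a" using Ta s a by auto
        then show ?thesis using t True iff[OF t] by simp
      next
        case False
        then show ?thesis using t iff[OF t] by simp
      qed
    next
      case False
      then show ?thesis using h(2) by simp
    qed
  qed
  also have "\<dots> = block_occupation e a \<eta> x + (\<integral>\<^sup>+t. ?B t \<partial>lborel)"
    unfolding block_occupation_def by (rule nn_integral_add) measurable
  also have "(\<integral>\<^sup>+t. ?B t \<partial>lborel) = (\<integral>\<^sup>+u. ?B (?T + 1 * u) \<partial>lborel)"
    by (subst nn_integral_real_affine[where c=1 and t="?T"]) auto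
  also have "\<dots> = (\<integral>\<^sup>+u. block_factor e a \<eta> x * (if 0 \<le> u \<and> (stalls e a ?y \<longrightarrow> u < ?s' + a) then ?w ?y u else 0) \<partial>lborel)"
  proof (intro nn_integral_cong)
    fix u
    have "?w x (?T + u) = block_factor e a \<eta> x * ?w ?y u" if "0 \<le> u"
    proof -
      have "exp (running_max x 0 (?T + u) - \<eta> * (?T + u)) = exp (e - \<eta> * ?T) * exp (running_max ?y 0 u - \<eta> * u)"
        unfolding running_max_restart[OF x e r that] by (simp add: exp_add[symmetric] algebra_simps)
      then show ?thesis using True
        by (simp add: block_factor_def ennreal_mult'[symmetric] mult_ac)
    qed
    moreover have "stalls e a ?y \<longleftrightarrow> stalls e a x" using stalls_rec(1)[OF True] by simp
    ultimately show "?B (?T + 1 * u) = block_factor e a \<eta> x * (if 0 \<le> u \<and> (stalls e a ?y \<longrightarrow> u < ?s' + a) then ?w ?y u else 0)"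
      using s by auto
  qed
  also have "\<dots> = block_factor e a \<eta> x * occupation e a \<eta> ?y"
    unfolding occupation_def by (rule nn_integral_cmult) measurable
  finally show ?thesis .
qed

lemma measurable_block_factor [measurable]:
  assumes "0 < e" shows "block_factor e a \<eta> \<in> borel_measurable path_space"
proof -
  note [measurable] = measurable_fast[OF assms] measurable_hit_time[OF assms]
  show ?thesis unfolding block_factor_def[abs_def] by measurable
qed

lemma adapted_block_factor:
  assumes "0 < e" shows "adapted (block_factor e a \<eta>) (hit_time e)"
proof -
  have "block_factor e a \<eta> = (\<lambda>x. if reaches e x then if hit_time e x \<le> a then ennreal (exp (e - \<eta> * hit_time e x)) else 0 else 0)"
    by (rule ext) (simp add: block_factor_def fast_def)
  then show ?thesis using adapted_hit_time[OF assms, of "\<lambda>t. if t \<le> a then ennreal (exp (e - \<eta> * t)) else 0"] by simp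
qed

lemma measurable_lag_value [measurable]:
  assumes "0 < e" and [measurable]: "h \<in> borel_measurable borel"
  shows "lag_value e a \<eta> h \<in> borel_measurable path_space"
proof -
  note [measurable] = measurable_stalls[OF assms(1)] measurable_stall_start[OF assms(1)]
  show ?thesis unfolding lag_value_def[abs_def] Let_def by measurable
qed

lemma measurable_occupation [measurable]:
  assumes "0 < e" shows "occupation e a \<eta> \<in> borel_measurable path_space"
proof -
  note [measurable] = measurable_stalls[OF assms] measurable_stall_start[OF assms]
  show ?thesis unfolding occupation_def[abs_def] by measurable
qed

lemma measurable_block_occupation [measurable]: "block_occupation e a \<eta> \<in> borel_measurable path_space"
  unfolding block_occupation_def[abs_def] by measurable

text \<open>Half of the discount controls \<open>exp (x v)\<close> at the time
  \<open>v \<le> t\<close> of the maximum, the other half is integrated over the clock; the factor 2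
  is \<open>\<eta> / (\<eta> / 2)\<close>.\<close>

lemma running_exp_dominated:
  assumes x: "x \<in> paths" and \<eta>: "0 < \<eta>"
    and D: "\<And>t. 0 \<le> t \<Longrightarrow> ennreal (exp (x t - (\<eta> / 2) * t)) \<le> D"
  shows "(\<integral>\<^sup>+t. (if 0 \<le> t then ennreal (\<eta> * exp (running_max x 0 t - \<eta> * t)) else 0) \<partial>lborel) \<le> 2 * D"
proof -
  have "ennreal (\<eta> * exp (running_max x 0 t - \<eta> * t)) \<le> D * ennreal (\<eta> * exp (- (\<eta> / 2) * t))" if t: "0 \<le> t" for t
  proof -
    obtain v where v: "v \<in> {0..t}" "x v = running_max x 0 t"
      using running_max_attained[OF pathsD(1)[OF x] t] by metis
    have "\<eta> / 2 * v \<le> \<eta> / 2 * t" using v(1) \<eta> by (intro mult_left_mono) auto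
    then have "x v - \<eta> * t \<le> (x v - \<eta> / 2 * v) + - (\<eta> / 2) * t" by (simp add: field_simps)
    then have "exp (x v - \<eta> * t) \<le> exp (x v - \<eta> / 2 * v) * exp (- (\<eta> / 2) * t)"
      by (simp add: exp_add[symmetric])
    then have "\<eta> * exp (x v - \<eta> * t) \<le> exp (x v - \<eta> / 2 * v) * (\<eta> * exp (- (\<eta> / 2) * t))"
      using \<eta> by simp
    then have "ennreal (\<eta> * exp (x v - \<eta> * t)) \<le> ennreal (exp (x v - \<eta> / 2 * v)) * ennreal (\<eta> * exp (- (\<eta> / 2) * t))"
      using \<eta> by (simp add: ennreal_mult[symmetric])
    also have "\<dots> \<le> D * ennreal (\<eta> * exp (- (\<eta> / 2) * t))"
      using D[of v] v(1) by (intro mult_right_mono) auto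
    finally show ?thesis using v(2) by simp
  qed
  then have "(\<integral>\<^sup>+t. (if 0 \<le> t then ennreal (\<eta> * exp (running_max x 0 t - \<eta> * t)) else 0) \<partial>lborel) \<le>
      (\<integral>\<^sup>+t. D * (if 0 \<le> t then ennreal (\<eta> * exp (- (\<eta> / 2) * t)) else 0) \<partial>lborel)"
    by (intro nn_integral_mono) auto
  also have "\<dots> = D * ennreal (\<eta> / (\<eta> / 2))"
    using \<eta> by (subst nn_integral_cmult) (auto simp: nn_integral_exp_atLeast)
  also have "\<dots> = 2 * D" using \<eta> by (simp add: mult.commute)
  finally show ?thesis .
qed

lemma lag_value_le:
  assumes x: "x \<in> paths" and e: "0 < e" and \<eta>: "0 < \<eta>" and a: "0 < a" and h: "\<And>y. h y \<le> C"
    and D: "\<And>t. 0 \<le> t \<Longrightarrow> ennreal (exp (x t - \<eta> * t)) \<le> D"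
  shows "lag_value e a \<eta> h x \<le> C * D"
proof (cases "stalls e a x")
  case True
  let ?s = "stall_start e a x"
  have s: "0 \<le> ?s" using stall_start_facts(1)[OF x e True] .
  have "ennreal (exp (x ?s - \<eta> * (?s + a))) \<le> ennreal (exp (x ?s - \<eta> * ?s))"
    using \<eta> a by (intro ennreal_leI) (simp add: algebra_simps)
  also have "\<dots> \<le> D" by (rule D[OF s])
  finally show ?thesis using True h by (auto simp: lag_value_def Let_def intro!: mult_mono)
qed (simp add: lag_value_def)

section \<open>Expectations over one block\<close>

context half_drift
begin

text \<open>For \<open>0 < t\<close>, the probability that \<open>e\<close> has not been reached by
  time \<open>t\<close>; the explicit density gives access to measurability and to the asymptotics
  in \<open>e\<close>.\<close>

definition survival :: "real \<Rightarrow> real \<Rightarrow> ennreal" where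
  "survival e t = (\<integral>\<^sup>+y. killed_density (- 1 / 2) e t y \<partial>lborel)"

text \<open>The probability that the clock rings before the block is completed and before it reaches
  age \<open>a\<close>.\<close>

definition clock_ring :: "real \<Rightarrow> real \<Rightarrow> real \<Rightarrow> ennreal" where
  "clock_ring e a \<eta> = (\<integral>\<^sup>+t. (if 0 < t \<and> t < a then ennreal (\<eta> * exp (- \<eta> * t)) * survival e t else 0) \<partial>lborel)"

lemma nn_integral_survival:
  assumes "0 < e" "0 < t"
  shows "(\<integral>\<^sup>+x. (if running_max x 0 t < e then 1 else 0) \<partial>P) = survival e t"
  using nn_integral_killed[OF assms(2,1), of "\<lambda>_. 1" 1] by (simp add: survival_def)

lemma survival_le_1:
  assumes "0 < e" "0 < t" shows "survival e t \<le> 1"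
proof -
  have "(\<integral>\<^sup>+x. (if running_max x 0 t < e then 1 else 0) \<partial>P) \<le> (\<integral>\<^sup>+x. 1 \<partial>P)"
    by (intro nn_integral_mono) auto
  then show ?thesis using nn_integral_survival[OF assms] by simp
qed

lemma clock_ring_eq:
  assumes e: "0 < e" and \<eta>: "0 < \<eta>"
  shows "(\<integral>\<^sup>+x. \<integral>\<^sup>+t. (if 0 \<le> t \<and> t < a \<and> running_max x 0 t < e then ennreal (\<eta> * exp (- \<eta> * t)) else 0) \<partial>lborel \<partial>P) =
    clock_ring e a \<eta>"
proof -
  interpret pair_sigma_finite P lborel ..
  let ?f = "\<lambda>x t. (if 0 \<le> t \<and> t < a \<and> running_max x 0 t < e then ennreal (\<eta> * exp (- \<eta> * t)) else 0)"
  have "(\<integral>\<^sup>+x. \<integral>\<^sup>+t. ?f x t \<partial>lborel \<partial>P) = (\<integral>\<^sup>+t. \<integral>\<^sup>+x. ?f x t \<partial>P \<partial>lborel)"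
    by (rule Fubini'[symmetric]) measurable
  also have "\<dots> = clock_ring e a \<eta>"
    unfolding clock_ring_def
  proof (intro nn_integral_cong_AE)
    show "AE t in lborel. (\<integral>\<^sup>+x. ?f x t \<partial>P) = (if 0 < t \<and> t < a then ennreal (\<eta> * exp (- \<eta> * t)) * survival e t else 0)"
      using AE_lborel_singleton[of 0]
    proof eventually_elim
      case (elim t)
      show ?case
      proof (cases "0 < t \<and> t < a")
        case True
        then have "(\<integral>\<^sup>+x. ?f x t \<partial>P) = (\<integral>\<^sup>+x. ennreal (\<eta> * exp (- \<eta> * t)) * (if running_max x 0 t < e then 1 else 0) \<partial>P)"
          by (intro nn_integral_cong) auto
        also have "\<dots> = ennreal (\<eta> * exp (- \<eta> * t)) * survival e t"
          by (subst nn_integral_cmult) (use nn_integral_survival[OF e] True in auto)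
        finally show ?thesis using True by simp
      next
        case False
        then have "?f x t = 0" for x using elim by auto
        then have "(\<integral>\<^sup>+x. ?f x t \<partial>P) = 0" by simp
        then show ?thesis using False by (simp only: if_False)
      qed
    qed
  qed
  finally show ?thesis .
qed

text \<open>Within a block the running maximum lies between 0 and \<open>e\<close>, so the payoff
  differs from 1 by a factor of at most \<open>exp e\<close>, which tends to 1.\<close>

lemma block_occupation_bounds:
  assumes e: "0 < e" and \<eta>: "0 < \<eta>"
  shows "clock_ring e a \<eta> \<le> (\<integral>\<^sup>+x. block_occupation e a \<eta> x \<partial>P)"
    and "(\<integral>\<^sup>+x. block_occupation e a \<eta> x \<partial>P) \<le> ennreal (exp e) * clock_ring e a \<eta>"
proof -
  let ?f = "\<lambda>x t. (if 0 \<le> t \<and> t < a \<and> running_max x 0 t < e then ennreal (\<eta> * exp (- \<eta> * t)) else 0)"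
  show "clock_ring e a \<eta> \<le> (\<integral>\<^sup>+x. block_occupation e a \<eta> x \<partial>P)"
    unfolding clock_ring_eq[OF e \<eta>, symmetric] block_occupation_def
  proof (intro nn_integral_mono)
    fix x t assume "x \<in> space P" then have x: "x \<in> paths" by simp
    have "0 \<le> running_max x 0 t" if "0 \<le> t"
      using running_max_upper[OF pathsD(1)[OF x], of 0 0 t] that x by simp
    then show "?f x t \<le> (if 0 \<le> t \<and> t < a \<and> running_max x 0 t < e then ennreal (\<eta> * exp (running_max x 0 t - \<eta> * t)) else 0)"
      using \<eta> by (auto intro!: ennreal_leI)
  qed
  have "(\<integral>\<^sup>+x. block_occupation e a \<eta> x \<partial>P) \<le> (\<integral>\<^sup>+x. \<integral>\<^sup>+t. ennreal (exp e) * ?f x t \<partial>lborel \<partial>P)"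
    unfolding block_occupation_def
  proof (intro nn_integral_mono)
    fix x :: "real \<Rightarrow> real" and t :: real
    show "(if 0 \<le> t \<and> t < a \<and> running_max x 0 t < e then ennreal (\<eta> * exp (running_max x 0 t - \<eta> * t)) else 0) \<le> ennreal (exp e) * ?f x t"
      using \<eta> by (auto simp: ennreal_mult'[symmetric] mult.left_commute[of "exp e"] exp_add[symmetric] intro!: ennreal_leI)
  qed
  also have "\<dots> = (\<integral>\<^sup>+x. ennreal (exp e) * (\<integral>\<^sup>+t. ?f x t \<partial>lborel) \<partial>P)"
  proof (intro nn_integral_cong nn_integral_cmult)
    fix x assume "x \<in> space P" then have x: "x \<in> paths" by simp
    note [measurable] = measurable_running_max_time[OF x]
    show "?f x \<in> borel_measurable lborel" by measurable
  qed
  also have "\<dots> = ennreal (exp e) * clock_ring e a \<eta>"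
    unfolding clock_ring_eq[OF e \<eta>, symmetric] by (rule nn_integral_cmult) measurable
  finally show "(\<integral>\<^sup>+x. block_occupation e a \<eta> x \<partial>P) \<le> ennreal (exp e) * clock_ring e a \<eta>" .
qed

text \<open>Total probability: the block is completed within \<open>a\<close> before the clock
  rings, the clock rings first, or the block reaches age \<open>a\<close> with the clock silent. The
  factor \<open>exp (- e)\<close> removes the level gain. Thus the block factor follows from
  survival probabilities, without integrating over the law of the passage time.\<close>

lemma block_factor_eq:
  assumes e: "0 < e" and \<eta>: "0 < \<eta>" and a: "0 < a"
  shows "ennreal (exp (- e)) * (\<integral>\<^sup>+x. block_factor e a \<eta> x \<partial>P) + clock_ring e a \<eta> + ennreal (exp (- \<eta> * a)) * survival e a = 1"
proof -
  note [measurable] = measurable_block_factor[OF e] measurable_fast[OF e]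
  let ?f = "\<lambda>x t. (if 0 \<le> t \<and> t < a \<and> running_max x 0 t < e then ennreal (\<eta> * exp (- \<eta> * t)) else 0)"
  let ?g = "\<lambda>x. if running_max x 0 a < e then 1 else 0 :: ennreal"
  have pw: "ennreal (exp (- e)) * block_factor e a \<eta> x + (\<integral>\<^sup>+t. ?f x t \<partial>lborel) + ennreal (exp (- \<eta> * a)) * ?g x = 1"
    if x: "x \<in> paths" for x
  proof (cases "fast e a x")
    case True
    let ?T = "hit_time e x"
    have r: "reaches e x" and Ta: "?T \<le> a" using True by (auto simp: fast_def)
    have "?f x t = (if 0 \<le> t \<and> t < ?T then ennreal (\<eta> * exp (- \<eta> * t)) else 0)" for t
      using reaches_by_iff[OF x e, of t] r Ta by auto
    then have "(\<integral>\<^sup>+t. ?f x t \<partial>lborel) = ennreal (1 - exp (- \<eta> * ?T))"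
      using nn_integral_exp_Ico[OF \<eta>, of ?T] hit_time(2)[OF x e r] by simp
    moreover have "\<not> running_max x 0 a < e" using True fast_iff[OF x e] by simp
    ultimately show ?thesis using True hit_time(2)[OF x e r] \<eta>
      by (simp add: block_factor_def ennreal_mult'[symmetric] exp_add[symmetric] ennreal_plus[symmetric] del: ennreal_plus)
  next
    case False
    then have lt: "running_max x 0 a < e" using fast_iff[OF x e] a by simp
    have "?f x t = (if 0 \<le> t \<and> t < a then ennreal (\<eta> * exp (- \<eta> * t)) else 0)" for t
    proof -
      have "running_max x 0 t \<le> running_max x 0 a" if "0 \<le> t" "t < a"
        using running_max_le_iff[OF pathsD(1)[OF x] that(1)] running_max_upper[OF pathsD(1)[OF x], of _ 0 a] that by simp
      then show ?thesis using lt by auto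
    qed
    then have "(\<integral>\<^sup>+t. ?f x t \<partial>lborel) = ennreal (1 - exp (- \<eta> * a))"
      using nn_integral_exp_Ico[OF \<eta>, of a] a by simp
    then show ?thesis using False lt \<eta> a
      by (simp add: block_factor_def ennreal_plus[symmetric] del: ennreal_plus)
  qed
  have "ennreal (exp (- e)) * (\<integral>\<^sup>+x. block_factor e a \<eta> x \<partial>P) + clock_ring e a \<eta> + ennreal (exp (- \<eta> * a)) * survival e a =
     (\<integral>\<^sup>+x. ennreal (exp (- e)) * block_factor e a \<eta> x + (\<integral>\<^sup>+t. ?f x t \<partial>lborel) + ennreal (exp (- \<eta> * a)) * ?g x \<partial>P)"
    unfolding clock_ring_eq[OF e \<eta>, symmetric] nn_integral_survival[OF e a, symmetric]
    by (simp add: nn_integral_add nn_integral_cmult)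
  also have "\<dots> = (\<integral>\<^sup>+x. 1 \<partial>P)" by (intro nn_integral_cong pw) simp
  finally show ?thesis by simp
qed

lemma block_factor_finite:
  assumes e: "0 < e" and \<eta>: "0 < \<eta>" and a: "0 < a"
  shows "(\<integral>\<^sup>+x. block_factor e a \<eta> x \<partial>P) < \<infinity>"
proof -
  have "(\<integral>\<^sup>+x. block_factor e a \<eta> x \<partial>P) \<le> (\<integral>\<^sup>+x. ennreal (exp e) \<partial>P)"
    using hit_time_nonneg[OF _ e] \<eta>
    by (intro nn_integral_mono) (auto simp: block_factor_def intro!: ennreal_leI)
  then show ?thesis by (rule le_less_trans) simp
qed

lemma lag_value_expectation:
  assumes e: "0 < e" and \<eta>: "0 < \<eta>" and a: "0 < a"
    and [measurable]: "h \<in> borel_measurable borel" and bd: "\<And>y. h y \<le> ennreal C"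
  shows "(\<integral>\<^sup>+x. lag_value e a \<eta> h x \<partial>P) =
    ennreal (exp (- \<eta> * a)) * (\<integral>\<^sup>+y. h y * killed_density (- 1 / 2) e a y \<partial>lborel) +
    (\<integral>\<^sup>+x. block_factor e a \<eta> x \<partial>P) * (\<integral>\<^sup>+x. lag_value e a \<eta> h x \<partial>P)"
proof -
  note [measurable] = measurable_block_factor[OF e] measurable_fast[OF e] measurable_restart[OF e] measurable_hit_time[OF e]
    measurable_lag_value[OF e]
  have "(\<integral>\<^sup>+x. lag_value e a \<eta> h x \<partial>P) =
      (\<integral>\<^sup>+x. ennreal (exp (- \<eta> * a)) * (if running_max x 0 a < e then h (x a) else 0) +
         block_factor e a \<eta> x * lag_value e a \<eta> h (shift (hit_time e x) x) \<partial>P)"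
  proof (intro nn_integral_cong)
    fix x assume "x \<in> space P" then have x: "x \<in> paths" by simp
    show "lag_value e a \<eta> h x = ennreal (exp (- \<eta> * a)) * (if running_max x 0 a < e then h (x a) else 0) +
         block_factor e a \<eta> x * lag_value e a \<eta> h (shift (hit_time e x) x)"
      using lag_value_rec[OF x e, of a \<eta> h] fast_iff[OF x e, of a] a
      by (auto simp: restart_def mult.commute not_less)
  qed
  also have "\<dots> = ennreal (exp (- \<eta> * a)) * (\<integral>\<^sup>+x. (if running_max x 0 a < e then h (x a) else 0) \<partial>P) +
      (\<integral>\<^sup>+x. block_factor e a \<eta> x * lag_value e a \<eta> h (shift (hit_time e x) x) \<partial>P)"
    by (simp add: nn_integral_add nn_integral_cmult)
  also have "(\<integral>\<^sup>+x. (if running_max x 0 a < e then h (x a) else 0) \<partial>P) = (\<integral>\<^sup>+y. h y * killed_density (- 1 / 2) e a y \<partial>lborel)"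
    by (rule nn_integral_killed[OF a e _ bd]) measurable
  also have "(\<integral>\<^sup>+x. block_factor e a \<eta> x * lag_value e a \<eta> h (shift (hit_time e x) x) \<partial>P) =
      (\<integral>\<^sup>+x. block_factor e a \<eta> x \<partial>P) * (\<integral>\<^sup>+x. lag_value e a \<eta> h x \<partial>P)"
    by (rule strong_markov_mult)
       (use hit_time_nonneg[OF _ e] adapted_block_factor[OF e] block_factor_finite[OF e \<eta> a] in auto)
  finally show ?thesis .
qed

lemma occupation_expectation:
  assumes e: "0 < e" and \<eta>: "0 < \<eta>" and a: "0 < a"
  shows "(\<integral>\<^sup>+x. occupation e a \<eta> x \<partial>P) = (\<integral>\<^sup>+x. block_occupation e a \<eta> x \<partial>P) +
    (\<integral>\<^sup>+x. block_factor e a \<eta> x \<partial>P) * (\<integral>\<^sup>+x. occupation e a \<eta> x \<partial>P)"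
proof -
  note [measurable] = measurable_block_factor[OF e] measurable_hit_time[OF e] measurable_occupation[OF e]
  have "(\<integral>\<^sup>+x. occupation e a \<eta> x \<partial>P) =
      (\<integral>\<^sup>+x. block_occupation e a \<eta> x + block_factor e a \<eta> x * occupation e a \<eta> (shift (hit_time e x) x) \<partial>P)"
  proof (intro nn_integral_cong)
    fix x assume "x \<in> space P" then have x: "x \<in> paths" by simp
    show "occupation e a \<eta> x = block_occupation e a \<eta> x + block_factor e a \<eta> x * occupation e a \<eta> (shift (hit_time e x) x)"
      using occupation_rec[OF x e less_imp_le[OF a], of \<eta>] by (simp only: restart_def)
  qed
  also have "\<dots> = (\<integral>\<^sup>+x. block_occupation e a \<eta> x \<partial>P) +
      (\<integral>\<^sup>+x. block_factor e a \<eta> x * occupation e a \<eta> (shift (hit_time e x) x) \<partial>P)"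
    by (rule nn_integral_add) measurable
  also have "(\<integral>\<^sup>+x. block_factor e a \<eta> x * occupation e a \<eta> (shift (hit_time e x) x) \<partial>P) =
      (\<integral>\<^sup>+x. block_factor e a \<eta> x \<partial>P) * (\<integral>\<^sup>+x. occupation e a \<eta> x \<partial>P)"
    by (rule strong_markov_mult)
       (use hit_time_nonneg[OF _ e] adapted_block_factor[OF e] block_factor_finite[OF e \<eta> a] in auto)
  finally show ?thesis .
qed

end

section \<open>Gaussian closed forms\<close>

lemma std_normal_density_minus [simp]: "std_normal_density (- x) = std_normal_density x"
  by (simp add: std_normal_density_def)

lemma DERIV_std_normal_density:
  "DERIV std_normal_density x :> - x * std_normal_density x"
  unfolding std_normal_density_def[abs_def]
  by (auto intro!: derivative_eq_intros simp: field_simps)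

text \<open>\<open>cdf\<close> is the measure of a half-line. Its increments near \<open>x\<close>
  are integrals of the density over bounded intervals, to which the fundamental theorem applies;
  since only differences enter, integration may start at \<open>x - 1\<close>.\<close>

lemma DERIV_std_normal_cdf: "DERIV std_normal_cdf x :> std_normal_density x"
proof -
  interpret N: real_distribution std_normal_distribution
    by (rule real_dist_normal_dist)
  let ?F = "\<lambda>y. integral {x - 1..y} std_normal_density"
  have cont: "continuous_on S std_normal_density" for S
    by (intro DERIV_continuous_on[OF has_field_derivative_at_within[OF DERIV_std_normal_density]])
  have F: "DERIV ?F y :> std_normal_density y" if "x - 1 < y" "y < x + 1" for y
  proof -
    have "(?F has_real_derivative std_normal_density y) (at y within {x - 1..x + 1})"
      by (rule integral_has_real_derivative[OF cont]) (use that in auto)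
    then show ?thesis using that by (simp add: at_within_Icc_at)
  qed
  have eq: "std_normal_cdf y - std_normal_cdf z = ?F y - ?F z" if zy: "x - 1 < z" "z < y" "y < x + 1" for y z
  proof -
    have "emeasure std_normal_distribution {z<..y} = (\<integral>\<^sup>+u. ennreal (std_normal_density u) * indicator {z<..y} u \<partial>lborel)"
      by (simp add: emeasure_density)
    also have "\<dots> = (\<integral>\<^sup>+u. ennreal (std_normal_density u) * indicator {z..y} u \<partial>lborel)"
    proof (rule nn_integral_cong_AE)
      show "AE u in lborel. ennreal (std_normal_density u) * indicator {z<..y} u = ennreal (std_normal_density u) * indicator {z..y} u"
        using AE_lborel_singleton[of z] by eventually_elim (auto simp: indicator_def)
    qed
    also have "\<dots> = ennreal (?F y - ?F z)"
      by (rule nn_integral_FTC_Icc) (use zy in \<open>auto intro!: F\<close>)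
    finally have "emeasure std_normal_distribution {z<..y} = ennreal (?F y - ?F z)" .
    moreover have "?F z \<le> ?F y"
      by (rule DERIV_nonneg_imp_nondecreasing[of z y ?F]) (use zy in \<open>auto intro!: exI F\<close>)
    moreover have "std_normal_cdf y - std_normal_cdf z = measure std_normal_distribution {z<..y}"
      by (rule N.cdf_diff_eq[of z y]) (use zy in auto)
    ultimately show ?thesis by (simp add: measure_def)
  qed
  have key: "std_normal_cdf y = std_normal_cdf x + (?F y - ?F x)" if "x - 1 < y" "y < x + 1" for y
    using eq[of x y] eq[of y x] that by (cases x y rule: linorder_cases) auto
  have eq': "std_normal_cdf x + (?F y - ?F x) = std_normal_cdf y" if "y \<in> {x - 1<..<x + 1}" for y
    using that by (intro key[symmetric]) auto
  have "DERIV (\<lambda>y. std_normal_cdf x + (?F y - ?F x)) x :> 0 + (std_normal_density x - 0)"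
    by (rule DERIV_add[OF DERIV_const DERIV_diff[OF F DERIV_const]]) auto
  then have "DERIV (\<lambda>y. std_normal_cdf x + (?F y - ?F x)) x :> std_normal_density x" by simp
  then show ?thesis
  proof (rule has_field_derivative_transform_within_open[where S="{x - 1<..<x + 1}"])
    show "open {x - 1<..<x + 1}" by (rule open_greaterThanLessThan)
    show "x \<in> {x - 1<..<x + 1}" by simp
  qed (rule eq')
qed

lemma std_normal_cdf_at_bot: "(std_normal_cdf \<longlongrightarrow> 0) at_bot"
proof -
  interpret N: real_distribution std_normal_distribution
    by (rule real_dist_normal_dist)
  show ?thesis by (rule N.cdf_lim_at_bot)
qed

text \<open>\<open>std_normal_cdf (- x) + std_normal_cdf x\<close> has derivative 0 and tends to 1
  at infinity.\<close>

lemma std_normal_cdf_minus: "std_normal_cdf (- x) = 1 - std_normal_cdf x"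
proof -
  interpret N: real_distribution std_normal_distribution
    by (rule real_dist_normal_dist)
  let ?f = "\<lambda>x. std_normal_cdf (- x) + std_normal_cdf x"
  have const: "?f x = ?f y" for x y
  proof (rule DERIV_isconst_all[where f="?f"])
    show "\<forall>x. DERIV ?f x :> 0"
    proof
      fix x :: real
      have "DERIV (\<lambda>x. - x) x :> - 1" by (auto intro!: derivative_eq_intros)
      from DERIV_add[OF DERIV_chain'[OF this DERIV_std_normal_cdf] DERIV_std_normal_cdf[of x]]
      show "DERIV ?f x :> 0" by simp
    qed
  qed
  have "(?f \<longlongrightarrow> 0 + 1) at_top"
    by (intro tendsto_add filterlim_compose[OF std_normal_cdf_at_bot] filterlim_uminus_at_bot_at_top N.cdf_lim_at_top_prob)
  moreover have "(?f \<longlongrightarrow> ?f x) at_top"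
    by (subst const[of _ x]) simp
  ultimately have "?f x = 0 + 1" by (intro tendsto_unique[of at_top ?f]) auto
  then show ?thesis by simp
qed

lemma std_normal_cdf_0: "std_normal_cdf 0 = 1 / 2"
  using std_normal_cdf_minus[of 0] by simp

lemma normal_density_eq_std: "0 < \<sigma> \<Longrightarrow> normal_density \<mu> \<sigma> y = std_normal_density ((y - \<mu>) / \<sigma>) / \<sigma>"
  by (simp add: normal_density_def real_sqrt_mult field_simps power2_eq_square)

text \<open>The rate, per unit of level, of excursions below the running maximum that survive for a time \<open>s\<close>
  and are then at depth \<open>y\<close>.\<close>

definition excursion_density :: "real \<Rightarrow> real \<Rightarrow> real \<Rightarrow> real" where
  "excursion_density c s y = (if y < 0 then - 2 * y / s * normal_density (c * s) (sqrt s) y else 0)"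

text \<open>The primitive of \<open>excursion_density\<close> on the negative half-line that
  vanishes at minus infinity: for \<open>y \<le> 0\<close>, the rate of excursions that reach age
  \<open>s\<close> at a depth below \<open>y\<close>. Its value at 0 is \<open>nu_a\<close>, and
  \<open>psi_0\<close> and \<open>psi_1\<close> are built from it.\<close>

definition excursion_tail :: "real \<Rightarrow> real \<Rightarrow> real \<Rightarrow> real" where
  "excursion_tail c s y =
     2 / sqrt s * std_normal_density ((y - c * s) / sqrt s) - 2 * c * std_normal_cdf ((y - c * s) / sqrt s)"

lemma measurable_excursion_density [measurable]: "excursion_density c s \<in> borel_measurable borel"
  unfolding excursion_density_def[abs_def] by measurable

lemma DERIV_excursion_tail:
  assumes "0 < s"
  shows "DERIV (excursion_tail c s) y :> - 2 * y / s * normal_density (c * s) (sqrt s) y"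
proof -
  have s: "0 < sqrt s" "sqrt s * sqrt s = s" using assms by auto
  let ?z = "(y - c * s) / sqrt s"
  have alg: "2 / r * (- z * p * (1 / r)) - 2 * c * (p * (1 / r)) = (- 2 * z / r - 2 * c) * (p / r)" for r z p :: real
    by (cases "r = 0") (auto simp: field_simps)
  have "DERIV (\<lambda>y. y - c * s) y :> 1" by (auto intro!: derivative_eq_intros)
  then have lin: "DERIV (\<lambda>y. (y - c * s) / sqrt s) y :> 1 / sqrt s" by (rule DERIV_cdivide)
  have z: "?z / sqrt s = (y - c * s) / s" using s by simp
  have "DERIV (excursion_tail c s) y :>
      2 / sqrt s * (- ?z * std_normal_density ?z * (1 / sqrt s)) - 2 * c * (std_normal_density ?z * (1 / sqrt s))"
    unfolding excursion_tail_def[abs_def]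
    by (rule DERIV_diff[OF DERIV_cmult[OF DERIV_chain'[OF lin DERIV_std_normal_density]]
        DERIV_cmult[OF DERIV_chain'[OF lin DERIV_std_normal_cdf]]])
  also have "2 / sqrt s * (- ?z * std_normal_density ?z * (1 / sqrt s)) - 2 * c * (std_normal_density ?z * (1 / sqrt s)) =
      (- 2 * ?z / sqrt s - 2 * c) * (std_normal_density ?z / sqrt s)"
    by (rule alg)
  also have "- 2 * ?z / sqrt s - 2 * c = - 2 * y / s"
    using assms s by (simp add: field_simps)
  also have "std_normal_density ?z / sqrt s = normal_density (c * s) (sqrt s) y"
    by (rule normal_density_eq_std[OF s(1), symmetric])
  finally show ?thesis .
qed

lemma std_normal_density_at_bot: "(std_normal_density \<longlongrightarrow> 0) at_bot"
proof -
  have "((\<lambda>x::real. 1 / sqrt (2 * pi) * exp (- x\<^sup>2 / 2)) \<longlongrightarrow> 1 / sqrt (2 * pi) * 0) at_bot"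
    by (intro tendsto_mult tendsto_const filterlim_compose[OF exp_at_bot]) real_asymp
  then show ?thesis by (simp add: std_normal_density_def[abs_def])
qed

lemma excursion_tail_at_bot:
  assumes "0 < s" shows "(excursion_tail c s \<longlongrightarrow> 0) at_bot"
proof -
  have lim: "LIM y at_bot. (y - c * s) / sqrt s :> at_bot"
    using assms by real_asymp
  have "(excursion_tail c s \<longlongrightarrow> 2 / sqrt s * 0 - 2 * c * 0) at_bot"
    unfolding excursion_tail_def[abs_def]
    by (intro tendsto_intros filterlim_compose[OF std_normal_density_at_bot lim] filterlim_compose[OF std_normal_cdf_at_bot lim])
  then show ?thesis by simp
qed

lemma excursion_tail_mono:
  assumes "0 < s" "x < y" "y \<le> 0" shows "excursion_tail c s x < excursion_tail c s y"
proof (rule DERIV_pos_imp_increasing_open[OF assms(2)])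
  fix z assume z: "x < z" "z < y"
  then have "- 2 * z / s * normal_density (c * s) (sqrt s) z > 0"
    using assms z by (intro mult_pos_pos normal_density_pos) (auto simp: divide_less_0_iff)
  with DERIV_excursion_tail[OF assms(1), of c z]
  show "\<exists>d. DERIV (excursion_tail c s) z :> d \<and> 0 < d" by blast
next
  show "continuous_on {x..y} (excursion_tail c s)"
    by (rule DERIV_continuous_on[OF has_field_derivative_at_within[OF DERIV_excursion_tail[OF assms(1)]]])
qed

text \<open>It increases strictly from the limit 0 at minus infinity. At \<open>y = 0\<close> this
  is Mills' inequality for the normal tail.\<close>

lemma excursion_tail_pos:
  assumes "0 < s" "y \<le> 0" shows "0 < excursion_tail c s y"
proof -
  have "0 \<le> excursion_tail c s (y - 1)"
  proof (rule tendsto_upperbound[OF excursion_tail_at_bot[OF assms(1)]])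
    show "\<forall>\<^sub>F x in at_bot. excursion_tail c s x \<le> excursion_tail c s (y - 1)"
      unfolding eventually_at_bot_dense
      using excursion_tail_mono[OF assms(1), of _ "y - 1" c] assms(2) by (auto intro!: exI[of _ "y - 1"] less_imp_le)
  qed simp
  also have "\<dots> < excursion_tail c s y" using assms by (intro excursion_tail_mono) auto
  finally show ?thesis .
qed

lemma nn_integral_excursion_density:
  assumes s: "0 < s" and q: "q \<le> 0"
  shows "(\<integral>\<^sup>+y. (if y < q then 1 else 0) * ennreal (excursion_density c s y) \<partial>lborel) = ennreal (excursion_tail c s q)"
proof -
  have "(\<integral>\<^sup>+y. (if y < q then 1 else 0) * ennreal (excursion_density c s y) \<partial>lborel) =
     (\<integral>\<^sup>+z. (if - z < q then 1 else 0) * ennreal (excursion_density c s (- z)) \<partial>lborel)"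
    \<comment> \<open>Reflection \<open>z = - y\<close>, because the fundamental theorem is applied
      on a half-line that is unbounded to the right.\<close>
    by (subst nn_integral_real_affine[where c="-1" and t=0]) auto
  also have "\<dots> = (\<integral>\<^sup>+z. ennreal (2 * z / s * normal_density (c * s) (sqrt s) (- z)) * indicator {- q..} z \<partial>lborel)"
  proof (rule nn_integral_cong_AE)
    show "AE z in lborel. (if - z < q then 1 else 0) * ennreal (excursion_density c s (- z)) =
        ennreal (2 * z / s * normal_density (c * s) (sqrt s) (- z)) * indicator {- q..} z"
      using AE_lborel_singleton[of "- q"]
    proof eventually_elim
      case (elim z)
      then have "- z < q \<longleftrightarrow> - q \<le> z" by auto
      then show ?case using q elim by (auto simp: excursion_density_def)
    qed
  qed
  also have "\<dots> = ennreal (0 - - excursion_tail c s (- (- q)))"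
  proof (rule nn_integral_FTC_atLeast)
    show "DERIV (\<lambda>z. - excursion_tail c s (- z)) z :> 2 * z / s * normal_density (c * s) (sqrt s) (- z)" for z
      by (rule derivative_eq_intros DERIV_chain'[OF _ DERIV_excursion_tail[OF s]] refl)+ simp
    have "((\<lambda>z. - excursion_tail c s (- z)) \<longlongrightarrow> - 0) at_top"
      by (intro tendsto_minus filterlim_compose[OF excursion_tail_at_bot[OF s]] filterlim_uminus_at_bot_at_top)
    then show "((\<lambda>z. - excursion_tail c s (- z)) \<longlongrightarrow> 0) at_top" by simp
    show "0 \<le> 2 * z / s * normal_density (c * s) (sqrt s) (- z)" if "- q \<le> z" for z
      using that q s by (intro mult_nonneg_nonneg divide_nonneg_pos) auto
  qed measurable
  finally show ?thesis by simp
qed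

text \<open>Weighting by \<open>exp y\<close> is an exponential tilt: it raises the drift from
  \<open>c\<close> to \<open>c + 1\<close> at the price of the constant
  \<open>exp ((c + 1 / 2) * s)\<close>. This is the origin of \<open>cbar\<close> and of the
  exponential prefactor in \<open>psi_1\<close>.\<close>

lemma nn_integral_exp_excursion_density:
  assumes s: "0 < s" and q: "q < 0"
  shows "(\<integral>\<^sup>+y. (if q < y then ennreal (exp y) else 0) * ennreal (excursion_density c s y) \<partial>lborel) =
     ennreal (exp ((c + 1 / 2) * s) * (excursion_tail (c + 1) s 0 - excursion_tail (c + 1) s q))"
proof -
  let ?f = "\<lambda>y. exp ((c + 1 / 2) * s) * (- 2 * y / s * normal_density ((c + 1) * s) (sqrt s) y)"
  have tilt: "exp y * normal_density (c * s) (sqrt s) y = exp ((c + 1 / 2) * s) * normal_density ((c + 1) * s) (sqrt s) y" for y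
  proof -
    have "y + (- (y - c * s)\<^sup>2 / (2 * s)) = (c + 1 / 2) * s + (- (y - (c + 1) * s)\<^sup>2 / (2 * s))"
      using s by (simp add: field_simps power2_eq_square)
    then show ?thesis using s by (simp add: normal_density_def exp_add[symmetric] mult_ac)
  qed
  have "(\<integral>\<^sup>+y. (if q < y then ennreal (exp y) else 0) * ennreal (excursion_density c s y) \<partial>lborel) =
     (\<integral>\<^sup>+y. ennreal (?f y) * indicator {q..0} y \<partial>lborel)"
  proof (rule nn_integral_cong_AE)
    show "AE y in lborel. (if q < y then ennreal (exp y) else 0) * ennreal (excursion_density c s y) = ennreal (?f y) * indicator {q..0} y"
      using AE_lborel_singleton[of q] AE_lborel_singleton[of 0]
    proof eventually_elim
      case (elim y)
      have E: "exp y * (- 2 * y / s * normal_density (c * s) (sqrt s) y) = ?f y"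
        using tilt[of y] by (simp only: mult.left_commute[of "exp _"])
      have "ennreal (exp y) * ennreal (- 2 * y / s * normal_density (c * s) (sqrt s) y) = ennreal (?f y)"
        unfolding E[symmetric] by (rule ennreal_mult'[symmetric]) simp
      then show ?case using elim by (auto simp: excursion_density_def indicator_def)
    qed
  qed
  also have "\<dots> = ennreal (exp ((c + 1 / 2) * s) * excursion_tail (c + 1) s 0 - exp ((c + 1 / 2) * s) * excursion_tail (c + 1) s q)"
  proof (rule nn_integral_FTC_Icc)
    show "DERIV (\<lambda>y. exp ((c + 1 / 2) * s) * excursion_tail (c + 1) s y) y :> ?f y" for y
      by (rule DERIV_cmult[OF DERIV_excursion_tail[OF s]])
    show "0 \<le> ?f y" if "y \<in> {q..0}" for y
    proof -
      have "0 \<le> - 2 * y / s" using that s by (simp add: divide_nonpos_pos)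
      then show ?thesis by (intro mult_nonneg_nonneg) auto
    qed
  qed (use q in auto)
  finally show ?thesis by (simp add: algebra_simps)
qed

lemma excursion_tail_0: "0 < s \<Longrightarrow> excursion_tail c s 0 = nu_a c s"
proof -
  assume s: "0 < s"
  have "(0 - c * s) / sqrt s = - (c * sqrt s)"
    using s real_div_sqrt[of s] by (simp add: times_divide_eq_right[symmetric] del: times_divide_eq_right)
  then show ?thesis by (simp add: excursion_tail_def nu_a_def)
qed

lemma psi_0_eq: "psi_0 c \<eta> a q = exp (- \<eta> * a) * excursion_tail c a q"
  by (simp add: psi_0_def excursion_tail_def)

lemma psi_1_eq:
  assumes a: "0 < a"
  shows "psi_1 c \<eta> a q = exp (- \<eta> * a) * (exp ((c + 1 / 2) * a) * (excursion_tail (c + 1) a 0 - excursion_tail (c + 1) a q))"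
proof -
  have 1: "(0 - (1 + c) * a) / sqrt a = - ((1 + c) * sqrt a)"
    using a real_div_sqrt[of a] by (simp only: diff_0 minus_divide_left[symmetric] times_divide_eq_right[symmetric])
  have 2: "exp ((c + 1 / 2 - \<eta>) * a) = exp (- \<eta> * a) * exp ((c + 1 / 2) * a)"
    by (simp add: exp_add[symmetric] algebra_simps)
  show ?thesis
    unfolding psi_1_def excursion_tail_def 2 Let_def add.commute[of c 1] 1 std_normal_cdf_minus std_normal_density_minus
    by (simp add: algebra_simps)
qed

section \<open>The rates as functions of the lag\<close>

lemma beta_const_sq: "0 \<le> \<eta> \<Longrightarrow> (beta_const c \<eta>)\<^sup>2 = c\<^sup>2 + 2 * \<eta>"
  by (simp add: beta_const_def)

text \<open>This is the reason for the choice of \<open>beta_const\<close>: discounting at rate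
  \<open>\<eta>\<close> amounts to replacing the drift by it in the Gaussian exponent.\<close>

lemma std_normal_density_beta:
  assumes "0 \<le> \<eta>" "0 \<le> t"
  shows "std_normal_density (beta_const c \<eta> * sqrt t) = exp (- \<eta> * t) * std_normal_density (c * sqrt t)"
proof -
  have "(beta_const c \<eta> * sqrt t)\<^sup>2 = (c\<^sup>2 + 2 * \<eta>) * t" "(c * sqrt t)\<^sup>2 = c\<^sup>2 * t"
    using assms beta_const_sq[OF assms(1), of c] by (simp_all add: power_mult_distrib)
  then have "- (beta_const c \<eta> * sqrt t)\<^sup>2 / 2 = - \<eta> * t + - (c * sqrt t)\<^sup>2 / 2" by (simp add: field_simps)
  then show ?thesis unfolding std_normal_density_def by (simp add: exp_add[symmetric] mult.left_commute)
qed

lemma nu_eq: "nu c \<eta> a = nu_alpha c \<eta> a + nu_a c a"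
  unfolding nu_def nu_alpha_def nu_a_def
  by (simp add: std_normal_cdf_minus algebra_simps diff_divide_distrib add_divide_distrib)

text \<open>The terms quadratic in \<open>b\<close> cancel. What remains is minus the Levy density
  of the first passage process of Brownian motion with drift of modulus \<open>b\<close>, so the
  function is the tail of that Levy measure up to a constant.\<close>

lemma DERIV_density_plus_cdf:
  assumes "0 < t"
  shows "DERIV (\<lambda>t. 2 / sqrt t * std_normal_density (b * sqrt t) + 2 * b * std_normal_cdf (b * sqrt t)) t :>
    - std_normal_density (b * sqrt t) / (t * sqrt t)"
proof -
  define r where "r = sqrt t"
  have r: "0 < r" "t = r * r" using assms by (auto simp: r_def)
  have d: "DERIV sqrt t :> 1 / (2 * r)"
    using DERIV_real_sqrt[OF assms] by (simp add: r_def field_simps)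
  have db: "DERIV (\<lambda>t. b * sqrt t) t :> b * (1 / (2 * r))"
    by (rule DERIV_cmult[OF d])
  have di: "DERIV (\<lambda>t. 2 / sqrt t) t :> (0 * sqrt t - 2 * (1 / (2 * r))) / (sqrt t * sqrt t)"
    by (rule DERIV_divide[OF DERIV_const d]) (use assms in auto)
  let ?p = "std_normal_density (b * sqrt t)"
  have "DERIV (\<lambda>t. 2 / sqrt t * std_normal_density (b * sqrt t) + 2 * b * std_normal_cdf (b * sqrt t)) t :>
      ((0 * sqrt t - 2 * (1 / (2 * r))) / (sqrt t * sqrt t) * ?p + - (b * sqrt t) * ?p * (b * (1 / (2 * r))) * (2 / sqrt t))
      + 2 * b * (?p * (b * (1 / (2 * r))))"
    by (rule DERIV_add[OF DERIV_mult[OF di DERIV_chain'[OF db DERIV_std_normal_density]]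
        DERIV_cmult[OF DERIV_chain'[OF db DERIV_std_normal_cdf]]])
  also have "((0 * sqrt t - 2 * (1 / (2 * r))) / (sqrt t * sqrt t) * ?p + - (b * sqrt t) * ?p * (b * (1 / (2 * r))) * (2 / sqrt t))
      + 2 * b * (?p * (b * (1 / (2 * r)))) = - ?p / (t * sqrt t)"
  proof -
    have "((0 * r - 2 * (1 / (2 * r))) / (r * r) * p + - (b * r) * p * (b * (1 / (2 * r))) * (2 / r))
      + 2 * b * (p * (b * (1 / (2 * r)))) = - p / (r * r * r)" for p
      using r(1) by (simp add: field_simps)
    from this[of ?p] show ?thesis by (simp only: r_def[symmetric] r(2)[symmetric])
  qed
  finally show ?thesis .
qed

lemma DERIV_nu_a:
  assumes "0 < t" shows "DERIV (nu_a c) t :> - std_normal_density (c * sqrt t) / (t * sqrt t)"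
proof -
  have "nu_a c = (\<lambda>t. 2 / sqrt t * std_normal_density (- c * sqrt t) + 2 * (- c) * std_normal_cdf (- c * sqrt t))"
    by (rule ext) (simp add: nu_a_def)
  then show ?thesis using DERIV_density_plus_cdf[OF assms, of "- c"] by simp
qed

text \<open>Closed form of the integral of \<open>\<eta> * exp (- \<eta> * t) * nu_a c t\<close>
  over (0, a): the rate, per unit of level, at which the clock rings during an excursion of age
  below \<open>a\<close>.\<close>

definition ring_rate :: "real \<Rightarrow> real \<Rightarrow> real \<Rightarrow> real" where
  "ring_rate c \<eta> t = nu_alpha c \<eta> t + (1 - exp (- \<eta> * t)) * nu_a c t"

lemma DERIV_ring_rate:
  assumes t: "0 < t" and \<eta>: "0 \<le> \<eta>"
  shows "DERIV (ring_rate c \<eta>) t :> \<eta> * exp (- \<eta> * t) * nu_a c t"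
proof -
  let ?b = "beta_const c \<eta>"
  let ?k = "\<lambda>b t. 2 / sqrt t * std_normal_density (b * sqrt t) + 2 * b * std_normal_cdf (b * sqrt t)"
  have eq: "ring_rate c \<eta> = (\<lambda>t. ((?k ?b t - ?k c t) + (c - ?b)) + (1 - exp (- \<eta> * t)) * nu_a c t)"
    by (rule ext) (simp add: ring_rate_def nu_alpha_def algebra_simps diff_divide_distrib)
  have dexp: "DERIV (\<lambda>t. 1 - exp (- \<eta> * t)) t :> \<eta> * exp (- \<eta> * t)"
    by (auto intro!: derivative_eq_intros)
  let ?p = "std_normal_density (c * sqrt t)"
  have "DERIV (ring_rate c \<eta>) t :>
      ((- std_normal_density (?b * sqrt t) / (t * sqrt t) - - ?p / (t * sqrt t)) + 0) +
      (\<eta> * exp (- \<eta> * t) * nu_a c t + - ?p / (t * sqrt t) * (1 - exp (- \<eta> * t)))"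
    unfolding eq
    by (rule DERIV_add[OF DERIV_add[OF DERIV_diff[OF DERIV_density_plus_cdf[OF t] DERIV_density_plus_cdf[OF t]] DERIV_const]
        DERIV_mult[OF dexp DERIV_nu_a[OF t]]])
  then show ?thesis
    unfolding std_normal_density_beta[OF \<eta> less_imp_le[OF t]] by (simp add: algebra_simps diff_divide_distrib)
qed

text \<open>The terms with \<open>2 / sqrt t\<close> cancel exactly once
  \<open>std_normal_density_beta\<close> is inserted; the remaining expression is continuous at
  0.\<close>

lemma ring_rate_at_0:
  assumes \<eta>: "0 \<le> \<eta>" shows "(ring_rate c \<eta> \<longlongrightarrow> 0) (at_right 0)"
proof -
  let ?b = "beta_const c \<eta>"
  have root: "((\<lambda>t. k * sqrt t) \<longlongrightarrow> k * 0) (at_right 0)" for k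
    using tendsto_real_sqrt[OF tendsto_ident_at, of 0 "{0<..}"] by (intro tendsto_mult tendsto_const) simp
  have cdf: "((\<lambda>t. std_normal_cdf (k * sqrt t)) \<longlongrightarrow> std_normal_cdf 0) (at_right 0)" for k
    using isCont_tendsto_compose[OF DERIV_isCont[OF DERIV_std_normal_cdf] root[of k, simplified]] .
  have dens: "((\<lambda>t. std_normal_density (k * sqrt t)) \<longlongrightarrow> std_normal_density 0) (at_right 0)" for k
    using isCont_tendsto_compose[OF DERIV_isCont[OF DERIV_std_normal_density] root[of k, simplified]] .
  have small: "((\<lambda>t. 2 / sqrt t * (1 - exp (- \<eta> * t))) \<longlongrightarrow> 0) (at_right 0)" by real_asymp
  have small': "((\<lambda>t. 1 - exp (- \<eta> * t)) \<longlongrightarrow> 0) (at_right 0)" by real_asymp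
  let ?p = "\<lambda>t. std_normal_density (c * sqrt t)"
  let ?e = "\<lambda>t. 1 - exp (- \<eta> * t)"
  have "((\<lambda>t. 2 * ?b * (std_normal_cdf (?b * sqrt t) - 1 / 2) - 2 * c * (std_normal_cdf (c * sqrt t) - 1 / 2)
      - ?e t * (2 * c * std_normal_cdf (- c * sqrt t))) \<longlongrightarrow>
      2 * ?b * (std_normal_cdf 0 - 1 / 2) - 2 * c * (std_normal_cdf 0 - 1 / 2) - 0 * (2 * c * std_normal_cdf 0)) (at_right 0)"
    by (intro tendsto_intros cdf small')
  then have "((\<lambda>t. 2 * ?b * (std_normal_cdf (?b * sqrt t) - 1 / 2) - 2 * c * (std_normal_cdf (c * sqrt t) - 1 / 2)
      - ?e t * (2 * c * std_normal_cdf (- c * sqrt t))) \<longlongrightarrow> 0) (at_right 0)"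
    by (simp add: std_normal_cdf_0)
  moreover have "eventually (\<lambda>t. 2 * ?b * (std_normal_cdf (?b * sqrt t) - 1 / 2) - 2 * c * (std_normal_cdf (c * sqrt t) - 1 / 2)
      - ?e t * (2 * c * std_normal_cdf (- c * sqrt t)) = ring_rate c \<eta> t) (at_right 0)"
    unfolding eventually_at_right_field
  proof (intro exI[of _ 1] conjI allI impI)
    fix t :: real assume "0 < t"
    then show "2 * ?b * (std_normal_cdf (?b * sqrt t) - 1 / 2) - 2 * c * (std_normal_cdf (c * sqrt t) - 1 / 2)
      - ?e t * (2 * c * std_normal_cdf (- c * sqrt t)) = ring_rate c \<eta> t"
      unfolding ring_rate_def nu_alpha_def nu_a_def
      by (subst std_normal_density_beta[OF \<eta>]) (auto simp: algebra_simps diff_divide_distrib)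
  qed simp
  ultimately show ?thesis by (rule Lim_transform_eventually)
qed

lemma nu_a_pos: "0 < t \<Longrightarrow> 0 < nu_a c t"
  using excursion_tail_pos[of t 0 c] by (simp add: excursion_tail_0)

text \<open>The integrand is unbounded near 0, so the fundamental theorem is applied on the open
  interval, with one-sided limits of the primitive.\<close>

lemma nn_integral_ring_rate:
  assumes "0 < \<eta>" "0 < a"
  shows "(\<integral>\<^sup>+t. (if 0 < t \<and> t < a then ennreal (\<eta> * exp (- \<eta> * t)) * ennreal (nu_a c t) else 0) \<partial>lborel) = ennreal (ring_rate c \<eta> a)"
    and "0 \<le> ring_rate c \<eta> a"
proof -
  let ?f = "\<lambda>t. \<eta> * exp (- \<eta> * t) * nu_a c t"
  have \<eta>: "0 \<le> \<eta>" using assms by simp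
  have cont: "isCont (ring_rate c \<eta>) a"
    by (rule DERIV_isCont[OF DERIV_ring_rate[OF assms(2) \<eta>]])
  have d: "DERIV (ring_rate c \<eta>) t :> ?f t" and c: "isCont ?f t" if "0 < ereal t" "ereal t < ereal a" for t
    using that DERIV_ring_rate[OF _ \<eta>] by (auto intro!: continuous_intros DERIV_isCont[OF DERIV_nu_a])
  have nn: "AE t in lborel. 0 < ereal t \<longrightarrow> ereal t < ereal a \<longrightarrow> 0 \<le> ?f t"
    using assms nu_a_pos by (intro AE_I2) (auto intro!: mult_nonneg_nonneg less_imp_le)
  have l0: "((ring_rate c \<eta> \<circ> real_of_ereal) \<longlongrightarrow> 0) (at_right 0)"
    using ring_rate_at_0[OF \<eta>, of c] by (simp add: zero_ereal_def ereal_tendsto_simps)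
  have la: "((ring_rate c \<eta> \<circ> real_of_ereal) \<longlongrightarrow> ring_rate c \<eta> a) (at_left (ereal a))"
    using cont by (simp add: ereal_tendsto_simps isCont_def filterlim_at_split)
  have "0 < ereal a" using assms by simp
  note * = interval_integral_FTC_nonneg[OF this d c nn l0 la]
  have ei: "einterval 0 (ereal a) = {0<..<a}" by (auto simp: einterval_def)
  have int: "integrable lborel (\<lambda>t. indicator {0<..<a} t * ?f t)"
    using *(1) unfolding set_integrable_def ei by simp
  have val: "(LINT t|lborel. indicator {0<..<a} t * ?f t) = ring_rate c \<eta> a"
    using *(2) assms(2) unfolding interval_lebesgue_integral_def set_lebesgue_integral_def ei by (simp add: zero_ereal_def)
  have nn: "0 \<le> indicator {0<..<a} t * ?f t" for t
    using assms nu_a_pos[of t c] by (auto simp: indicator_def intro!: mult_nonneg_nonneg less_imp_le)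
  show "0 \<le> ring_rate c \<eta> a" unfolding val[symmetric] using nn by (rule Bochner_Integration.integral_nonneg)
  have "(\<integral>\<^sup>+t. (if 0 < t \<and> t < a then ennreal (\<eta> * exp (- \<eta> * t)) * ennreal (nu_a c t) else 0) \<partial>lborel) =
     (\<integral>\<^sup>+t. ennreal (indicator {0<..<a} t * ?f t) \<partial>lborel)"
    using assms by (intro nn_integral_cong) (auto simp: indicator_def ennreal_mult'[symmetric])
  also have "\<dots> = ennreal (ring_rate c \<eta> a)"
    unfolding val[symmetric] using nn by (intro nn_integral_eq_integral int AE_I2)
  finally show "(\<integral>\<^sup>+t. (if 0 < t \<and> t < a then ennreal (\<eta> * exp (- \<eta> * t)) * ennreal (nu_a c t) else 0) \<partial>lborel) = ennreal (ring_rate c \<eta> a)" .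
qed

lemma nu_eq_ring_rate: "nu c \<eta> a = ring_rate c \<eta> a + exp (- \<eta> * a) * nu_a c a"
  by (simp add: nu_eq ring_rate_def algebra_simps)

text \<open>The gap \<open>\<nu> - 1 - \<psi>\<^sub>1(-\<infinity>)\<close> vanishes at \<open>a = 0\<close> and increases with \<open>a\<close> by Mills' inequality,
  which is the positivity of \<^const>\<open>excursion_tail\<close>.\<close>

lemma denominator_pos:
  assumes \<eta>: "0 < \<eta>" and a: "0 < a" and q: "q \<le> 0"
  shows "0 < nu (- 1 / 2) \<eta> a - 1 - psi_1 (- 1 / 2) \<eta> a q"
proof -
  let ?c = "- 1 / 2 :: real"
  let ?b = "beta_const ?c \<eta>"
  \<comment> \<open>\<open>g t\<close> is \<open>nu - 1\<close> minus the value of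
    \<open>psi_1\<close> with \<open>q\<close> at minus infinity, both for lag \<open>t\<close>. The
    singular terms \<open>2 / sqrt t\<close> have been cancelled, which makes \<open>g\<close>
    continuous at 0 with \<open>g 0 = 0\<close>.\<close>
  define g where "g t = ?b * (2 * std_normal_cdf (?b * sqrt t) - 1) - 1 / 2 + exp (- \<eta> * t) * std_normal_cdf (- 1 / 2 * sqrt t)" for t
  have b2: "?b * ?b = 1 / 4 + 2 * \<eta>" using beta_const_sq[of \<eta> ?c] \<eta> by (simp add: power2_eq_square)
  have b0: "std_normal_density (?b * sqrt t) = exp (- \<eta> * t) * std_normal_density (1 / 2 * sqrt t)" if "0 \<le> t" for t
    using std_normal_density_beta[of \<eta> t ?c] \<eta> that std_normal_density_minus[of "1 / 2 * sqrt t"] by simp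
  have tail: "excursion_tail (1 / 2) t 0 = 2 / sqrt t * std_normal_density (1 / 2 * sqrt t) - std_normal_cdf (- 1 / 2 * sqrt t)" if "0 < t" for t
    using excursion_tail_0[OF that, of "1 / 2"] by (simp add: nu_a_def)
  have "g 0 < g a"
  proof (rule DERIV_pos_imp_increasing_open[OF a])
    fix t assume t: "0 < t" "t < a"
    define r where "r = sqrt t"
    have r: "0 < r" using t by (simp add: r_def)
    have d: "DERIV sqrt t :> 1 / (2 * r)"
      using DERIV_real_sqrt[OF t(1)] by (simp add: r_def field_simps)
    have dk: "DERIV (\<lambda>t. std_normal_cdf (k * sqrt t)) t :> std_normal_density (k * sqrt t) * (k * (1 / (2 * r)))" for k
      by (rule DERIV_chain'[OF DERIV_cmult[OF d] DERIV_std_normal_cdf])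
    have dexp: "DERIV (\<lambda>t. exp (- \<eta> * t)) t :> - \<eta> * exp (- \<eta> * t)"
      by (auto intro!: derivative_eq_intros)
    let ?p = "std_normal_density (1 / 2 * sqrt t)" and ?E = "exp (- \<eta> * t)" and ?P = "std_normal_cdf (- 1 / 2 * sqrt t)"
    have "DERIV g t :> ?b * (2 * (std_normal_density (?b * sqrt t) * (?b * (1 / (2 * r)))) - 0) - 0 +
        (- \<eta> * ?E * ?P + std_normal_density (- 1 / 2 * sqrt t) * (- 1 / 2 * (1 / (2 * r))) * ?E)"
      unfolding g_def[abs_def]
      by (rule DERIV_add[OF DERIV_diff[OF DERIV_cmult[OF DERIV_diff[OF DERIV_cmult[OF dk] DERIV_const]] DERIV_const] DERIV_mult[OF dexp dk]])
    also have "std_normal_density (- 1 / 2 * sqrt t) = ?p"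
      using std_normal_density_minus[of "1 / 2 * sqrt t"] by simp
    also have "?b * (2 * (std_normal_density (?b * sqrt t) * (?b * (1 / (2 * r)))) - 0) - 0 +
        (- \<eta> * ?E * ?P + ?p * (- 1 / 2 * (1 / (2 * r))) * ?E) = \<eta> * ?E * (2 / r * ?p - ?P)"
    proof -
      have "?b * (2 * ((E * p) * (?b * (1 / (2 * r)))) - 0) - 0 + (- \<eta> * E * P + p * (- 1 / 2 * (1 / (2 * r))) * E) =
          (?b * ?b - 1 / 4) * (E * p / r) - \<eta> * E * P" for E p P
        using r by (simp add: field_simps)
      note key = this[of ?E ?p ?P]
      show ?thesis
        unfolding b0[OF less_imp_le[OF t(1)]] key b2 by (simp add: algebra_simps)
    qed
    also have "2 / r * ?p - ?P = excursion_tail (1 / 2) t 0" using tail[OF t(1)] by (simp add: r_def)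
    finally have "DERIV g t :> \<eta> * ?E * excursion_tail (1 / 2) t 0" .
    moreover have "0 < \<eta> * ?E * excursion_tail (1 / 2) t 0"
      using \<eta> excursion_tail_pos[OF t(1), of 0 "1 / 2"] by simp
    ultimately show "\<exists>d. DERIV g t :> d \<and> 0 < d" by blast
  next
    have "continuous_on UNIV std_normal_cdf"
      by (rule DERIV_continuous_on[OF has_field_derivative_at_within[OF DERIV_std_normal_cdf]])
    then have "continuous_on {0..a} (\<lambda>t. std_normal_cdf (k * sqrt t))" for k
      by (rule continuous_on_compose2) (auto intro!: continuous_intros)
    then show "continuous_on {0..a} g" unfolding g_def by (intro continuous_intros)
  qed
  also have "g a = nu ?c \<eta> a - 1 - exp (- \<eta> * a) * excursion_tail (1 / 2) a 0"
    unfolding g_def nu_def tail[OF a] b0[OF less_imp_le[OF a]] by (simp add: algebra_simps)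
  finally have "0 < nu ?c \<eta> a - 1 - exp (- \<eta> * a) * excursion_tail (1 / 2) a 0"
    by (simp add: g_def std_normal_cdf_0)
  \<comment> \<open>Dropping the positive term \<open>excursion_tail (1 / 2) a q\<close> is the
    passage to \<open>q\<close> at minus infinity; the prefactor
    \<open>exp ((c + 1 / 2) * a)\<close> is 1 at this drift.\<close>
  moreover have "psi_1 ?c \<eta> a q \<le> exp (- \<eta> * a) * excursion_tail (1 / 2) a 0"
    using excursion_tail_pos[OF a q, of "1 / 2"] by (simp add: psi_1_eq[OF a])
  ultimately show ?thesis by simp
qed

section \<open>The limit of vanishing level width\<close>

text \<open>From \<open>1 - exp (- u) \<le> u\<close>. The bound is of first order in
  \<open>e\<close>, so it survives the division by \<open>e\<close>.\<close>

lemma killed_density_le: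
  assumes "0 < e" "0 < s"
  shows "killed_density c e s y \<le> 2 * e / s * (e + \<bar>y\<bar>) * normal_density (c * s) (sqrt s) y"
proof (cases "y < e")
  case True
  have "1 - exp (- 2 * e * (e - y) / s) \<le> 2 * e * (e - y) / s"
    using exp_ge_add_one_self[of "- 2 * e * (e - y) / s"] by simp
  also have "\<dots> \<le> 2 * e * (e + \<bar>y\<bar>) / s"
    using assms by (intro divide_right_mono mult_left_mono) auto
  finally have "(1 - exp (- 2 * e * (e - y) / s)) * normal_density (c * s) (sqrt s) y \<le>
      2 * e * (e + \<bar>y\<bar>) / s * normal_density (c * s) (sqrt s) y"
    by (intro mult_right_mono) auto
  then show ?thesis using True by (simp add: killed_density_def)
next
  case False
  have "0 \<le> 2 * e / s * (e + \<bar>y\<bar>) * normal_density (c * s) (sqrt s) y"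
    using assms by (intro mult_nonneg_nonneg) auto
  then show ?thesis using False by (simp add: killed_density_def)
qed

lemma nn_integral_abs_normal_le:
  assumes s: "0 < s" and k: "0 \<le> k"
  shows "(\<integral>\<^sup>+y. ennreal ((k + \<bar>y\<bar>) * normal_density (c * s) (sqrt s) y) \<partial>lborel) \<le> ennreal (k + \<bar>c\<bar> * s + sqrt s)"
proof -
  let ?\<phi> = "normal_density (c * s) (sqrt s)"
  have abs: "has_bochner_integral lborel (\<lambda>y. ?\<phi> y * \<bar>y - c * s\<bar> ^ (2 * 0 + 1)) (2 ^ 0 * sqrt s ^ (2 * 0 + 1) * fact 0 * sqrt (2 / pi))"
    using normal_moment_abs_odd[of _ _ 0] s by simp
  have "(\<integral>\<^sup>+y. ennreal (?\<phi> y * \<bar>y - c * s\<bar>) \<partial>lborel) = ennreal (sqrt s * sqrt (2 / pi))"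
    using abs by (subst nn_integral_eq_integral) (auto simp: has_bochner_integral_iff)
  also have "\<dots> \<le> ennreal (sqrt s)"
  proof (rule ennreal_leI)
    have "sqrt (2 / pi) \<le> 1" using pi_gt3 by simp
    then show "sqrt s * sqrt (2 / pi) \<le> sqrt s" using s by (simp add: mult_left_le)
  qed
  finally have m: "(\<integral>\<^sup>+y. ennreal (?\<phi> y * \<bar>y - c * s\<bar>) \<partial>lborel) \<le> ennreal (sqrt s)" .
  have tot: "(\<integral>\<^sup>+y. ennreal (?\<phi> y) \<partial>lborel) = 1"
  proof -
    interpret N: prob_space "density lborel ?\<phi>" by (rule prob_space_normal_density) (use s in simp)
    show ?thesis using N.emeasure_space_1 by (simp add: emeasure_density)
  qed
  have "(\<integral>\<^sup>+y. ennreal ((k + \<bar>y\<bar>) * ?\<phi> y) \<partial>lborel) \<le>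
      (\<integral>\<^sup>+y. ennreal (k + \<bar>c\<bar> * s) * ennreal (?\<phi> y) + ennreal (?\<phi> y * \<bar>y - c * s\<bar>) \<partial>lborel)"
  proof (intro nn_integral_mono)
    fix y
    have "\<bar>y\<bar> \<le> \<bar>c\<bar> * s + \<bar>y - c * s\<bar>" using abs_triangle_ineq[of "c * s" "y - c * s"] s by (simp add: abs_mult)
    then have "(k + \<bar>y\<bar>) * ?\<phi> y \<le> (k + \<bar>c\<bar> * s + \<bar>y - c * s\<bar>) * ?\<phi> y"
      by (intro mult_right_mono) auto
    also have "\<dots> = (k + \<bar>c\<bar> * s) * ?\<phi> y + ?\<phi> y * \<bar>y - c * s\<bar>" by (simp add: algebra_simps)
    finally have "ennreal ((k + \<bar>y\<bar>) * ?\<phi> y) \<le> ennreal ((k + \<bar>c\<bar> * s) * ?\<phi> y + ?\<phi> y * \<bar>y - c * s\<bar>)"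
      by (rule ennreal_leI)
    also have "\<dots> = ennreal (k + \<bar>c\<bar> * s) * ennreal (?\<phi> y) + ennreal (?\<phi> y * \<bar>y - c * s\<bar>)"
      using s k by (subst ennreal_plus) (auto simp: ennreal_mult)
    finally show "ennreal ((k + \<bar>y\<bar>) * ?\<phi> y) \<le> ennreal (k + \<bar>c\<bar> * s) * ennreal (?\<phi> y) + ennreal (?\<phi> y * \<bar>y - c * s\<bar>)" .
  qed
  also have "\<dots> = ennreal (k + \<bar>c\<bar> * s) + (\<integral>\<^sup>+y. ennreal (?\<phi> y * \<bar>y - c * s\<bar>) \<partial>lborel)"
    by (simp add: nn_integral_add nn_integral_cmult tot)
  also have "\<dots> \<le> ennreal (k + \<bar>c\<bar> * s) + ennreal (sqrt s)" using m by (rule add_left_mono)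
  also have "\<dots> = ennreal (k + \<bar>c\<bar> * s + sqrt s)" using s k by (subst ennreal_plus) auto
  finally show ?thesis .
qed

text \<open>For \<open>y < 0\<close> this is a difference quotient at 0 of
  \<open>1 - exp (- 2 * \<epsilon> * (\<epsilon> - y) / s)\<close> as a function of
  \<open>\<epsilon>\<close>; for \<open>y > 0\<close> the density vanishes once
  \<open>e n < y\<close>.\<close>

lemma killed_density_tendsto:
  fixes e :: "nat \<Rightarrow> real"
  assumes e: "\<And>n. 0 < e n" "e \<longlonglongrightarrow> 0" and s: "0 < s" and y: "y \<noteq> 0"
  shows "(\<lambda>n. killed_density c (e n) s y / e n) \<longlonglongrightarrow> excursion_density c s y"
proof (cases "y < 0")
  case True
  let ?g = "\<lambda>\<epsilon>. 1 - exp (- 2 * \<epsilon> * (\<epsilon> - y) / s)"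
  have "DERIV ?g 0 :> - 2 * y / s"
    using s by (auto intro!: derivative_eq_intros)
  then have "((\<lambda>h. (?g (0 + h) - ?g 0) / h) \<longlongrightarrow> - 2 * y / s) (at 0)" by (simp add: DERIV_def)
  moreover have "filterlim e (at 0) sequentially"
    using e by (simp add: filterlim_at less_imp_neq[THEN not_sym])
  ultimately have "(\<lambda>n. (?g (0 + e n) - ?g 0) / e n) \<longlonglongrightarrow> - 2 * y / s" by (rule filterlim_compose)
  then have "(\<lambda>n. (?g (0 + e n) - ?g 0) / e n * normal_density (c * s) (sqrt s) y) \<longlonglongrightarrow>
      - 2 * y / s * normal_density (c * s) (sqrt s) y"
    by (intro tendsto_mult tendsto_const)
  moreover have "(?g (0 + e n) - ?g 0) / e n * normal_density (c * s) (sqrt s) y = killed_density c (e n) s y / e n" for n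
    using True e(1)[of n] by (simp add: killed_density_def)
  ultimately have "(\<lambda>n. killed_density c (e n) s y / e n) \<longlonglongrightarrow> - 2 * y / s * normal_density (c * s) (sqrt s) y"
    by (simp only:)
  then show ?thesis unfolding excursion_density_def using True by (simp only: if_True)
next
  case False
  with y have "0 < y" by simp
  from order_tendstoD(2)[OF e(2) this] have "\<forall>\<^sub>F n in sequentially. killed_density c (e n) s y / e n = 0"
    by eventually_elim (simp add: killed_density_def)
  then show ?thesis using False by (simp add: excursion_density_def tendsto_eventually)
qed

lemma killed_density_integral_tendsto:
  fixes e :: "nat \<Rightarrow> real"
  assumes e: "\<And>n. 0 < e n" "\<And>n. e n \<le> 1" "e \<longlonglongrightarrow> 0" and s: "0 < s"
    and [measurable]: "h \<in> borel_measurable borel" and bd: "\<And>y. h y \<le> ennreal C"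
  shows "(\<lambda>n. ennreal (1 / e n) * (\<integral>\<^sup>+y. h y * killed_density c (e n) s y \<partial>lborel)) \<longlonglongrightarrow>
     (\<integral>\<^sup>+y. h y * excursion_density c s y \<partial>lborel)"
proof -
  let ?\<phi> = "normal_density (c * s) (sqrt s)"
  have C: "h y < top" for y using bd[of y] by (auto intro: le_less_trans)
  have eq: "ennreal (1 / e n) * (\<integral>\<^sup>+y. h y * killed_density c (e n) s y \<partial>lborel) =
      (\<integral>\<^sup>+y. h y * ennreal (killed_density c (e n) s y / e n) \<partial>lborel)" for n
  proof -
    have "ennreal (1 / e n) * (h y * killed_density c (e n) s y) = h y * ennreal (killed_density c (e n) s y / e n)" for y
    proof -
      have "ennreal (1 / e n) * ennreal (killed_density c (e n) s y) = ennreal (killed_density c (e n) s y / e n)"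
        using e(1)[of n] by (simp add: ennreal_mult'[symmetric])
      then show ?thesis by (metis mult.left_commute)
    qed
    then show ?thesis by (simp add: nn_integral_cmult[symmetric])
  qed
  show ?thesis unfolding eq
  proof (rule nn_integral_dominated_convergence[where w="\<lambda>y. ennreal C * (ennreal (2 / s) * ennreal ((1 + \<bar>y\<bar>) * ?\<phi> y))"])
    show "AE y in lborel. h y * ennreal (killed_density c (e n) s y / e n) \<le> ennreal C * (ennreal (2 / s) * ennreal ((1 + \<bar>y\<bar>) * ?\<phi> y))" for n
    proof (intro AE_I2 mult_mono bd)
      fix y
      have "killed_density c (e n) s y / e n \<le> (2 * e n / s * (e n + \<bar>y\<bar>) * ?\<phi> y) / e n"
        using killed_density_le[OF e(1) s] e(1)[of n] by (intro divide_right_mono) auto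
      also have "\<dots> = 2 / s * ((e n + \<bar>y\<bar>) * ?\<phi> y)" using e(1)[of n] by simp
      also have "\<dots> \<le> 2 / s * ((1 + \<bar>y\<bar>) * ?\<phi> y)"
        using s e(2)[of n] by (intro mult_left_mono mult_right_mono) auto
      finally show "ennreal (killed_density c (e n) s y / e n) \<le> ennreal (2 / s) * ennreal ((1 + \<bar>y\<bar>) * ?\<phi> y)"
        using s by (subst ennreal_mult[symmetric]) (auto intro!: ennreal_leI)
    qed auto
    have "(\<integral>\<^sup>+y. ennreal C * (ennreal (2 / s) * ennreal ((1 + \<bar>y\<bar>) * ?\<phi> y)) \<partial>lborel) =
        ennreal C * (ennreal (2 / s) * (\<integral>\<^sup>+y. ennreal ((1 + \<bar>y\<bar>) * ?\<phi> y) \<partial>lborel))"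
      by (simp add: nn_integral_cmult)
    also have "\<dots> < \<infinity>"
      using le_less_trans[OF nn_integral_abs_normal_le[OF s, of 1 c] ennreal_less_top]
      by (auto simp: ennreal_mult_less_top)
    finally show "(\<integral>\<^sup>+y. ennreal C * (ennreal (2 / s) * ennreal ((1 + \<bar>y\<bar>) * ?\<phi> y)) \<partial>lborel) < \<infinity>" .
    show "AE y in lborel. (\<lambda>n. h y * ennreal (killed_density c (e n) s y / e n)) \<longlonglongrightarrow> h y * ennreal (excursion_density c s y)"
      using AE_lborel_singleton[of 0]
      by eventually_elim (intro ennreal_tendsto_cmult C tendsto_ennrealI killed_density_tendsto e s)
  qed measurable
qed

text \<open>The integrand is the majorant of survival probabilities divided by the level width; a
  primitive is \<open>8 * sqrt t + t\<close>.\<close>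

lemma nn_integral_root_bound:
  assumes "0 < a"
  shows "(\<integral>\<^sup>+t. (if 0 < t \<and> t < a then ennreal (4 / sqrt t + 1) else 0) \<partial>lborel) < \<infinity>"
proof -
  let ?f = "\<lambda>t::real. 4 / sqrt t + 1" and ?F = "\<lambda>t::real. 8 * sqrt t + t"
  have d: "DERIV ?F t :> ?f t" and c: "isCont ?f t" if "0 < ereal t" "ereal t < ereal a" for t
  proof -
    have t: "0 < t" using that by simp
    have "DERIV ?F t :> 8 * (inverse (sqrt t) / 2) + 1"
      by (intro DERIV_add DERIV_cmult DERIV_real_sqrt t DERIV_ident)
    also have "8 * (inverse (sqrt t) / 2) + 1 = ?f t" using t by (simp add: field_simps)
    finally show "DERIV ?F t :> ?f t" .
    show "isCont ?f t"
      by (rule DERIV_isCont[OF DERIV_add[OF DERIV_divide[OF DERIV_const DERIV_real_sqrt[OF t]] DERIV_const]]) (use t in simp)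
  qed
  have nn: "AE t in lborel. 0 < ereal t \<longrightarrow> ereal t < ereal a \<longrightarrow> 0 \<le> ?f t" by (intro AE_I2) auto
  have "(?F \<longlongrightarrow> 8 * sqrt 0 + 0) (at_right 0)"
    by (rule tendsto_add[OF tendsto_mult[OF tendsto_const tendsto_real_sqrt[OF tendsto_ident_at]] tendsto_ident_at])
  then have l0: "((?F \<circ> real_of_ereal) \<longlongrightarrow> 0) (at_right 0)"
    by (simp add: zero_ereal_def ereal_tendsto_simps)
  have "(?F \<longlongrightarrow> 8 * sqrt a + a) (at_left a)"
    by (rule tendsto_add[OF tendsto_mult[OF tendsto_const tendsto_real_sqrt[OF tendsto_ident_at]] tendsto_ident_at])
  then have la: "((?F \<circ> real_of_ereal) \<longlongrightarrow> 8 * sqrt a + a) (at_left (ereal a))"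
    by (simp add: ereal_tendsto_simps)
  have "0 < ereal a" using assms by simp
  from interval_integral_FTC_nonneg(1)[OF this d c nn l0 la]
  have si: "set_integrable lborel (einterval 0 (ereal a)) ?f" .
  have ei: "einterval 0 (ereal a) = {0<..<a}" by (auto simp: einterval_def)
  have "integrable lborel (\<lambda>t. indicator {0<..<a} t * ?f t)"
    using si unfolding set_integrable_def ei by simp
  then have "(\<integral>\<^sup>+t. ennreal (norm (indicator {0<..<a} t * ?f t)) \<partial>lborel) < \<infinity>"
    by (simp add: integrable_iff_bounded)
  also have "(\<integral>\<^sup>+t. ennreal (norm (indicator {0<..<a} t * ?f t)) \<partial>lborel) = (\<integral>\<^sup>+t. (if 0 < t \<and> t < a then ennreal (?f t) else 0) \<partial>lborel)"
    by (intro nn_integral_cong) (auto simp: indicator_def)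
  finally show ?thesis .
qed

section \<open>Limit functionals and pathwise convergence\<close>

definition level_width :: "nat \<Rightarrow> real" where "level_width n = inverse (real (Suc n))"

lemma level_width: "0 < level_width n" "level_width n \<le> 1" "level_width \<longlonglongrightarrow> 0"
  using LIMSEQ_inverse_real_of_nat by (auto simp: level_width_def[abs_def] field_simps)

definition has_lag :: "real \<Rightarrow> (real \<Rightarrow> real) \<Rightarrow> bool" where
  "has_lag a x \<longleftrightarrow> (\<exists>s. lag_at a x s)"

text \<open>\<open>has_lag\<close> quantifies over uncountably many times, whereas boundedness of
  the stall starts along \<open>level_width\<close> is a countable condition and gives
  measurability. Without a lag the stall starts leave every bounded interval.\<close>

lemma has_lag_iff:
  assumes x: "x \<in> paths" and a: "0 \<le> a"
  shows "has_lag a x \<longleftrightarrow> (\<exists>B::nat. \<forall>n. stalls (level_width n) a x \<and> stall_start (level_width n) a x \<le> real B)"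
proof
  assume h: "has_lag a x"
  obtain B :: nat where "first_lag a x \<le> real B" using real_arch_simple by blast
  then show "\<exists>B::nat. \<forall>n. stalls (level_width n) a x \<and> stall_start (level_width n) a x \<le> real B"
    using stall_start_tendsto(1,2)[OF x a level_width(1,3) h[unfolded has_lag_def]] by (meson order_trans)
next
  assume "\<exists>B::nat. \<forall>n. stalls (level_width n) a x \<and> stall_start (level_width n) a x \<le> real B"
  then obtain B :: nat where B: "\<And>n. stalls (level_width n) a x" "\<And>n. stall_start (level_width n) a x \<le> real B" by blast
  show "has_lag a x"
  proof (rule ccontr)
    assume "\<not> has_lag a x"
    then have "\<not> lag_at a x s" for s by (simp add: has_lag_def)
    from stall_start_eventually_greater[OF x level_width(1,3) this, of "real B"]
    have "\<forall>\<^sub>F n in sequentially. False"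
      by eventually_elim (use B in \<open>auto simp: not_less[symmetric]\<close>)
    then show False by simp
  qed
qed

lemma measurable_has_lag [measurable]:
  assumes a: "0 \<le> a" shows "Measurable.pred path_space (has_lag a)"
proof -
  note [measurable] = measurable_stalls[OF level_width(1)] measurable_stall_start[OF level_width(1)]
  have "Measurable.pred path_space (has_lag a) \<longleftrightarrow>
      Measurable.pred path_space (\<lambda>x. \<exists>B::nat. \<forall>n. stalls (level_width n) a x \<and> stall_start (level_width n) a x \<le> real B)"
    by (rule measurable_cong) (simp add: has_lag_iff[OF _ a])
  also have "\<dots>" by measurable
  finally show ?thesis .
qed

text \<open>The limit of the stall starts on \<open>has_lag\<close>. Elsewhere
  \<open>first_lag\<close> is the default \<open>Inf {}\<close>, and the approximations are set to
  the same value.\<close>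

lemma measurable_first_lag [measurable]:
  assumes a: "0 \<le> a" shows "first_lag a \<in> borel_measurable path_space"
proof (rule borel_measurable_LIMSEQ_real)
  note [measurable] = measurable_stall_start[OF level_width(1)] measurable_has_lag[OF a]
  show "(\<lambda>x. if has_lag a x then stall_start (level_width n) a x else Inf {}) \<in> borel_measurable path_space" for n
    by measurable
  fix x assume "x \<in> space path_space" then have x: "x \<in> paths" by simp
  show "(\<lambda>n. if has_lag a x then stall_start (level_width n) a x else Inf {}) \<longlonglongrightarrow> first_lag a x"
  proof (cases "has_lag a x")
    case True
    then show ?thesis using stall_start_tendsto(3)[OF x a level_width(1,3) True[unfolded has_lag_def]] by simp
  next
    case False
    then have "{s. lag_at a x s} = {}" by (auto simp: has_lag_def)
    then have "first_lag a x = Inf {}" unfolding first_lag_def by (rule arg_cong)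
    then show ?thesis using False by simp
  qed
qed

definition lag_payoff :: "real \<Rightarrow> real \<Rightarrow> (real \<Rightarrow> ennreal) \<Rightarrow> (real \<Rightarrow> real) \<Rightarrow> ennreal" where
  "lag_payoff a \<eta> h x =
    (if has_lag a x then (let s = first_lag a x in h (x (s + a) - x s) * ennreal (exp (x s - \<eta> * (s + a)))) else 0)"

definition running_payoff :: "real \<Rightarrow> real \<Rightarrow> (real \<Rightarrow> real) \<Rightarrow> ennreal" where
  "running_payoff a \<eta> x =
    (\<integral>\<^sup>+t. (if 0 \<le> t \<and> (has_lag a x \<longrightarrow> t < first_lag a x + a)
       then ennreal (\<eta> * exp (running_max x 0 t - \<eta> * t)) else 0) \<partial>lborel)"

lemma measurable_lag_payoff [measurable]:
  assumes a: "0 \<le> a" and [measurable]: "h \<in> borel_measurable borel"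
  shows "lag_payoff a \<eta> h \<in> borel_measurable path_space"
proof -
  note [measurable] = measurable_has_lag[OF a] measurable_first_lag[OF a]
  show ?thesis unfolding lag_payoff_def[abs_def] Let_def by measurable
qed

lemma measurable_running_payoff [measurable]:
  assumes a: "0 \<le> a" shows "running_payoff a \<eta> \<in> borel_measurable path_space"
proof -
  note [measurable] = measurable_has_lag[OF a] measurable_first_lag[OF a]
  show ?thesis unfolding running_payoff_def[abs_def] by measurable
qed

text \<open>With a lag, the stall starts converge and continuity of \<open>k\<close> and of the path
  suffices. Without one, the stall starts exceed every bound, and half of the discount tends to 0
  while the other half is absorbed by \<open>D\<close>.\<close>

lemma lag_value_tendsto:
  assumes x: "x \<in> paths" and a: "0 < a" and \<eta>: "0 < \<eta>"
    and k: "continuous_on UNIV k" "\<And>y. 0 \<le> k y" "\<And>y. k y \<le> C"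
    and D: "\<And>t. 0 \<le> t \<Longrightarrow> ennreal (exp (x t - \<eta> / 2 * t)) \<le> D" "D < \<infinity>"
  shows "(\<lambda>n. lag_value (level_width n) a \<eta> (\<lambda>y. ennreal (k y)) x) \<longlonglongrightarrow> lag_payoff a \<eta> (\<lambda>y. ennreal (k y)) x"
proof (cases "has_lag a x")
  case True
  let ?s = "\<lambda>n. stall_start (level_width n) a x" and ?l = "first_lag a x"
  note st = stall_start_tendsto[OF x less_imp_le[OF a] level_width(1,3) True[unfolded has_lag_def]]
  have X: "(\<lambda>n. x (?s n + v)) \<longlonglongrightarrow> x (?l + v)" for v
    by (intro isCont_tendsto_compose[OF pathsD(2)[OF x]] tendsto_intros st(3))
  have "(\<lambda>n. k (x (?s n + a) - x (?s n + 0)) * exp (x (?s n + 0) - \<eta> * (?s n + a))) \<longlonglongrightarrow>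
      k (x (?l + a) - x (?l + 0)) * exp (x (?l + 0) - \<eta> * (?l + a))"
    using k(1) by (intro tendsto_mult tendsto_exp isCont_tendsto_compose[of _ k] tendsto_diff X tendsto_const tendsto_add st(3))
      (simp add: continuous_on_eq_continuous_at)
  from tendsto_ennrealI[OF this] show ?thesis
    using True st(1) k(2) by (simp add: lag_value_def lag_payoff_def Let_def ennreal_mult)
next
  case False
  let ?s = "\<lambda>n. stall_start (level_width n) a x"
  obtain d where d: "D = ennreal d" "0 \<le> d" using D(2) by (cases D) auto
  define g where "g n = (if stalls (level_width n) a x then exp (- (\<eta> / 2) * ?s n) else 0)" for n
  have "g \<longlonglongrightarrow> 0"
  proof (rule tendstoI)
    fix r :: real assume r: "0 < r"
    \<comment> \<open>Chosen such that \<open>exp (- (\<eta> / 2) * B) = r\<close>.\<close>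
    define B where "B = - ln r / (\<eta> / 2)"
    have "\<not> lag_at a x s" for s using False by (simp add: has_lag_def)
    from stall_start_eventually_greater[OF x level_width(1,3) this, of B]
    show "\<forall>\<^sub>F n in sequentially. dist (g n) 0 < r"
    proof eventually_elim
      case (elim n)
      show ?case
      proof (cases "stalls (level_width n) a x")
        case True
        with elim have "B < ?s n" by simp
        then have "- (\<eta> / 2) * ?s n < ln r"
          using \<eta> by (simp add: B_def field_simps)
        then have "exp (- (\<eta> / 2) * ?s n) < r" using r by (metis exp_less_mono exp_ln)
        then show ?thesis using True by (simp add: g_def)
      qed (use r in \<open>simp add: g_def\<close>)
    qed
  qed
  then have "(\<lambda>n. C * d * g n) \<longlonglongrightarrow> C * d * 0" by (intro tendsto_intros)
  from tendsto_ennrealI[OF this] have lim: "(\<lambda>n. ennreal (C * d * g n)) \<longlonglongrightarrow> 0" by simp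
  have C: "0 \<le> C" using k(2,3)[of 0] by simp
  have le: "lag_value (level_width n) a \<eta> (\<lambda>y. ennreal (k y)) x \<le> ennreal (C * d * g n)" for n
  proof (cases "stalls (level_width n) a x")
    case True
    have s: "0 \<le> ?s n" using stall_start_facts(1)[OF x level_width(1) True] .
    have "exp (x (?s n) - \<eta> / 2 * ?s n) \<le> d" using D(1)[OF s] d by simp
    moreover have "exp (x (?s n) - \<eta> * (?s n + a)) \<le> exp (x (?s n) - \<eta> / 2 * ?s n) * exp (- (\<eta> / 2) * ?s n)"
      using \<eta> a by (simp add: exp_add[symmetric] algebra_simps)
    ultimately have "exp (x (?s n) - \<eta> * (?s n + a)) \<le> d * exp (- (\<eta> / 2) * ?s n)"
      by (smt (verit) exp_ge_zero mult_right_mono)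
    then have "k (x (?s n + a) - x (?s n)) * exp (x (?s n) - \<eta> * (?s n + a)) \<le> C * (d * exp (- (\<eta> / 2) * ?s n))"
      using k C by (intro mult_mono) auto
    then show ?thesis using True k(2)
      by (simp add: lag_value_def Let_def g_def ennreal_mult[symmetric] mult.assoc ennreal_leI)
  qed (simp add: lag_value_def)
  have "(\<lambda>n. lag_value (level_width n) a \<eta> (\<lambda>y. ennreal (k y)) x) \<longlonglongrightarrow> 0"
    by (rule tendsto_sandwich[OF _ _ tendsto_const lim]) (use le in auto)
  then show ?thesis using False by (simp add: lag_payoff_def)
qed

text \<open>For every \<open>t\<close> except the end of the first lag window the indicator is
  eventually constant in \<open>n\<close>, and that single time is a null set.\<close>

lemma occupation_tendsto:
  assumes x: "x \<in> paths" and a: "0 < a" and \<eta>: "0 < \<eta>"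
    and D: "\<And>t. 0 \<le> t \<Longrightarrow> ennreal (exp (x t - \<eta> / 2 * t)) \<le> D" "D < \<infinity>"
  shows "(\<lambda>n. occupation (level_width n) a \<eta> x) \<longlonglongrightarrow> running_payoff a \<eta> x"
  unfolding occupation_def running_payoff_def
proof (rule nn_integral_dominated_convergence[where w="\<lambda>t. if 0 \<le> t then ennreal (\<eta> * exp (running_max x 0 t - \<eta> * t)) else 0"])
  note [measurable] = measurable_running_max_time[OF x]
  let ?w = "\<lambda>t. ennreal (\<eta> * exp (running_max x 0 t - \<eta> * t))"
  let ?s = "\<lambda>n. stall_start (level_width n) a x" and ?l = "first_lag a x"
  have "(\<integral>\<^sup>+t. (if 0 \<le> t then ?w t else 0) \<partial>lborel) \<le> 2 * D"
    by (rule running_exp_dominated[OF x \<eta> D(1)])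
  also have "\<dots> < \<infinity>" using D(2) by (auto simp: ennreal_mult_less_top)
  finally show "(\<integral>\<^sup>+t. (if 0 \<le> t then ?w t else 0) \<partial>lborel) < \<infinity>" .
  show "AE t in lborel. (\<lambda>n. if 0 \<le> t \<and> (stalls (level_width n) a x \<longrightarrow> t < ?s n + a) then ?w t else 0) \<longlonglongrightarrow>
      (if 0 \<le> t \<and> (has_lag a x \<longrightarrow> t < ?l + a) then ?w t else 0)"
    using AE_lborel_singleton[of "?l + a"]
  proof eventually_elim
    case (elim t)
    have "\<forall>\<^sub>F n in sequentially. (stalls (level_width n) a x \<longrightarrow> t < ?s n + a) \<longleftrightarrow> (has_lag a x \<longrightarrow> t < ?l + a)"
    proof (cases "has_lag a x")
      case True
      note st = stall_start_tendsto[OF x less_imp_le[OF a] level_width(1,3) True[unfolded has_lag_def]]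
      show ?thesis
      proof (cases "t < ?l + a")
        case tl: True
        then have "t - a < ?l" by simp
        from order_tendstoD(1)[OF st(3) this] show ?thesis
          by eventually_elim (use tl in auto)
      next
        case False
        have "\<not> t < ?s n + a" for n using st(2)[of n] False by simp
        then show ?thesis using True False st(1) by simp
      qed
    next
      case False
      then have "\<not> lag_at a x s" for s by (simp add: has_lag_def)
      from stall_start_eventually_greater[OF x level_width(1,3) this, of "t - a"]
      show ?thesis by eventually_elim (use False in auto)
    qed
    then have "\<forall>\<^sub>F n in sequentially. (if 0 \<le> t \<and> (stalls (level_width n) a x \<longrightarrow> t < ?s n + a) then ?w t else 0) =
        (if 0 \<le> t \<and> (has_lag a x \<longrightarrow> t < ?l + a) then ?w t else 0)"
      by eventually_elim simp
    then show ?case by (rule tendsto_eventually)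
  qed
qed (use measurable_running_max_time[OF x] in \<open>auto intro!: AE_I2\<close>)

section \<open>Convergence of the renewal quantities\<close>

context half_drift
begin

text \<open>Uniform in \<open>e\<close> and integrable in \<open>t\<close> near 0. For
  \<open>e \<le> sqrt t\<close> the first moment of the normal law gives
  \<open>2 * e / t * (2 * sqrt t + t / 2)\<close>; for larger \<open>e\<close> the right-hand side
  exceeds 1.\<close>

lemma survival_bound:
  assumes e: "0 < e" and t: "0 < t"
  shows "survival e t \<le> ennreal (e * (4 / sqrt t + 1))"
proof (cases "e \<le> sqrt t")
  case True
  let ?\<phi> = "normal_density (- 1 / 2 * t) (sqrt t)"
  have r: "0 < sqrt t" "sqrt t * sqrt t = t" using t by auto
  have "survival e t \<le> (\<integral>\<^sup>+y. ennreal (2 * e / t) * ennreal ((e + \<bar>y\<bar>) * ?\<phi> y) \<partial>lborel)"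
    unfolding survival_def
  proof (intro nn_integral_mono)
    fix y
    have "ennreal (killed_density (- 1 / 2) e t y) \<le> ennreal (2 * e / t * ((e + \<bar>y\<bar>) * ?\<phi> y))"
      using killed_density_le[OF e t, of "- 1 / 2" y] by (intro ennreal_leI) (simp add: mult.assoc)
    also have "\<dots> = ennreal (2 * e / t) * ennreal ((e + \<bar>y\<bar>) * ?\<phi> y)"
      using e t by (intro ennreal_mult) auto
    finally show "ennreal (killed_density (- 1 / 2) e t y) \<le> ennreal (2 * e / t) * ennreal ((e + \<bar>y\<bar>) * ?\<phi> y)" .
  qed
  also have "\<dots> = ennreal (2 * e / t) * (\<integral>\<^sup>+y. ennreal ((e + \<bar>y\<bar>) * ?\<phi> y) \<partial>lborel)"
    by (rule nn_integral_cmult) measurable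
  also have "\<dots> \<le> ennreal (2 * e / t) * ennreal (e + \<bar>- 1 / 2\<bar> * t + sqrt t)"
    using nn_integral_abs_normal_le[OF t, of e "- 1 / 2"] e by (intro mult_left_mono) auto
  also have "\<dots> = ennreal (2 * e / t * (e + \<bar>- 1 / 2\<bar> * t + sqrt t))"
    using e t by (intro ennreal_mult[symmetric]) auto
  also have "\<dots> \<le> ennreal (e * (4 / sqrt t + 1))"
  proof (rule ennreal_leI)
    have "2 * e / t * (e + \<bar>- 1 / 2\<bar> * t + sqrt t) \<le> 2 * e / t * (sqrt t + 1 / 2 * t + sqrt t)"
      using True e t by (intro mult_left_mono) auto
    also have "\<dots> = e * (4 * (sqrt t / t) + 1)" using t by (simp add: field_simps)
    also have "sqrt t / t = 1 / sqrt t"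
    proof -
      have "sqrt t / (sqrt t * sqrt t) = 1 / sqrt t"
        by (rule nonzero_divide_mult_cancel_left) (use r(1) in simp)
      then show ?thesis by (simp only: r(2))
    qed
    finally show "2 * e / t * (e + \<bar>- 1 / 2\<bar> * t + sqrt t) \<le> e * (4 / sqrt t + 1)" by simp
  qed
  finally show ?thesis .
next
  case False
  have r: "0 < sqrt t" using t by auto
  then have "1 \<le> e / sqrt t" using False by simp
  also have "\<dots> \<le> e * (4 / sqrt t + 1)" using e r by (simp add: field_simps)
  finally have "ennreal 1 \<le> ennreal (e * (4 / sqrt t + 1))" by (rule ennreal_leI)
  with survival_le_1[OF e t] show ?thesis unfolding ennreal_1 by (rule order_trans)
qed

lemma survival_tendsto:
  assumes t: "0 < t"
  shows "(\<lambda>n. ennreal (1 / level_width n) * survival (level_width n) t) \<longlonglongrightarrow> ennreal (nu_a (- 1 / 2) t)"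
proof -
  have "(\<integral>\<^sup>+y. 1 * ennreal (excursion_density (- 1 / 2) t y) \<partial>lborel) = (\<integral>\<^sup>+y. (if y < 0 then 1 else 0) * ennreal (excursion_density (- 1 / 2) t y) \<partial>lborel)"
    by (intro nn_integral_cong) (auto simp: excursion_density_def)
  also have "\<dots> = ennreal (nu_a (- 1 / 2) t)"
    by (simp only: nn_integral_excursion_density[OF t order_refl] excursion_tail_0[OF t])
  finally show ?thesis
    using killed_density_integral_tendsto[OF level_width t, of "\<lambda>_. 1" 1 "- 1 / 2"] by (simp add: survival_def)
qed

lemma measurable_survival [measurable]: "survival e \<in> borel_measurable borel"
  unfolding survival_def[abs_def] killed_density_def[abs_def] normal_density_def[abs_def] by measurable

lemma clock_ring_tendsto:
  assumes a: "0 < a" and \<eta>: "0 < \<eta>"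
  shows "(\<lambda>n. ennreal (1 / level_width n) * clock_ring (level_width n) a \<eta>) \<longlonglongrightarrow> ennreal (ring_rate (- 1 / 2) \<eta> a)"
proof -
  let ?g = "\<lambda>n t. if 0 < t \<and> t < a then ennreal (\<eta> * exp (- \<eta> * t)) * (ennreal (1 / level_width n) * survival (level_width n) t) else 0"
  have eq: "ennreal (1 / level_width n) * clock_ring (level_width n) a \<eta> = (\<integral>\<^sup>+t. ?g n t \<partial>lborel)" for n
    unfolding clock_ring_def
    by (subst nn_integral_cmult[symmetric]) (auto intro!: nn_integral_cong simp: mult.left_commute)
  show ?thesis
    unfolding eq nn_integral_ring_rate(1)[OF \<eta> a, symmetric]
  proof (rule nn_integral_dominated_convergence[where w="\<lambda>t. ennreal \<eta> * (if 0 < t \<and> t < a then ennreal (4 / sqrt t + 1) else 0)"])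
    show "AE t in lborel. ?g n t \<le> ennreal \<eta> * (if 0 < t \<and> t < a then ennreal (4 / sqrt t + 1) else 0)" for n
    proof (rule AE_I2)
      fix t :: real
      have "ennreal (\<eta> * exp (- \<eta> * t)) * (ennreal (1 / level_width n) * survival (level_width n) t) \<le> ennreal \<eta> * ennreal (4 / sqrt t + 1)" if t: "0 < t"
      proof (rule mult_mono)
        show "ennreal (\<eta> * exp (- \<eta> * t)) \<le> ennreal \<eta>" using \<eta> t by (intro ennreal_leI) simp
        have "ennreal (1 / level_width n) * survival (level_width n) t \<le> ennreal (1 / level_width n) * ennreal (level_width n * (4 / sqrt t + 1))"
          by (intro mult_left_mono survival_bound level_width t) simp
        also have "\<dots> = ennreal (4 / sqrt t + 1)"
          using level_width(1)[of n] by (simp add: ennreal_mult'[symmetric])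
        finally show "ennreal (1 / level_width n) * survival (level_width n) t \<le> ennreal (4 / sqrt t + 1)" .
      qed auto
      then show "?g n t \<le> ennreal \<eta> * (if 0 < t \<and> t < a then ennreal (4 / sqrt t + 1) else 0)" by auto
    qed
    show "(\<integral>\<^sup>+t. ennreal \<eta> * (if 0 < t \<and> t < a then ennreal (4 / sqrt t + 1) else 0) \<partial>lborel) < \<infinity>"
      using nn_integral_root_bound[OF a] by (subst nn_integral_cmult) (auto simp: ennreal_mult_less_top)
    show "AE t in lborel. (\<lambda>n. ?g n t) \<longlonglongrightarrow> (if 0 < t \<and> t < a then ennreal (\<eta> * exp (- \<eta> * t)) * ennreal (nu_a (- 1 / 2) t) else 0)"
    proof (rule AE_I2)
      fix t :: real
      show "(\<lambda>n. ?g n t) \<longlonglongrightarrow> (if 0 < t \<and> t < a then ennreal (\<eta> * exp (- \<eta> * t)) * ennreal (nu_a (- 1 / 2) t) else 0)"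
        using survival_tendsto[of t] by (cases "0 < t \<and> t < a") (auto intro!: ennreal_tendsto_cmult)
    qed
    show "(\<lambda>t. if 0 < t \<and> t < a then ennreal (\<eta> * exp (- \<eta> * t)) * ennreal (nu_a (- 1 / 2) t) else 0) \<in> borel_measurable lborel"
    proof -
      \<comment> \<open>Continuity of \<open>nu_a\<close> is established for positive times, so
        measurability is derived from the restriction to the interval.\<close>
      have eq: "(\<lambda>t. if 0 < t \<and> t < a then ennreal (\<eta> * exp (- \<eta> * t)) * ennreal (nu_a (- 1 / 2) t) else 0) =
        (\<lambda>t. indicator {0<..<a} t * (ennreal (\<eta> * exp (- \<eta> * t)) * ennreal (indicator {0<..<a} t *\<^sub>R nu_a (- 1 / 2) t)))"
        by (rule ext) (auto simp: indicator_def)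
      have "continuous_on {0<..<a} (nu_a (- 1 / 2))"
        by (rule DERIV_continuous_on[OF has_field_derivative_at_within[OF DERIV_nu_a]]) simp
      then have [measurable]: "(\<lambda>t. indicator {0<..<a} t *\<^sub>R nu_a (- 1 / 2) t) \<in> borel_measurable borel"
        by (intro borel_measurable_continuous_on_indicator) auto
      show ?thesis unfolding eq by measurable
    qed
  qed measurable
qed

text \<open>By \<open>block_factor_eq\<close>, the block factor falls short of 1 by
  \<open>exp e\<close> times the two failure probabilities, minus \<open>exp e - 1\<close>. To first
  order in the width, the failures give \<open>nu\<close> and the level gain gives the 1 that is
  subtracted.\<close>

lemma block_factor_tendsto:
  assumes a: "0 < a" and \<eta>: "0 < \<eta>"
  shows "(\<lambda>n. (1 - enn2real (\<integral>\<^sup>+x. block_factor (level_width n) a \<eta> x \<partial>P)) / level_width n) \<longlonglongrightarrow> nu (- 1 / 2) \<eta> a - 1"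
proof -
  define e where "e = level_width"
  have e: "0 < e n" for n by (simp add: e_def level_width)
  have elim: "e \<longlonglongrightarrow> 0" by (simp add: e_def level_width)
  define f where "f n = enn2real (\<integral>\<^sup>+x. block_factor (e n) a \<eta> x \<partial>P)" for n
  define p where "p n = enn2real (clock_ring (e n) a \<eta>)" for n
  define s where "s n = enn2real (survival (e n) a)" for n
  define E where "E = exp (- \<eta> * a)"
  have nn: "0 \<le> f n" "0 \<le> p n" "0 \<le> s n" for n by (auto simp: f_def p_def s_def)
  have F: "(\<integral>\<^sup>+x. block_factor (e n) a \<eta> x \<partial>P) = ennreal (f n)" for n
    using block_factor_finite[OF e \<eta> a] by (simp add: f_def)
  have sum: "ennreal (exp (- e n)) * (\<integral>\<^sup>+x. block_factor (e n) a \<eta> x \<partial>P) + clock_ring (e n) a \<eta> + ennreal E * survival (e n) a = 1" for n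
    using block_factor_eq[OF e \<eta> a] by (simp add: E_def)
  have "clock_ring (e n) a \<eta> \<le> 1" for n
    unfolding sum[of n, symmetric] by (simp add: add.assoc add.left_commute[of _ "clock_ring (e n) a \<eta>"])
  then have p: "clock_ring (e n) a \<eta> = ennreal (p n)" for n
    unfolding p_def by (metis ennreal_enn2real ennreal_one_less_top le_less_trans)
  have s: "survival (e n) a = ennreal (s n)" for n
    unfolding s_def using survival_le_1[OF e a] by (metis ennreal_enn2real ennreal_one_less_top le_less_trans)
  have sum': "exp (- e n) * f n + p n + E * s n = 1" for n
  proof -
    have "ennreal (exp (- e n) * f n + p n + E * s n) = 1"
      using sum[of n] nn unfolding F p s by (simp add: ennreal_mult ennreal_plus E_def)
    then show ?thesis by (simp only: ennreal_eq_1)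
  qed
  have cv: "ennreal (1 / e n) * ennreal v = ennreal (v / e n)" if "0 \<le> v" for v n
    using e[of n] that by (subst ennreal_mult[symmetric]) auto
  have "(\<lambda>n. ennreal (s n / e n)) \<longlonglongrightarrow> ennreal (nu_a (- 1 / 2) a)"
    using survival_tendsto[OF a] unfolding e_def[symmetric] s cv[OF nn(3)] .
  then have s_lim: "(\<lambda>n. s n / e n) \<longlonglongrightarrow> nu_a (- 1 / 2) a"
    by (rule tendsto_ennrealD) (use less_imp_le[OF nu_a_pos[OF a]] nn e in \<open>auto intro!: divide_nonneg_pos always_eventually\<close>)
  have "(\<lambda>n. ennreal (p n / e n)) \<longlonglongrightarrow> ennreal (ring_rate (- 1 / 2) \<eta> a)"
    using clock_ring_tendsto[OF a \<eta>] unfolding e_def[symmetric] p cv[OF nn(2)] .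
  then have p_lim: "(\<lambda>n. p n / e n) \<longlonglongrightarrow> ring_rate (- 1 / 2) \<eta> a"
    by (rule tendsto_ennrealD) (use nn_integral_ring_rate(2)[OF \<eta> a] nn e in \<open>auto intro!: divide_nonneg_pos always_eventually\<close>)
  have "DERIV exp 0 :> exp (0 :: real)" by (rule DERIV_exp)
  then have "((\<lambda>h. (exp (0 + h) - exp 0) / h) \<longlongrightarrow> (1 :: real)) (at 0)" by (simp add: DERIV_def)
  moreover have "filterlim e (at 0) sequentially"
    using e elim by (simp add: filterlim_at less_imp_neq[THEN not_sym])
  ultimately have exp_lim: "(\<lambda>n. (exp (0 + e n) - exp 0) / e n) \<longlonglongrightarrow> 1" by (rule filterlim_compose)
  have "(\<lambda>n. - ((exp (0 + e n) - exp 0) / e n) + exp (e n) * (p n / e n + E * (s n / e n))) \<longlonglongrightarrow>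
      - 1 + exp 0 * (ring_rate (- 1 / 2) \<eta> a + E * nu_a (- 1 / 2) a)"
    by (intro tendsto_intros exp_lim p_lim s_lim elim)
  moreover have "- ((exp (0 + e n) - exp 0) / e n) + exp (e n) * (p n / e n + E * (s n / e n)) = (1 - f n) / e n" for n
  proof -
    have "f n = exp (e n) * (exp (- e n) * f n)" by (simp add: mult.assoc[symmetric] exp_add[symmetric])
    also have "exp (- e n) * f n = 1 - p n - E * s n" using sum'[of n] by simp
    finally have "1 - f n = - (exp (e n) - 1) + exp (e n) * (p n + E * s n)" by (simp add: algebra_simps)
    then have "(1 - f n) / e n = (- (exp (e n) - 1) + exp (e n) * (p n + E * s n)) / e n" by (rule arg_cong)
    also have "\<dots> = - ((exp (0 + e n) - exp 0) / e n) + exp (e n) * (p n / e n + E * (s n / e n))"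
      by (simp add: add_divide_distrib distrib_left diff_divide_distrib)
    finally show ?thesis by (rule sym)
  qed
  ultimately show ?thesis by (simp add: nu_eq_ring_rate E_def f_def e_def)
qed

text \<open>Finiteness of \<open>Y n\<close> allows the renewal equation to be solved for
  \<open>R n\<close>: divided by the width, \<open>R n\<close> is the product of the scaled defect
  of the block factor and \<open>Y n\<close>, and both factors converge.\<close>

lemma renewal_limit:
  assumes a: "0 < a" and \<eta>: "0 < \<eta>"
    and rec: "\<And>n. Y n = R n + (\<integral>\<^sup>+x. block_factor (level_width n) a \<eta> x \<partial>P) * Y n"
    and Y: "\<And>n. Y n < \<infinity>" "Y \<longlonglongrightarrow> L" "L < \<infinity>"
    and R: "(\<lambda>n. ennreal (1 / level_width n) * R n) \<longlonglongrightarrow> r"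
  shows "ennreal (nu (- 1 / 2) \<eta> a - 1) * L = r"
proof -
  define e where "e = level_width"
  have e: "0 < e n" for n by (simp add: e_def level_width)
  define f where "f n = enn2real (\<integral>\<^sup>+x. block_factor (e n) a \<eta> x \<partial>P)" for n
  define y where "y n = enn2real (Y n)" for n
  define l where "l = enn2real L"
  have F: "(\<integral>\<^sup>+x. block_factor (e n) a \<eta> x \<partial>P) = ennreal (f n)" for n
    using block_factor_finite[OF e \<eta> a] by (simp add: f_def)
  have y: "Y n = ennreal (y n)" "0 \<le> y n" for n using Y(1)[of n] by (auto simp: y_def)
  have l: "L = ennreal l" "0 \<le> l" using Y(3) by (auto simp: l_def)
  have f0: "0 \<le> f n" for n by (simp add: f_def)
  have "y \<longlonglongrightarrow> l"
    using Y(2) unfolding l y(1)[abs_def] by (rule tendsto_ennrealD) (use l y in auto)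
  with block_factor_tendsto[OF a \<eta>, folded e_def, folded f_def]
  have "(\<lambda>n. (1 - f n) / e n * y n) \<longlonglongrightarrow> (nu (- 1 / 2) \<eta> a - 1) * l" by (rule tendsto_mult)
  then have "(\<lambda>n. ennreal ((1 - f n) / e n * y n)) \<longlonglongrightarrow> ennreal ((nu (- 1 / 2) \<eta> a - 1) * l)"
    by (rule tendsto_ennrealI)
  moreover have "ennreal ((1 - f n) / e n * y n) = ennreal (1 / e n) * R n" for n
  proof -
    have eq: "ennreal (y n) = R n + ennreal (f n * y n)"
      using rec[of n] y f0 unfolding e_def[symmetric] F by (simp add: ennreal_mult)
    then have "R n = ennreal (y n) - ennreal (f n * y n)" by simp
    also have "\<dots> = ennreal (y n - f n * y n)" using f0 y by (intro ennreal_minus) simp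
    finally have "ennreal (1 / e n) * R n = ennreal (1 / e n * (y n - f n * y n))"
      using e[of n] by (simp add: ennreal_mult'[symmetric])
    also have "1 / e n * (y n - f n * y n) = (1 - f n) / e n * y n" by (simp add: algebra_simps diff_divide_distrib)
    finally show ?thesis by simp
  qed
  ultimately have "(\<lambda>n. ennreal (1 / e n) * R n) \<longlonglongrightarrow> ennreal ((nu (- 1 / 2) \<eta> a - 1) * l)" by simp
  from LIMSEQ_unique[OF this R[folded e_def]] show ?thesis using l by (simp add: ennreal_mult'')
qed

lemma running_payoff_expectation:
  assumes a: "0 < a" and \<eta>: "0 < \<eta>"
  shows "ennreal (nu (- 1 / 2) \<eta> a - 1) * (\<integral>\<^sup>+x. running_payoff a \<eta> x \<partial>P) = ennreal (ring_rate (- 1 / 2) \<eta> a)"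
    and "(\<integral>\<^sup>+x. running_payoff a \<eta> x \<partial>P) < \<infinity>"
proof -
  obtain D where D [measurable]: "D \<in> borel_measurable path_space" and Dfin: "(\<integral>\<^sup>+x. D x \<partial>P) < \<infinity>"
    and Dle: "\<And>x t. x \<in> paths \<Longrightarrow> 0 \<le> t \<Longrightarrow> ennreal (exp (x t - \<eta> / 2 * t)) \<le> D x"
    using discounted_exp_dominated[of "\<eta> / 2"] \<eta> by auto
  note [measurable] = measurable_occupation[OF level_width(1)] measurable_running_payoff[OF less_imp_le[OF a]]
  have w: "(\<integral>\<^sup>+x. 2 * D x \<partial>P) < \<infinity>"
    using Dfin by (simp add: nn_integral_cmult ennreal_mult_less_top)
  have le: "occupation (level_width n) a \<eta> x \<le> 2 * D x" if x: "x \<in> paths" for n x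
  proof -
    have "occupation (level_width n) a \<eta> x \<le> (\<integral>\<^sup>+t. (if 0 \<le> t then ennreal (\<eta> * exp (running_max x 0 t - \<eta> * t)) else 0) \<partial>lborel)"
      unfolding occupation_def by (intro nn_integral_mono) auto
    also have "\<dots> \<le> 2 * D x" by (rule running_exp_dominated[OF x \<eta> Dle[OF x]])
    finally show ?thesis .
  qed
  have le': "running_payoff a \<eta> x \<le> 2 * D x" if x: "x \<in> paths" for x
  proof -
    have "running_payoff a \<eta> x \<le> (\<integral>\<^sup>+t. (if 0 \<le> t then ennreal (\<eta> * exp (running_max x 0 t - \<eta> * t)) else 0) \<partial>lborel)"
      unfolding running_payoff_def by (intro nn_integral_mono) auto
    also have "\<dots> \<le> 2 * D x" by (rule running_exp_dominated[OF x \<eta> Dle[OF x]])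
    finally show ?thesis .
  qed
  have lim: "(\<lambda>n. \<integral>\<^sup>+x. occupation (level_width n) a \<eta> x \<partial>P) \<longlonglongrightarrow> (\<integral>\<^sup>+x. running_payoff a \<eta> x \<partial>P)"
  proof (rule nn_integral_dominated_convergence[where w="\<lambda>x. 2 * D x"])
    have "AE x in P. D x \<noteq> \<infinity>" by (rule nn_integral_PInf_AE) (use Dfin in auto)
    moreover have "AE x in P. x \<in> paths" by (rule AE_I2) simp
    ultimately show "AE x in P. (\<lambda>n. occupation (level_width n) a \<eta> x) \<longlonglongrightarrow> running_payoff a \<eta> x"
      by eventually_elim (intro occupation_tendsto[OF _ a \<eta> Dle], auto simp: less_top)
    show "AE x in P. occupation (level_width n) a \<eta> x \<le> 2 * D x" for n by (rule AE_I2) (use le in simp)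
  qed (use w in auto)
  have fin: "(\<integral>\<^sup>+x. occupation (level_width n) a \<eta> x \<partial>P) < \<infinity>" for n
    by (rule le_less_trans[OF nn_integral_mono w]) (use le in simp)
  show fin': "(\<integral>\<^sup>+x. running_payoff a \<eta> x \<partial>P) < \<infinity>"
    by (rule le_less_trans[OF nn_integral_mono w]) (use le' in simp)
  have R: "(\<lambda>n. ennreal (1 / level_width n) * (\<integral>\<^sup>+x. block_occupation (level_width n) a \<eta> x \<partial>P)) \<longlonglongrightarrow> ennreal (ring_rate (- 1 / 2) \<eta> a)"
  proof (rule tendsto_sandwich[OF _ _ clock_ring_tendsto[OF a \<eta>]])
    have "(\<lambda>n. ennreal (exp (level_width n)) * (ennreal (1 / level_width n) * clock_ring (level_width n) a \<eta>)) \<longlonglongrightarrow>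
        ennreal (exp 0) * ennreal (ring_rate (- 1 / 2) \<eta> a)"
      by (intro tendsto_mult_ennreal tendsto_ennrealI tendsto_exp level_width clock_ring_tendsto a \<eta>) auto
    then show "(\<lambda>n. ennreal (exp (level_width n)) * (ennreal (1 / level_width n) * clock_ring (level_width n) a \<eta>)) \<longlonglongrightarrow>
        ennreal (ring_rate (- 1 / 2) \<eta> a)" by simp
    show "\<forall>\<^sub>F n in sequentially. ennreal (1 / level_width n) * clock_ring (level_width n) a \<eta> \<le>
        ennreal (1 / level_width n) * (\<integral>\<^sup>+x. block_occupation (level_width n) a \<eta> x \<partial>P)"
      by (intro always_eventually allI mult_left_mono block_occupation_bounds level_width \<eta>) simp
    show "\<forall>\<^sub>F n in sequentially. ennreal (1 / level_width n) * (\<integral>\<^sup>+x. block_occupation (level_width n) a \<eta> x \<partial>P) \<le>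
        ennreal (exp (level_width n)) * (ennreal (1 / level_width n) * clock_ring (level_width n) a \<eta>)"
    proof (intro always_eventually allI)
      fix n
      have "ennreal (1 / level_width n) * (\<integral>\<^sup>+x. block_occupation (level_width n) a \<eta> x \<partial>P) \<le>
          ennreal (1 / level_width n) * (ennreal (exp (level_width n)) * clock_ring (level_width n) a \<eta>)"
        by (intro mult_left_mono block_occupation_bounds level_width \<eta>) simp
      then show "ennreal (1 / level_width n) * (\<integral>\<^sup>+x. block_occupation (level_width n) a \<eta> x \<partial>P) \<le>
        ennreal (exp (level_width n)) * (ennreal (1 / level_width n) * clock_ring (level_width n) a \<eta>)"
        by (simp only: mult.left_commute)
    qed
  qed
  show "ennreal (nu (- 1 / 2) \<eta> a - 1) * (\<integral>\<^sup>+x. running_payoff a \<eta> x \<partial>P) = ennreal (ring_rate (- 1 / 2) \<eta> a)"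
    by (rule renewal_limit[OF a \<eta> occupation_expectation[OF level_width(1) \<eta> a] fin lim fin' R])
qed

lemma lag_payoff_finite:
  assumes a: "0 < a" and \<eta>: "0 < \<eta>" and h: "\<And>y. h y \<le> ennreal C"
  shows "(\<integral>\<^sup>+x. lag_payoff a \<eta> h x \<partial>P) < \<infinity>"
proof -
  obtain D where D [measurable]: "D \<in> borel_measurable path_space" and Dfin: "(\<integral>\<^sup>+x. D x \<partial>P) < \<infinity>"
    and Dle: "\<And>x t. x \<in> paths \<Longrightarrow> 0 \<le> t \<Longrightarrow> ennreal (exp (x t - \<eta> * t)) \<le> D x"
    using discounted_exp_dominated[OF \<eta>] by auto
  have "(\<integral>\<^sup>+x. lag_payoff a \<eta> h x \<partial>P) \<le> (\<integral>\<^sup>+x. ennreal C * D x \<partial>P)"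
  proof (intro nn_integral_mono)
    fix x assume "x \<in> space P" then have x: "x \<in> paths" by simp
    show "lag_payoff a \<eta> h x \<le> ennreal C * D x"
    proof (cases "has_lag a x")
      case True
      let ?s = "first_lag a x"
      have s: "0 \<le> ?s" using first_lag(3)[OF x less_imp_le[OF a]] True by (simp add: has_lag_def)
      have "ennreal (exp (x ?s - \<eta> * (?s + a))) \<le> ennreal (exp (x ?s - \<eta> * ?s))"
        using \<eta> a by (intro ennreal_leI) (simp add: algebra_simps)
      also have "\<dots> \<le> D x" by (rule Dle[OF x s])
      finally show ?thesis using True h by (auto simp: lag_payoff_def Let_def intro!: mult_mono)
    qed (simp add: lag_payoff_def)
  qed
  also have "\<dots> = ennreal C * (\<integral>\<^sup>+x. D x \<partial>P)" by (rule nn_integral_cmult) measurable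
  also have "\<dots> < \<infinity>" using Dfin by (simp add: ennreal_mult_less_top)
  finally show ?thesis .
qed

lemma lag_payoff_continuous:
  assumes a: "0 < a" and \<eta>: "0 < \<eta>"
    and k: "continuous_on UNIV k" "\<And>y. 0 \<le> k y" "\<And>y. k y \<le> C"
  shows "ennreal (nu (- 1 / 2) \<eta> a - 1) * (\<integral>\<^sup>+x. lag_payoff a \<eta> (\<lambda>y. ennreal (k y)) x \<partial>P) =
    ennreal (exp (- \<eta> * a)) * (\<integral>\<^sup>+y. ennreal (k y) * excursion_density (- 1 / 2) a y \<partial>lborel)"
proof -
  let ?h = "\<lambda>y. ennreal (k y)"
  have [measurable]: "k \<in> borel_measurable borel" using k(1) by (rule borel_measurable_continuous_onI)
  have bd: "?h y \<le> ennreal C" for y using k(3) by (rule ennreal_leI)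
  obtain D where D [measurable]: "D \<in> borel_measurable path_space" and Dfin: "(\<integral>\<^sup>+x. D x \<partial>P) < \<infinity>"
    and Dle: "\<And>x t. x \<in> paths \<Longrightarrow> 0 \<le> t \<Longrightarrow> ennreal (exp (x t - \<eta> / 2 * t)) \<le> D x"
    using discounted_exp_dominated[of "\<eta> / 2"] \<eta> by auto
  note [measurable] = measurable_lag_value[OF level_width(1)] measurable_lag_payoff[OF less_imp_le[OF a]]
  have w: "(\<integral>\<^sup>+x. ennreal C * D x \<partial>P) < \<infinity>"
    using Dfin by (simp add: nn_integral_cmult ennreal_mult_less_top)
  have le: "lag_value (level_width n) a \<eta> ?h x \<le> ennreal C * D x" if x: "x \<in> paths" for n x
  proof (rule lag_value_le[OF x level_width(1) \<eta> a bd])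
    fix t :: real assume t: "0 \<le> t"
    have "ennreal (exp (x t - \<eta> * t)) \<le> ennreal (exp (x t - \<eta> / 2 * t))"
      using t \<eta> by (intro ennreal_leI) simp
    also have "\<dots> \<le> D x" by (rule Dle[OF x t])
    finally show "ennreal (exp (x t - \<eta> * t)) \<le> D x" .
  qed
  have lim: "(\<lambda>n. \<integral>\<^sup>+x. lag_value (level_width n) a \<eta> ?h x \<partial>P) \<longlonglongrightarrow> (\<integral>\<^sup>+x. lag_payoff a \<eta> ?h x \<partial>P)"
  proof (rule nn_integral_dominated_convergence[where w="\<lambda>x. ennreal C * D x"])
    have "AE x in P. D x \<noteq> \<infinity>" by (rule nn_integral_PInf_AE) (use Dfin in auto)
    moreover have "AE x in P. x \<in> paths" by (rule AE_I2) simp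
    ultimately show "AE x in P. (\<lambda>n. lag_value (level_width n) a \<eta> ?h x) \<longlonglongrightarrow> lag_payoff a \<eta> ?h x"
      by eventually_elim (intro lag_value_tendsto[OF _ a \<eta> k Dle], auto simp: less_top)
    show "AE x in P. lag_value (level_width n) a \<eta> ?h x \<le> ennreal C * D x" for n by (rule AE_I2) (use le in simp)
  qed (use w in auto)
  have fin: "(\<integral>\<^sup>+x. lag_value (level_width n) a \<eta> ?h x \<partial>P) < \<infinity>" for n
    by (rule le_less_trans[OF nn_integral_mono w]) (use le in simp)
  have fin': "(\<integral>\<^sup>+x. lag_payoff a \<eta> ?h x \<partial>P) < \<infinity>"
    by (rule lag_payoff_finite[OF a \<eta> bd])
  have "(\<lambda>n. ennreal (exp (- \<eta> * a)) * (ennreal (1 / level_width n) * (\<integral>\<^sup>+y. ?h y * killed_density (- 1 / 2) (level_width n) a y \<partial>lborel))) \<longlonglongrightarrow>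
      ennreal (exp (- \<eta> * a)) * (\<integral>\<^sup>+y. ?h y * excursion_density (- 1 / 2) a y \<partial>lborel)"
    by (intro ennreal_tendsto_cmult killed_density_integral_tendsto[OF level_width a _ bd]) auto
  then have R: "(\<lambda>n. ennreal (1 / level_width n) * (ennreal (exp (- \<eta> * a)) * (\<integral>\<^sup>+y. ?h y * killed_density (- 1 / 2) (level_width n) a y \<partial>lborel))) \<longlonglongrightarrow>
      ennreal (exp (- \<eta> * a)) * (\<integral>\<^sup>+y. ?h y * excursion_density (- 1 / 2) a y \<partial>lborel)"
    by (simp only: mult.left_commute)
  show ?thesis
    by (rule renewal_limit[OF a \<eta> lag_value_expectation[OF level_width(1) \<eta> a _ bd] fin lim fin' R]) measurable
qed

text \<open>Both sides are integrals of \<open>h\<close> against finite measures on the line.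
  Continuous ramps approximate the indicators of half-lines, which identifies the measures;
  afterwards \<open>h\<close> may be discontinuous or unbounded.\<close>

lemma lag_payoff_expectation:
  assumes a: "0 < a" and \<eta>: "0 < \<eta>" and [measurable]: "h \<in> borel_measurable borel"
  shows "ennreal (nu (- 1 / 2) \<eta> a - 1) * (\<integral>\<^sup>+x. lag_payoff a \<eta> h x \<partial>P) =
    ennreal (exp (- \<eta> * a)) * (\<integral>\<^sup>+y. h y * excursion_density (- 1 / 2) a y \<partial>lborel)"
proof -
  note [measurable] = measurable_has_lag[OF less_imp_le[OF a]] measurable_first_lag[OF less_imp_le[OF a]]
    measurable_lag_payoff[OF less_imp_le[OF a]]
  let ?s = "first_lag a"
  \<comment> \<open>The constant, the discount and exp of the level go into the density
    \<open>W\<close>; the measure to be identified is the law of the drop \<open>\<Delta>\<close>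
    under it.\<close>
  define W where "W x = ennreal (nu (- 1 / 2) \<eta> a - 1) * (if has_lag a x then ennreal (exp (x (?s x) - \<eta> * (?s x + a))) else 0)" for x
  define \<Delta> where "\<Delta> x = x (?s x + a) - x (?s x)" for x
  have [measurable]: "W \<in> borel_measurable path_space" "\<Delta> \<in> borel_measurable path_space"
    unfolding W_def[abs_def] \<Delta>_def[abs_def] by measurable
  let ?V = "\<lambda>y. ennreal (exp (- \<eta> * a)) * ennreal (excursion_density (- 1 / 2) a y)"
  let ?M1 = "distr (density P W) borel \<Delta>" and ?M2 = "density lborel ?V"
  have L: "(\<integral>\<^sup>+x. W x * h (\<Delta> x) \<partial>P) = ennreal (nu (- 1 / 2) \<eta> a - 1) * (\<integral>\<^sup>+x. lag_payoff a \<eta> h x \<partial>P)"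
    if [measurable]: "h \<in> borel_measurable borel" for h
    by (subst nn_integral_cmult[symmetric])
       (auto intro!: nn_integral_cong simp: W_def \<Delta>_def lag_payoff_def Let_def mult_ac)
  have R: "(\<integral>\<^sup>+y. ?V y * h y \<partial>lborel) = ennreal (exp (- \<eta> * a)) * (\<integral>\<^sup>+y. h y * excursion_density (- 1 / 2) a y \<partial>lborel)"
    if [measurable]: "h \<in> borel_measurable borel" for h
    by (subst nn_integral_cmult[symmetric]) (auto intro!: nn_integral_cong simp: mult_ac)
  have finW: "(\<integral>\<^sup>+x. W x \<partial>P) < \<infinity>"
    using L[of "\<lambda>_. 1"] lag_payoff_finite[OF a \<eta>, of "\<lambda>_. 1" 1] by (simp add: ennreal_mult_less_top)
  have finV: "(\<integral>\<^sup>+y. ?V y \<partial>lborel) < \<infinity>"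
    using L[of "\<lambda>_. 1"] R[of "\<lambda>_. 1"] lag_payoff_continuous[OF a \<eta>, of "\<lambda>_. 1" 1] finW by simp
  have eq: "?M1 = ?M2"
  proof (rule measure_eqI_lessThan)
    fix q :: real
    have E1: "emeasure ?M1 {q<..} = (\<integral>\<^sup>+x. W x * indicator {q<..} (\<Delta> x) \<partial>P)"
      by (rule emeasure_distr_density) measurable
    also have "\<dots> \<le> (\<integral>\<^sup>+x. W x \<partial>P)" by (intro nn_integral_mono) (auto simp: indicator_def)
    finally show "emeasure ?M1 {q<..} < \<infinity>" using finW by (rule le_less_trans)
    define k where "k n y = min 1 (real n * max 0 (y - q))" for n and y :: real
    have k: "continuous_on UNIV (k n)" "0 \<le> k n y" "k n y \<le> 1" for n y
      unfolding k_def by (auto intro!: continuous_intros)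
    have [measurable]: "k n \<in> borel_measurable borel" for n using k(1) by (rule borel_measurable_continuous_onI)
    have klim: "(\<lambda>n. ennreal (k n y)) \<longlonglongrightarrow> indicator {q<..} y" for y
    proof (cases "q < y")
      case True
      have "eventually (\<lambda>n. real n \<ge> 1 / (y - q)) sequentially"
        using filterlim_real_sequentially unfolding filterlim_at_top by blast
      then have "eventually (\<lambda>n. ennreal (k n y) = 1) sequentially"
        by eventually_elim (use True in \<open>auto simp: k_def field_simps min_def\<close>)
      then show ?thesis using True by (simp add: tendsto_eventually)
    qed (simp add: k_def)
    have k1: "ennreal (k n y) \<le> 1" for n y using k(3)[of n y] by (simp add: ennreal_le_1)
    have lim1: "(\<lambda>n. \<integral>\<^sup>+x. W x * ennreal (k n (\<Delta> x)) \<partial>P) \<longlonglongrightarrow> (\<integral>\<^sup>+x. W x * indicator {q<..} (\<Delta> x) \<partial>P)"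
    proof (rule nn_integral_dominated_convergence[where w=W])
      show "AE x in P. W x * ennreal (k n (\<Delta> x)) \<le> W x" for n
        using mult_left_mono[OF k1, of "W _"] by (intro AE_I2) simp
      show "AE x in P. (\<lambda>n. W x * ennreal (k n (\<Delta> x))) \<longlonglongrightarrow> W x * indicator {q<..} (\<Delta> x)"
        by (intro AE_I2 ennreal_tendsto_cmult klim) (simp add: W_def ennreal_mult_less_top)
    qed (use finW in auto)
    have lim2: "(\<lambda>n. \<integral>\<^sup>+y. ?V y * ennreal (k n y) \<partial>lborel) \<longlonglongrightarrow> (\<integral>\<^sup>+y. ?V y * indicator {q<..} y \<partial>lborel)"
    proof (rule nn_integral_dominated_convergence[where w="?V"])
      show "AE y in lborel. ?V y * ennreal (k n y) \<le> ?V y" for n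
        using mult_left_mono[OF k1, of "?V _"] by (intro AE_I2) simp
      show "AE y in lborel. (\<lambda>n. ?V y * ennreal (k n y)) \<longlonglongrightarrow> ?V y * indicator {q<..} y"
        by (intro AE_I2 ennreal_tendsto_cmult klim) (simp add: ennreal_mult_less_top)
    qed (use finV in auto)
    have "(\<integral>\<^sup>+x. W x * ennreal (k n (\<Delta> x)) \<partial>P) = (\<integral>\<^sup>+y. ?V y * ennreal (k n y) \<partial>lborel)" for n
      using L[of "\<lambda>y. ennreal (k n y)"] R[of "\<lambda>y. ennreal (k n y)"] lag_payoff_continuous[OF a \<eta> k, of n] by simp
    then have "(\<integral>\<^sup>+x. W x * indicator {q<..} (\<Delta> x) \<partial>P) = (\<integral>\<^sup>+y. ?V y * indicator {q<..} y \<partial>lborel)"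
      using LIMSEQ_unique[OF lim1] lim2 by simp
    then show "emeasure ?M1 {q<..} = emeasure ?M2 {q<..}"
      unfolding E1 by (subst emeasure_density) auto
  qed auto
  have "ennreal (nu (- 1 / 2) \<eta> a - 1) * (\<integral>\<^sup>+x. lag_payoff a \<eta> h x \<partial>P) = (\<integral>\<^sup>+x. W x * h (\<Delta> x) \<partial>P)"
    by (rule L[symmetric]) measurable
  also have "\<dots> = (\<integral>\<^sup>+y. h y \<partial>?M1)"
    by (subst nn_integral_distr, simp, simp, subst nn_integral_density) auto
  also have "\<dots> = (\<integral>\<^sup>+y. ?V y * h y \<partial>lborel)"
    unfolding eq by (rule nn_integral_density) auto
  also have "\<dots> = ennreal (exp (- \<eta> * a)) * (\<integral>\<^sup>+y. h y * excursion_density (- 1 / 2) a y \<partial>lborel)"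
    by (rule R) measurable
  finally show ?thesis .
qed

end

section \<open>The restarted rule\<close>

lemma running_max_shift:
  assumes x: "x \<in> paths" and "0 \<le> u" "u \<le> v"
  shows "running_max x (\<sigma> + u) (\<sigma> + v) = x \<sigma> + running_max (shift \<sigma> x) u v"
proof -
  let ?y = "shift \<sigma> x"
  obtain w where w: "w \<in> {u..v}" "?y w = running_max ?y u v" "\<And>z. z \<in> {u..v} \<Longrightarrow> ?y z \<le> ?y w"
    using running_max_attained[OF pathsD(1)[OF shift_paths[OF x]] assms(3)] by metis
  have val: "?y z = x (\<sigma> + z) - x \<sigma>" if "z \<in> {u..v}" for z
    using that assms(2) by (simp add: shift_def)
  have "running_max x (\<sigma> + u) (\<sigma> + v) = x (\<sigma> + w)"
  proof (rule running_max_eqI)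
    show "\<sigma> + w \<in> {\<sigma> + u..\<sigma> + v}" using w(1) by simp
    fix z assume z: "z \<in> {\<sigma> + u..\<sigma> + v}"
    then have "z - \<sigma> \<in> {u..v}" by auto
    from w(3)[OF this] val[OF this] val[OF w(1)] show "x z \<le> x (\<sigma> + w)" by simp
  qed
  then show ?thesis using w(2) val[OF w(1)] by simp
qed

text \<open>The real value of tau_0, with default 0 where tau_0 is infinite.\<close>

definition lag_end :: "real \<Rightarrow> (real \<Rightarrow> real) \<Rightarrow> real" where
  "lag_end a x = (if has_lag a x then first_lag a x + a else 0)"

text \<open>Waiting after \<open>\<sigma>\<close> is waiting from 0 on the shifted path: windows
  start at or after \<open>\<sigma>\<close>, and the lag condition compares values of the path, so
  it is invariant under subtraction of \<open>x \<sigma>\<close>.\<close>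

lemma lag_time_eq:
  assumes x: "x \<in> paths" and a: "0 < a" and \<sigma>: "0 \<le> \<sigma>"
  shows "lag_time a x (ereal \<sigma>) = (if has_lag a (shift \<sigma> x) then ereal (\<sigma> + lag_end a (shift \<sigma> x)) else \<infinity>)"
proof -
  let ?y = "shift \<sigma> x"
  have y: "?y \<in> paths" using x by simp
  have rm: "running_max x (t - a) t = x (t - a) \<longleftrightarrow> (\<forall>u\<in>{t-a..t}. x u \<le> x (t - a))" for t
    using running_max_upper[OF pathsD(1)[OF x], of _ "t - a" t] running_max_eqI[of "t - a" "t - a" t x] a
    by (metis atLeastAtMost_iff diff_le_eq le_add_same_cancel1 less_imp_le order_refl)
  have lag: "lag_at a ?y s \<longleftrightarrow> 0 \<le> s \<and> (\<forall>u\<in>{\<sigma>+s..\<sigma>+s+a}. x u \<le> x (\<sigma> + s))" for s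
  proof (cases "0 \<le> s")
    case True
    have "(\<forall>u\<in>{s..s+a}. ?y u \<le> ?y s) \<longleftrightarrow> (\<forall>u\<in>{s..s+a}. x (\<sigma> + u) \<le> x (\<sigma> + s))"
      using True by (intro ball_cong refl) (simp add: shift_def)
    also have "\<dots> \<longleftrightarrow> (\<forall>u\<in>(+) \<sigma> ` {s..s+a}. x u \<le> x (\<sigma> + s))" by blast
    also have "(+) \<sigma> ` {s..s+a} = {\<sigma>+s..\<sigma>+s+a}" by (simp add: add.assoc)
    finally show ?thesis using True by (simp add: lag_at_def)
  qed (simp add: lag_at_def)
  have eq: "{ereal t |t. ereal \<sigma> + ereal a \<le> ereal t \<and> running_max x (t - a) t = x (t - a)} = {ereal (\<sigma> + s + a) |s. lag_at a ?y s}"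
    unfolding rm lag
  proof (intro set_eqI iffI)
    fix z assume "z \<in> {ereal t |t. ereal \<sigma> + ereal a \<le> ereal t \<and> (\<forall>u\<in>{t-a..t}. x u \<le> x (t - a))}"
    then obtain t where "z = ereal t" "\<sigma> + a \<le> t" "\<forall>u\<in>{t-a..t}. x u \<le> x (t - a)" by auto
    then show "z \<in> {ereal (\<sigma> + s + a) |s. 0 \<le> s \<and> (\<forall>u\<in>{\<sigma>+s..\<sigma>+s+a}. x u \<le> x (\<sigma> + s))}"
      by (intro CollectI exI[of _ "t - a - \<sigma>"]) auto
  next
    fix z assume "z \<in> {ereal (\<sigma> + s + a) |s. 0 \<le> s \<and> (\<forall>u\<in>{\<sigma>+s..\<sigma>+s+a}. x u \<le> x (\<sigma> + s))}"
    then obtain s where "z = ereal (\<sigma> + s + a)" "0 \<le> s" "\<forall>u\<in>{\<sigma>+s..\<sigma>+s+a}. x u \<le> x (\<sigma> + s)" by auto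
    then show "z \<in> {ereal t |t. ereal \<sigma> + ereal a \<le> ereal t \<and> (\<forall>u\<in>{t-a..t}. x u \<le> x (t - a))}"
      by (intro CollectI exI[of _ "\<sigma> + s + a"]) auto
  qed
  show ?thesis
  proof (cases "has_lag a ?y")
    case True
    note fl = first_lag[OF y less_imp_le[OF a] True[unfolded has_lag_def]]
    have "Inf {ereal (\<sigma> + s + a) |s. lag_at a ?y s} = ereal (\<sigma> + first_lag a ?y + a)"
      by (rule cInf_eq_minimum) (use fl in auto)
    then show ?thesis using True unfolding lag_time_def eq lag_end_def by (simp add: add.assoc)
  next
    case False
    then have "{ereal (\<sigma> + s + a) |s. lag_at a ?y s} = {}" by (auto simp: has_lag_def)
    then show ?thesis using False unfolding lag_time_def eq by (simp add: top_ereal_def)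
  qed
qed

lemma lag_time_0:
  assumes "x \<in> paths" "0 < a"
  shows "lag_time a x 0 = (if has_lag a x then ereal (lag_end a x) else \<infinity>)"
  using lag_time_eq[OF assms, of 0] assms(1) by (simp add: zero_ereal_def)

lemma lag_time_infinity: "lag_time a x \<infinity> = \<infinity>"
  by (simp add: lag_time_def top_ereal_def)

lemma lag_end_nonneg: "x \<in> paths \<Longrightarrow> 0 < a \<Longrightarrow> 0 \<le> lag_end a x"
  using first_lag(3)[of x a] by (auto simp: lag_end_def has_lag_def)

lemma lag_end_max:
  assumes x: "x \<in> paths" and a: "0 < a" and l: "has_lag a x"
  shows "running_max x 0 (lag_end a x) = x (first_lag a x)" "x (lag_end a x) \<le> x (first_lag a x)"
    "0 \<le> first_lag a x" "lag_end a x = first_lag a x + a"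
proof -
  note fl = first_lag[OF x less_imp_le[OF a] l[unfolded has_lag_def]]
  show eq: "lag_end a x = first_lag a x + a" using l by (simp add: lag_end_def)
  show "running_max x 0 (lag_end a x) = x (first_lag a x)"
    by (rule running_max_eqI) (use fl a eq in auto)
  show "x (lag_end a x) \<le> x (first_lag a x)" using fl(3) fl(4)[of "lag_end a x"] eq a by simp
  show "0 \<le> first_lag a x" by (rule fl)
qed

text \<open>The lag condition at \<open>s\<close> involves the path after \<open>s\<close> only up
  to \<open>s + a\<close>. It therefore transfers between paths that agree beyond the first lag
  window of one of them, and minimality is compared in both directions.\<close>

lemma adapted_lag_end:
  assumes a: "0 < a"
  shows "adapted (lag_payoff a \<eta> h) (lag_end a)"
  unfolding adapted_def
proof (intro ballI allI impI)
  fix x y t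
  assume x: "x \<in> paths" and y: "y \<in> paths" and xy: "\<forall>s\<le>t. x s = y s"
    and nz: "lag_payoff a \<eta> h x \<noteq> 0" and t: "lag_end a x < t"
  have lx: "has_lag a x" using nz by (auto simp: lag_payoff_def split: if_splits)
  note fx = first_lag[OF x less_imp_le[OF a] lx[unfolded has_lag_def]]
  have tx: "first_lag a x + a < t" using t lx by (simp add: lag_end_def)
  have tr: "lag_at a x s \<longleftrightarrow> lag_at a y s" if "s + a < t" for s
    using that xy a by (auto simp: lag_at_def)
  have "lag_at a y (first_lag a x)" using tr[OF tx] fx(1) by simp
  then have ly: "has_lag a y" by (auto simp: has_lag_def)
  note fy = first_lag[OF y less_imp_le[OF a] ly[unfolded has_lag_def]]
  have le: "first_lag a y \<le> first_lag a x" by (rule fy(2)) fact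
  then have "lag_at a x (first_lag a y)" using tr[of "first_lag a y"] fy(1) tx by simp
  then have "first_lag a x \<le> first_lag a y" by (rule fx(2))
  with le have eq: "first_lag a y = first_lag a x" by simp
  then show "lag_payoff a \<eta> h y = lag_payoff a \<eta> h x \<and> lag_end a y = lag_end a x"
    using lx ly xy tx a by (simp add: lag_payoff_def lag_end_def)
qed

text \<open>Nonnegativity is carried along in the induction because \<open>lag_time_eq\<close>
  speaks of nonnegative real times; infinite restart times are absorbing.\<close>

lemma restart_time_Suc:
  assumes x: "x \<in> paths" and a: "0 < a" and l: "has_lag a x"
  shows "restart_time a x (Suc k) = ereal (lag_end a x) + restart_time a (shift (lag_end a x) x) k
    \<and> 0 \<le> restart_time a (shift (lag_end a x) x) k"
proof (induction k)
  case 0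
  show ?case using lag_time_0[OF x a] l by simp
next
  case (Suc k)
  let ?T = "lag_end a x" let ?y = "shift ?T x" let ?r = "restart_time a ?y k"
  have T: "0 \<le> ?T" by (rule lag_end_nonneg[OF x a])
  have step: "restart_time a x (Suc (Suc k)) = lag_time a x (ereal ?T + ?r)" using Suc by simp
  have y: "?y \<in> paths" using x by simp
  show ?case
  proof (cases ?r)
    case (real r)
    then have r: "0 \<le> r" using Suc by simp
    have "lag_time a x (ereal ?T + ?r) = (if has_lag a (shift (?T + r) x) then ereal ((?T + r) + lag_end a (shift (?T + r) x)) else \<infinity>)"
      using lag_time_eq[OF x a, of "?T + r"] T r real by simp
    moreover have "restart_time a ?y (Suc k) = (if has_lag a (shift (?T + r) x) then ereal (r + lag_end a (shift (?T + r) x)) else \<infinity>)"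
      using lag_time_eq[OF y a r] real shift_shift[OF r, of ?T x] by simp
    ultimately show ?thesis unfolding step using r lag_end_nonneg[OF shift_paths[OF x] a, of "?T + r"]
      by (simp add: add.assoc)
  next
    case PInf
    then show ?thesis unfolding step by (simp add: lag_time_infinity)
  next
    case MInf
    then show ?thesis using Suc by simp
  qed
qed

text \<open>Each further restart takes at least \<open>a\<close>, so finitely many restarts lie
  below a given time.\<close>

lemma restart_time_facts:
  assumes x: "x \<in> paths" and a: "0 < a"
  shows "ereal (real k * a) \<le> restart_time a x k \<and> restart_time a x k \<le> restart_time a x (Suc k)"
proof (induction k)
  case 0
  then show ?case using lag_time_0[OF x a] lag_end_nonneg[OF x a] by simp
next
  case (Suc k)
  have step: "ereal (r + a) \<le> lag_time a x (ereal r)" if r: "0 \<le> r" for r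
  proof -
    have "a \<le> lag_end a (shift r x)" if "has_lag a (shift r x)"
      using lag_end_max(3,4)[OF shift_paths[OF x] a that] by simp
    then show ?thesis using lag_time_eq[OF x a r] by simp
  qed
  have "0 \<le> ereal (real k * a)" using a by simp
  then have pos: "0 \<le> restart_time a x k" by (rule order_trans[OF _ conjunct1[OF Suc]])
  have grow: "ereal (real (Suc k) * a) \<le> restart_time a x (Suc k)"
  proof (cases "restart_time a x k")
    case (real r)
    then have "real k * a \<le> r" "0 \<le> r" using Suc pos by auto
    then have "ereal (real (Suc k) * a) \<le> ereal (r + a)" by (simp add: algebra_simps)
    also have "\<dots> \<le> restart_time a x (Suc k)" using step[OF \<open>0 \<le> r\<close>] real by simp
    finally show ?thesis .
  qed (use pos in \<open>auto simp: lag_time_infinity\<close>)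
  have pos': "0 \<le> restart_time a x (Suc k)" by (rule order_trans[OF pos conjunct2[OF Suc]])
  have "restart_time a x (Suc k) \<le> restart_time a x (Suc (Suc k))"
  proof (cases "restart_time a x (Suc k)")
    case (real r)
    then have "0 \<le> r" using pos' by simp
    have "ereal r \<le> ereal (r + a)" using a by simp
    also have "\<dots> \<le> restart_time a x (Suc (Suc k))" using step[OF \<open>0 \<le> r\<close>] real by simp
    finally show ?thesis using real by simp
  qed (use pos' in \<open>auto simp: lag_time_infinity\<close>)
  with grow show ?case by blast
qed

section \<open>Stopping index and reward under a restart\<close>

definition stop_cond :: "real \<Rightarrow> real \<Rightarrow> (real \<Rightarrow> real) \<Rightarrow> real \<Rightarrow> nat \<Rightarrow> bool" where
  "stop_cond a q x T k \<longleftrightarrow> ereal T < restart_time a x (Suc k) \<or>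
     (let \<sigma> = real_of_ereal (restart_time a x (Suc k)) in x \<sigma> - max_since_restart a x k \<sigma> < q)"

lemma stop_index_eq: "stop_index a q x T = (LEAST k. stop_cond a q x T k)"
  by (simp add: stop_index_def stop_cond_def)

lemma stop_cond_exists:
  assumes x: "x \<in> paths" and a: "0 < a"
  shows "\<exists>k. stop_cond a q x T k"
proof -
  obtain k where k: "T < real k * a" using reals_Archimedean3[OF a] by blast
  then have "T < real (Suc k) * a" using a by (simp add: algebra_simps)
  then have "ereal T < ereal (real (Suc k) * a)" by simp
  also have "\<dots> \<le> restart_time a x (Suc k)" using restart_time_facts[OF x a, of "Suc k"] by blast
  finally show ?thesis unfolding stop_cond_def by blast
qed

lemma stop_cond_0:
  assumes x: "x \<in> paths" and a: "0 < a"
  shows "stop_cond a q x T 0 \<longleftrightarrow> (has_lag a x \<longrightarrow> T < lag_end a x \<or> x (lag_end a x) - x (first_lag a x) < q)"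
proof (cases "has_lag a x")
  case True
  have "restart_time a x (Suc 0) = ereal (lag_end a x)" using lag_time_0[OF x a] True by simp
  then have "stop_cond a q x T 0 \<longleftrightarrow> T < lag_end a x \<or> x (lag_end a x) - running_max x 0 (lag_end a x) < q"
    by (simp add: stop_cond_def Let_def max_since_restart_def del: restart_time.simps(2))
  then show ?thesis using True lag_end_max(1)[OF x a True] by simp
next
  case False
  then have "restart_time a x (Suc 0) = \<infinity>" using lag_time_0[OF x a] by simp
  then show ?thesis using False by (simp add: stop_cond_def del: restart_time.simps(2))
qed

text \<open>The clock test depends on the remaining time, and the threshold test is a difference of
  two path values, which the shift leaves unchanged.\<close>

lemma stop_cond_Suc:
  assumes x: "x \<in> paths" and a: "0 < a" and l: "has_lag a x"
  shows "stop_cond a q x T (Suc k) \<longleftrightarrow> stop_cond a q (shift (lag_end a x) x) (T - lag_end a x) k"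
proof -
  let ?T = "lag_end a x" let ?y = "shift ?T x"
  have y: "?y \<in> paths" using x by simp
  note rs = restart_time_Suc[OF x a l]
  show ?thesis
  proof (cases "restart_time a ?y (Suc k)")
    case PInf
    then have "restart_time a x (Suc (Suc k)) = \<infinity>" using conjunct1[OF rs[of "Suc k"]] by (simp only: plus_ereal.simps)
    then show ?thesis unfolding stop_cond_def PInf by simp
  next
    case MInf
    then show ?thesis using conjunct2[OF rs[of "Suc k"]] by (simp only: MInf) simp
  next
    case (real r)
    have le: "restart_time a ?y k \<le> restart_time a ?y (Suc k)" using restart_time_facts[OF y a] by blast
    obtain r' where r': "restart_time a ?y k = ereal r'" "0 \<le> r'" "r' \<le> r"
      using conjunct2[OF rs[of k]] le unfolding real by (cases "restart_time a ?y k") auto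
    have m: "running_max x (?T + r') (?T + r) = x ?T + running_max ?y r' r"
      by (rule running_max_shift[OF x r'(2,3)])
    have v: "?y r = x (?T + r) - x ?T" using r' by (simp add: shift_def)
    have e: "restart_time a x (Suc (Suc k)) = ereal (?T + r)" "restart_time a x (Suc k) = ereal (?T + r')"
      using conjunct1[OF rs[of "Suc k"]] conjunct1[OF rs[of k]] unfolding real r'(1) by simp_all
    have 1: "stop_cond a q x T (Suc k) \<longleftrightarrow> T < ?T + r \<or> x (?T + r) - running_max x (?T + r') (?T + r) < q"
      by (simp only: stop_cond_def Let_def max_since_restart_def e real_of_ereal.simps less_ereal.simps)
    have 2: "stop_cond a q ?y (T - ?T) k \<longleftrightarrow> T - ?T < r \<or> ?y r - running_max ?y r' r < q"
      by (simp only: stop_cond_def Let_def max_since_restart_def real r'(1) real_of_ereal.simps less_ereal.simps)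
    show ?thesis unfolding 1 2 m v by (auto simp: algebra_simps)
  qed
qed

lemma stop_index_0:
  assumes "x \<in> paths" "0 < a" "stop_cond a q x T 0" shows "stop_index a q x T = 0"
  unfolding stop_index_eq using assms(3) by (rule Least_eq_0)

lemma stop_index_Suc:
  assumes x: "x \<in> paths" and a: "0 < a" and n: "\<not> stop_cond a q x T 0"
  shows "stop_index a q x T = Suc (stop_index a q (shift (lag_end a x) x) (T - lag_end a x))"
proof -
  have l: "has_lag a x" using n stop_cond_0[OF x a] by blast
  obtain k where "stop_cond a q x T k" using stop_cond_exists[OF x a] by blast
  then have "(LEAST k. stop_cond a q x T k) = Suc (LEAST k. stop_cond a q x T (Suc k))"
    by (rule Least_Suc[where P="stop_cond a q x T", OF _ n])
  then show ?thesis unfolding stop_index_eq stop_cond_Suc[OF x a l] .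
qed

lemma reward_before_lag:
  assumes x: "x \<in> paths" and a: "0 < a" and T: "has_lag a x \<Longrightarrow> T < lag_end a x"
  shows "reward a q x T = exp (running_max x 0 T)"
proof -
  have "stop_cond a q x T 0" using stop_cond_0[OF x a] T by blast
  from stop_index_0[OF x a this] have "stop_index a q x T = 0" .
  moreover have "min (restart_time a x (Suc 0)) (ereal T) = ereal T"
    using T lag_time_0[OF x a] by (auto simp: min_def)
  ultimately show ?thesis by (simp add: reward_def max_since_restart_def del: restart_time.simps(2))
qed

lemma reward_at_lag:
  assumes x: "x \<in> paths" and a: "0 < a" and l: "has_lag a x" and T: "lag_end a x \<le> T"
    and q: "x (lag_end a x) - x (first_lag a x) < q"
  shows "reward a q x T = exp (x (first_lag a x))"
proof -
  have "stop_cond a q x T 0" using stop_cond_0[OF x a] q by blast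
  from stop_index_0[OF x a this] have "stop_index a q x T = 0" .
  moreover have "min (restart_time a x (Suc 0)) (ereal T) = ereal (lag_end a x)"
    using T l lag_time_0[OF x a] by (auto simp: min_def)
  ultimately show ?thesis using lag_end_max(1)[OF x a l]
    by (simp add: reward_def max_since_restart_def del: restart_time.simps(2))
qed

text \<open>The maximum since a later restart is \<open>x (lag_end a x)\<close> plus that of the
  shifted path, so the exponential payoff factorises.\<close>

lemma reward_after_lag:
  assumes x: "x \<in> paths" and a: "0 < a" and l: "has_lag a x" and T: "lag_end a x \<le> T"
    and q: "\<not> x (lag_end a x) - x (first_lag a x) < q"
  shows "reward a q x T = exp (x (lag_end a x)) * reward a q (shift (lag_end a x) x) (T - lag_end a x)"
proof -
  let ?T = "lag_end a x" let ?y = "shift ?T x"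
  have y: "?y \<in> paths" using x by simp
  define N where "N = stop_index a q ?y (T - ?T)"
  have "\<not> stop_cond a q x T 0" using stop_cond_0[OF x a] l T q by auto
  from stop_index_Suc[OF x a this] have N: "stop_index a q x T = Suc N" by (simp add: N_def)
  note rs = restart_time_Suc[OF x a l]
  \<comment> \<open>By minimality of \<open>N\<close> the stop condition fails at the preceding
    index, so restart \<open>N\<close> happens within the remaining time and the final maximum is
    over a nonempty interval.\<close>
  have le: "restart_time a ?y N \<le> ereal (T - ?T)"
  proof (cases N)
    case 0
    then show ?thesis using T by simp
  next
    case (Suc m)
    then have "m < (LEAST k. stop_cond a q ?y (T - ?T) k)" by (simp add: N_def stop_index_eq)
    then have "\<not> stop_cond a q ?y (T - ?T) m" by (rule not_less_Least)
    then show ?thesis using Suc by (simp add: stop_cond_def not_less)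
  qed
  obtain r' where r': "restart_time a ?y N = ereal r'" "0 \<le> r'" "r' \<le> T - ?T"
    using le rs[of N] by (cases "restart_time a ?y N") auto
  have le2: "restart_time a ?y N \<le> restart_time a ?y (Suc N)" using restart_time_facts[OF y a] by blast
  have "\<exists>v. min (restart_time a ?y (Suc N)) (ereal (T - ?T)) = ereal v \<and> r' \<le> v"
  proof (cases "restart_time a ?y (Suc N)")
    case (real r)
    then have "r' \<le> r" using le2 r'(1) by (simp del: restart_time.simps)
    then show ?thesis unfolding real using r' by (intro exI[of _ "min r (T - ?T)"]) (auto simp: min_def)
  next
    case PInf
    then show ?thesis unfolding PInf using r' by (intro exI[of _ "T - ?T"]) (auto simp: min_def)
  next
    case MInf
    then show ?thesis using le2 r'(1) by (simp del: restart_time.simps)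
  qed
  then obtain v where v: "min (restart_time a ?y (Suc N)) (ereal (T - ?T)) = ereal v" "r' \<le> v" by blast
  have "min (restart_time a x (Suc (Suc N))) (ereal T) = ereal ?T + min (restart_time a ?y (Suc N)) (ereal (T - ?T))"
    using conjunct1[OF rs[of "Suc N"]]
    by (cases "restart_time a ?y (Suc N)") (auto simp: min_def simp del: restart_time.simps)
  then have "min (restart_time a x (Suc (Suc N))) (ereal T) = ereal (?T + v)" unfolding v(1) by simp
  moreover have "restart_time a x (Suc N) = ereal (?T + r')" using rs[of N] r' by simp
  ultimately have "reward a q x T = exp (running_max x (?T + r') (?T + v))"
    by (simp add: reward_def N max_since_restart_def Let_def del: restart_time.simps)
  also have "\<dots> = exp (x ?T) * exp (running_max ?y r' v)"
    by (simp add: running_max_shift[OF x r'(2) v(2)] exp_add)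
  also have "exp (running_max ?y r' v) = reward a q ?y (T - ?T)"
    using v r' by (simp add: reward_def N_def[symmetric] max_since_restart_def Let_def del: restart_time.simps)
  finally show ?thesis .
qed

text \<open>Runs that stop within the first \<open>n\<close> stages keep their reward, all others
  count 0. The recursion yields measurability and, in expectation, the partial sums of the geometric
  series; the reward is the supremum over \<open>n\<close>.\<close>

primrec truncated_reward :: "real \<Rightarrow> real \<Rightarrow> nat \<Rightarrow> (real \<Rightarrow> real) \<Rightarrow> real \<Rightarrow> ennreal" where
  "truncated_reward a q 0 x T = 0"
| "truncated_reward a q (Suc n) x T =
    (if has_lag a x \<longrightarrow> T < lag_end a x then ennreal (exp (running_max x 0 T))
     else if x (lag_end a x) - x (first_lag a x) < q then ennreal (exp (x (first_lag a x)))
     else ennreal (exp (x (lag_end a x))) * truncated_reward a q n (shift (lag_end a x) x) (T - lag_end a x))"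

lemma truncated_reward_eq:
  assumes "0 < a"
  shows "x \<in> paths \<Longrightarrow> truncated_reward a q n x T = (if stop_index a q x T < n then ennreal (reward a q x T) else 0)"
proof (induction n arbitrary: x T)
  case (Suc n)
  note x = Suc.prems
  show ?case
  proof (cases "stop_cond a q x T 0")
    case True
    then have "stop_index a q x T < Suc n" using stop_index_0[OF x assms True] by simp
    then show ?thesis using True reward_before_lag[OF x assms, of T q] reward_at_lag[OF x assms, of T q]
      unfolding stop_cond_0[OF x assms] by (auto simp: not_less)
  next
    case False
    have l: "has_lag a x" "lag_end a x \<le> T" "\<not> x (lag_end a x) - x (first_lag a x) < q"
      using False unfolding stop_cond_0[OF x assms] by auto
    show ?thesis
      using l reward_after_lag[OF x assms l] Suc.IH[OF shift_paths[OF x]] stop_index_Suc[OF x assms False]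
      by (auto simp: ennreal_mult')
  qed
qed simp

lemma measurable_lag_end [measurable]:
  assumes a: "0 < a" shows "lag_end a \<in> borel_measurable path_space"
proof -
  note [measurable] = measurable_has_lag[OF less_imp_le[OF a]] measurable_first_lag[OF less_imp_le[OF a]]
  show ?thesis unfolding lag_end_def[abs_def] by measurable
qed

lemma measurable_truncated_reward:
  assumes a: "0 < a"
  shows "(\<lambda>p. truncated_reward a q n (fst p) (snd p)) \<in> borel_measurable (path_space \<Otimes>\<^sub>M borel)"
proof (induction n)
  case (Suc n)
  note [measurable] = measurable_has_lag[OF less_imp_le[OF a]] measurable_first_lag[OF less_imp_le[OF a]] measurable_lag_end[OF a] Suc
  have [measurable]: "(\<lambda>p. truncated_reward a q n (shift (lag_end a (fst p)) (fst p)) (snd p - lag_end a (fst p))) \<in> borel_measurable (path_space \<Otimes>\<^sub>M borel)"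
    by (rule measurable_compose[where g="\<lambda>p. truncated_reward a q n (fst p) (snd p)" and
        f="\<lambda>p. (shift (lag_end a (fst p)) (fst p), snd p - lag_end a (fst p))", simplified]) measurable
  have [measurable]: "(\<lambda>p. fst p (lag_end a (fst p))) \<in> borel_measurable (path_space \<Otimes>\<^sub>M borel)"
    "(\<lambda>p. fst p (first_lag a (fst p))) \<in> borel_measurable (path_space \<Otimes>\<^sub>M borel)"
    by (rule measurable_path_eval; measurable)+
  show ?case unfolding truncated_reward.simps by measurable
qed simp

lemma reward_eq_SUP:
  assumes "x \<in> paths" "0 < a"
  shows "ennreal (reward a q x T) = (SUP n. truncated_reward a q n x T)"
proof (rule antisym)
  have "ennreal (reward a q x T) = truncated_reward a q (Suc (stop_index a q x T)) x T"
    by (simp add: truncated_reward_eq[OF assms(2,1)] del: truncated_reward.simps)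
  also have "\<dots> \<le> (SUP n. truncated_reward a q n x T)" by (rule SUP_upper) simp
  finally show "ennreal (reward a q x T) \<le> (SUP n. truncated_reward a q n x T)" .
  show "(SUP n. truncated_reward a q n x T) \<le> ennreal (reward a q x T)"
    by (rule SUP_least) (simp add: truncated_reward_eq[OF assms(2,1)])
qed

lemma reward_nonneg: "0 \<le> reward a q x T"
  by (simp add: reward_def Let_def)

lemma measurable_reward:
  assumes a: "0 < a"
  shows "(\<lambda>p. reward a q (fst p) (snd p)) \<in> borel_measurable (path_space \<Otimes>\<^sub>M borel)"
proof -
  note [measurable] = measurable_truncated_reward[OF a]
  have "(\<lambda>p. enn2real (SUP n. truncated_reward a q n (fst p) (snd p))) \<in> borel_measurable (path_space \<Otimes>\<^sub>M borel)"
    by measurable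
  moreover have "(\<lambda>p. reward a q (fst p) (snd p)) \<in> borel_measurable (path_space \<Otimes>\<^sub>M borel) \<longleftrightarrow>
     (\<lambda>p. enn2real (SUP n. truncated_reward a q n (fst p) (snd p))) \<in> borel_measurable (path_space \<Otimes>\<^sub>M borel)"
    by (rule measurable_cong) (auto simp: space_pair_measure reward_eq_SUP[OF _ a, symmetric] reward_nonneg)
  ultimately show ?thesis by blast
qed

definition truncated_value :: "real \<Rightarrow> real \<Rightarrow> real \<Rightarrow> nat \<Rightarrow> (real \<Rightarrow> real) \<Rightarrow> ennreal" where
  "truncated_value a \<eta> q n x =
    (\<integral>\<^sup>+T. (if 0 \<le> T then ennreal (\<eta> * exp (- \<eta> * T)) else 0) * truncated_reward a q n x T \<partial>lborel)"

lemma measurable_truncated_value [measurable]: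
  assumes a: "0 < a" shows "truncated_value a \<eta> q n \<in> borel_measurable path_space"
proof -
  note [measurable] = measurable_truncated_reward[OF a]
  have "sets (path_space \<Otimes>\<^sub>M lborel) = sets (path_space \<Otimes>\<^sub>M (borel :: real measure))"
    by (rule sets_pair_measure_cong) simp_all
  from measurable_cong_sets[OF this refl]
  have [measurable]: "(\<lambda>p. truncated_reward a q n (fst p) (snd p)) \<in> borel_measurable (path_space \<Otimes>\<^sub>M lborel)"
    using measurable_truncated_reward[OF a] by blast
  show ?thesis unfolding truncated_value_def[abs_def]
    by (rule lborel.borel_measurable_nn_integral) (simp add: split_beta', measurable)
qed

text \<open>The cut-off at \<open>0\<close> does not change the payoff, since a path never ends above its maximum;
  it makes the function bounded.\<close>

definition continue_gain :: "real \<Rightarrow> real \<Rightarrow> ennreal" where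
  "continue_gain q y = (if y < q then 0 else ennreal (exp (min 0 y)))"

lemma measurable_continue_gain [measurable]: "continue_gain q \<in> borel_measurable borel"
  unfolding continue_gain_def[abs_def] by measurable

text \<open>The clock integral is split at \<open>lag_end a x\<close>. Beyond it the exponential
  clock is memoryless: a translation leaves the discount \<open>exp (- \<eta> * lag_end a x)\<close>
  and the same integral for the shifted path.\<close>

lemma truncated_value_rec:
  assumes x: "x \<in> paths" and a: "0 < a" and \<eta>: "0 < \<eta>"
  shows "truncated_value a \<eta> q (Suc n) x = running_payoff a \<eta> x + lag_payoff a \<eta> (\<lambda>y. if y < q then 1 else 0) x +
    lag_payoff a \<eta> (continue_gain q) x * truncated_value a \<eta> q n (shift (lag_end a x) x)"
proof -
  let ?e = "\<lambda>T. if 0 \<le> T then ennreal (\<eta> * exp (- \<eta> * T)) else 0"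
  let ?L = "lag_end a x"
  note [measurable] = measurable_running_max_time[OF x]
  have run: "(\<integral>\<^sup>+T. (if has_lag a x \<longrightarrow> T < ?L then ?e T * ennreal (exp (running_max x 0 T)) else 0) \<partial>lborel) = running_payoff a \<eta> x"
    unfolding running_payoff_def
  proof (intro nn_integral_cong)
    fix T
    have "ennreal (\<eta> * exp (- \<eta> * T)) * ennreal (exp (running_max x 0 T)) = ennreal (\<eta> * exp (running_max x 0 T - \<eta> * T))"
      using \<eta> by (simp add: ennreal_mult'[symmetric] mult.assoc exp_add[symmetric])
    then show "(if has_lag a x \<longrightarrow> T < ?L then ?e T * ennreal (exp (running_max x 0 T)) else 0) =
       (if 0 \<le> T \<and> (has_lag a x \<longrightarrow> T < first_lag a x + a) then ennreal (\<eta> * exp (running_max x 0 T - \<eta> * T)) else 0)"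
      by (auto simp: lag_end_def)
  qed
  show ?thesis
  proof (cases "has_lag a x")
    case False
    have "truncated_value a \<eta> q (Suc n) x = (\<integral>\<^sup>+T. (if has_lag a x \<longrightarrow> T < ?L then ?e T * ennreal (exp (running_max x 0 T)) else 0) \<partial>lborel)"
      unfolding truncated_value_def using False by simp
    then show ?thesis using run False by (simp add: lag_payoff_def)
  next
    case True
    note le = lag_end_max[OF x a True]
    let ?y = "shift ?L x"
    have y: "?y \<in> paths" using x by simp
    have L0: "0 \<le> ?L" by (rule lag_end_nonneg[OF x a])
    let ?D = "x ?L - x (first_lag a x)"
    have [measurable]: "(\<lambda>T. truncated_reward a q n ?y T) \<in> borel_measurable borel"
      by (rule measurable_compose[OF _ measurable_truncated_reward[OF a], of "\<lambda>T. (?y, T)", simplified]) (use y in simp)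
    define G where "G U = (if ?D < q then ennreal (exp (x (first_lag a x))) else ennreal (exp (x ?L)) * truncated_reward a q n ?y U)" for U
    have [measurable]: "G \<in> borel_measurable borel" unfolding G_def[abs_def] by measurable
    have "truncated_value a \<eta> q (Suc n) x =
        (\<integral>\<^sup>+T. (if has_lag a x \<longrightarrow> T < ?L then ?e T * ennreal (exp (running_max x 0 T)) else 0) + (if ?L \<le> T then ?e T * G (T - ?L) else 0) \<partial>lborel)"
      unfolding truncated_value_def using True by (intro nn_integral_cong) (simp add: G_def)
    also have "\<dots> = running_payoff a \<eta> x + (\<integral>\<^sup>+T. (if ?L \<le> T then ?e T * G (T - ?L) else 0) \<partial>lborel)"
      unfolding run[symmetric] by (rule nn_integral_add) measurable
    also have "(\<integral>\<^sup>+T. (if ?L \<le> T then ?e T * G (T - ?L) else 0) \<partial>lborel) = (\<integral>\<^sup>+U. (if ?L \<le> ?L + 1 * U then ?e (?L + 1 * U) * G (?L + 1 * U - ?L) else 0) \<partial>lborel)"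
      by (subst nn_integral_real_affine[where c=1 and t="?L"]) auto
    also have "\<dots> = (\<integral>\<^sup>+U. ennreal (exp (- \<eta> * ?L)) * (?e U * G U) \<partial>lborel)"
    proof (intro nn_integral_cong)
      fix U
      have "ennreal (\<eta> * exp (- \<eta> * (?L + U))) = ennreal (exp (- \<eta> * ?L)) * ennreal (\<eta> * exp (- \<eta> * U))"
        using \<eta> by (simp add: ennreal_mult'[symmetric] mult.left_commute exp_add[symmetric] algebra_simps)
      then show "(if ?L \<le> ?L + 1 * U then ?e (?L + 1 * U) * G (?L + 1 * U - ?L) else 0) = ennreal (exp (- \<eta> * ?L)) * (?e U * G U)"
        using L0 by (simp add: mult.assoc)
    qed
    also have "\<dots> = ennreal (exp (- \<eta> * ?L)) * (\<integral>\<^sup>+U. ?e U * G U \<partial>lborel)"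
      by (rule nn_integral_cmult) measurable
    also have "\<dots> = lag_payoff a \<eta> (\<lambda>y. if y < q then 1 else 0) x + lag_payoff a \<eta> (continue_gain q) x * truncated_value a \<eta> q n ?y"
    proof (cases "?D < q")
      case q: True
      have "(\<integral>\<^sup>+U. ?e U * G U \<partial>lborel) = (\<integral>\<^sup>+U. ?e U \<partial>lborel) * ennreal (exp (x (first_lag a x)))"
        unfolding G_def using q by (simp add: nn_integral_multc)
      also have "(\<integral>\<^sup>+U. ?e U \<partial>lborel) = 1" using nn_integral_exp_atLeast[of \<eta> \<eta>] \<eta> by simp
      finally have "ennreal (exp (- \<eta> * ?L)) * (\<integral>\<^sup>+U. ?e U * G U \<partial>lborel) = ennreal (exp (x (first_lag a x) - \<eta> * ?L))"
        by (simp add: ennreal_mult[symmetric] exp_add[symmetric])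
      then show ?thesis using True q le(4)
        by (simp add: lag_payoff_def Let_def continue_gain_def)
    next
      case q: False
      have "(\<integral>\<^sup>+U. ?e U * G U \<partial>lborel) = (\<integral>\<^sup>+U. ennreal (exp (x ?L)) * (?e U * truncated_reward a q n ?y U) \<partial>lborel)"
        unfolding G_def using q by (intro nn_integral_cong) (simp add: mult_ac)
      also have "\<dots> = ennreal (exp (x ?L)) * truncated_value a \<eta> q n ?y"
        unfolding truncated_value_def by (rule nn_integral_cmult) measurable
      finally have "ennreal (exp (- \<eta> * ?L)) * (\<integral>\<^sup>+U. ?e U * G U \<partial>lborel) = ennreal (exp (- \<eta> * ?L) * exp (x ?L)) * truncated_value a \<eta> q n ?y"
        by (simp add: ennreal_mult mult.assoc)
      \<comment> \<open>The drop is nonpositive here, so it equals its minimum with 0, and drop plus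
        level at the window start is \<open>x ?L\<close>.\<close>
      also have "ennreal (exp (- \<eta> * ?L) * exp (x ?L)) = continue_gain q ?D * ennreal (exp (x (first_lag a x) - \<eta> * ?L))"
        using q le(2) by (simp add: continue_gain_def min_def ennreal_mult[symmetric] exp_add[symmetric])
      finally show ?thesis using True q le(4) by (simp add: lag_payoff_def Let_def)
    qed
    finally show ?thesis by (simp add: add.assoc)
  qed
qed

context half_drift
begin

text \<open>The path-space form of \<open>A_0 + A_minus q\<close>.\<close>

definition stop_gain :: "real \<Rightarrow> real \<Rightarrow> real \<Rightarrow> ennreal" where
  "stop_gain a \<eta> q = (\<integral>\<^sup>+x. running_payoff a \<eta> x \<partial>P) + (\<integral>\<^sup>+x. lag_payoff a \<eta> (\<lambda>y. if y < q then 1 else 0) x \<partial>P)"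

lemma truncated_value_expectation_rec:
  assumes a: "0 < a" and \<eta>: "0 < \<eta>"
  shows "(\<integral>\<^sup>+x. truncated_value a \<eta> q (Suc n) x \<partial>P) =
    stop_gain a \<eta> q + (\<integral>\<^sup>+x. lag_payoff a \<eta> (continue_gain q) x \<partial>P) * (\<integral>\<^sup>+x. truncated_value a \<eta> q n x \<partial>P)"
proof -
  note [measurable] = measurable_running_payoff[OF less_imp_le[OF a]] measurable_lag_payoff[OF less_imp_le[OF a]]
    measurable_truncated_value[OF a] measurable_lag_end[OF a]
  have "(\<integral>\<^sup>+x. truncated_value a \<eta> q (Suc n) x \<partial>P) = (\<integral>\<^sup>+x. running_payoff a \<eta> x + lag_payoff a \<eta> (\<lambda>y. if y < q then 1 else 0) x +
    lag_payoff a \<eta> (continue_gain q) x * truncated_value a \<eta> q n (shift (lag_end a x) x) \<partial>P)"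
    by (intro nn_integral_cong truncated_value_rec a \<eta>) simp
  also have "\<dots> = stop_gain a \<eta> q + (\<integral>\<^sup>+x. lag_payoff a \<eta> (continue_gain q) x * truncated_value a \<eta> q n (shift (lag_end a x) x) \<partial>P)"
    by (simp add: nn_integral_add stop_gain_def)
  also have "(\<integral>\<^sup>+x. lag_payoff a \<eta> (continue_gain q) x * truncated_value a \<eta> q n (shift (lag_end a x) x) \<partial>P) =
     (\<integral>\<^sup>+x. lag_payoff a \<eta> (continue_gain q) x \<partial>P) * (\<integral>\<^sup>+x. truncated_value a \<eta> q n x \<partial>P)"
  proof (rule strong_markov_mult)
    show "(\<integral>\<^sup>+x. lag_payoff a \<eta> (continue_gain q) x \<partial>P) < \<infinity>"
      by (rule lag_payoff_finite[OF a \<eta>, of _ 1]) (simp add: continue_gain_def)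
  qed (use lag_end_nonneg[OF _ a] adapted_lag_end[OF a] in auto)
  finally show ?thesis .
qed

lemma incseq_truncated_reward: "0 < a \<Longrightarrow> x \<in> paths \<Longrightarrow> incseq (\<lambda>n. truncated_reward a q n x T)"
  by (auto simp: incseq_def truncated_reward_eq)

text \<open>Monotone convergence, in the clock and in the path, reduces the value to the truncated
  values, which satisfy an affine recursion started at 0.\<close>

lemma reward_expectation:
  assumes a: "0 < a" and \<eta>: "0 < \<eta>" and A: "(\<integral>\<^sup>+x. lag_payoff a \<eta> (continue_gain q) x \<partial>P) = ennreal A" "0 \<le> A" "A < 1"
    and B: "stop_gain a \<eta> q = ennreal B" "0 \<le> B"
  shows "(\<integral>\<^sup>+x. \<integral>\<^sup>+T. (if 0 \<le> T then ennreal (\<eta> * exp (- \<eta> * T)) else 0) * ennreal (reward a q x T) \<partial>lborel \<partial>P) = ennreal (B / (1 - A))"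
proof -
  note [measurable] = measurable_truncated_value[OF a]
  let ?e = "\<lambda>T. if 0 \<le> T then ennreal (\<eta> * exp (- \<eta> * T)) else 0"
  have "(\<integral>\<^sup>+x. \<integral>\<^sup>+T. ?e T * ennreal (reward a q x T) \<partial>lborel \<partial>P) = (\<integral>\<^sup>+x. (SUP n. truncated_value a \<eta> q n x) \<partial>P)"
  proof (intro nn_integral_cong)
    fix x assume "x \<in> space P" then have x: "x \<in> paths" by simp
    have [measurable]: "(\<lambda>T. truncated_reward a q n x T) \<in> borel_measurable borel" for n
      by (rule measurable_compose[OF _ measurable_truncated_reward[OF a], of "\<lambda>T. (x, T)", simplified]) (use x in simp)
    have "(\<integral>\<^sup>+T. ?e T * ennreal (reward a q x T) \<partial>lborel) = (\<integral>\<^sup>+T. (SUP n. ?e T * truncated_reward a q n x T) \<partial>lborel)"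
      by (intro nn_integral_cong) (simp only: reward_eq_SUP[OF x a] SUP_mult_left_ennreal)
    also have "\<dots> = (SUP n. \<integral>\<^sup>+T. ?e T * truncated_reward a q n x T \<partial>lborel)"
      using incseq_truncated_reward[OF a x]
      by (intro nn_integral_monotone_convergence_SUP) (auto simp: incseq_def le_fun_def intro!: mult_left_mono)
    finally show "(\<integral>\<^sup>+T. ?e T * ennreal (reward a q x T) \<partial>lborel) = (SUP n. truncated_value a \<eta> q n x)"
      by (simp add: truncated_value_def)
  qed
  also have "\<dots> = (SUP n. \<integral>\<^sup>+x. truncated_value a \<eta> q n x \<partial>P)"
  proof (rule nn_integral_monotone_convergence_SUP_AE)
    show "AE x in P. truncated_value a \<eta> q n x \<le> truncated_value a \<eta> q (Suc n) x" for n
    proof (rule AE_I2)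
      fix x assume "x \<in> space P" then have x: "x \<in> paths" by simp
      show "truncated_value a \<eta> q n x \<le> truncated_value a \<eta> q (Suc n) x"
        unfolding truncated_value_def using incseq_truncated_reward[OF a x]
        by (intro nn_integral_mono mult_left_mono) (auto simp: incseq_def simp del: truncated_reward.simps)
    qed
  qed measurable
  also have "(\<lambda>n. \<integral>\<^sup>+x. truncated_value a \<eta> q n x \<partial>P) = (\<lambda>n. ennreal (B * (\<Sum>i<n. A ^ i)))"
  proof
    fix n show "(\<integral>\<^sup>+x. truncated_value a \<eta> q n x \<partial>P) = ennreal (B * (\<Sum>i<n. A ^ i))"
    proof (induction n)
      case (Suc n)
      have "B * (\<Sum>i<Suc n. A ^ i) = B + A * (B * (\<Sum>i<n. A ^ i))"
        by (subst sum.lessThan_Suc_shift) (simp add: sum_distrib_left algebra_simps)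
      then show ?case
        unfolding truncated_value_expectation_rec[OF a \<eta>] A B Suc using A B
        by (simp add: ennreal_plus ennreal_mult sum_nonneg)
    qed (simp add: truncated_value_def)
  qed
  also have "(SUP n. ennreal (B * (\<Sum>i<n. A ^ i))) = ennreal (B / (1 - A))"
  proof (rule LIMSEQ_unique[OF LIMSEQ_SUP])
    show "incseq (\<lambda>n. ennreal (B * (\<Sum>i<n. A ^ i)))"
      using A B by (auto simp: incseq_def intro!: ennreal_leI mult_left_mono sum_mono2)
    have "(\<lambda>n. \<Sum>i<n. A ^ i) \<longlonglongrightarrow> 1 / (1 - A)"
      using geometric_sums[of A] A by (simp add: sums_def)
    from tendsto_mult[OF tendsto_const this, of B]
    show "(\<lambda>n. ennreal (B * (\<Sum>i<n. A ^ i))) \<longlonglongrightarrow> ennreal (B / (1 - A))"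
      by (intro tendsto_ennrealI) simp
  qed
  finally show ?thesis .
qed

end

section \<open>From Brownian motion to the path space\<close>

text \<open>\<open>W 0\<close> vanishes only almost surely, whereas \<open>paths\<close> demands the
  value 0; subtracting \<open>W 0\<close> makes every sample path admissible.\<close>

definition drifted_path :: "real \<Rightarrow> (real \<Rightarrow> 'a \<Rightarrow> real) \<Rightarrow> 'a \<Rightarrow> real \<Rightarrow> real" where
  "drifted_path c W \<omega> = (\<lambda>t. W (max 0 t) \<omega> - W 0 \<omega> + c * max 0 t)"

lemma dyadics_common_grid:
  assumes "finite S" "S \<subseteq> dyadics"
  shows "\<exists>n. \<forall>s\<in>S. \<exists>i::nat. s = real i / 2 ^ n"
  using assms
proof (induction S)
  case (insert s S)
  then obtain n where n: "\<forall>s\<in>S. \<exists>i::nat. s = real i / 2 ^ n" by auto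
  obtain i m where s: "s = real i / 2 ^ m" using insert.prems by (auto simp: dyadics_def)
  have ref: "real j / 2 ^ k = real (j * 2 ^ l) / 2 ^ (k + l)" for j k l :: nat
    by (simp add: power_add)
  show ?case
  proof (rule exI[of _ "m + n"], rule ballI)
    fix r assume "r \<in> insert s S"
    then consider "r = s" | "r \<in> S" by auto
    then show "\<exists>i::nat. r = real i / 2 ^ (m + n)"
    proof cases
      case 1
      then show ?thesis using s ref[of i m n] by metis
    next
      case 2
      then obtain j where "r = real j / 2 ^ n" using n by auto
      then show ?thesis using ref[of j n m] by (metis add.commute)
    qed
  qed
qed simp

locale brownian =
  fixes M :: "'a measure" and W :: "real \<Rightarrow> 'a \<Rightarrow> real"
  assumes bm: "standard_brownian_motion M W"
begin

sublocale prob_space M using bm by (simp add: standard_brownian_motion_def)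

lemma W_measurable: "0 \<le> t \<Longrightarrow> W t \<in> borel_measurable M"
  using bm by (simp add: standard_brownian_motion_def)

lemma W_0: "AE \<omega> in M. W 0 \<omega> = 0"
  using bm by (simp add: standard_brownian_motion_def)

lemma W_continuous: "\<omega> \<in> space M \<Longrightarrow> continuous_on {0..} (\<lambda>t. W t \<omega>)"
  using bm by (simp add: standard_brownian_motion_def)

lemma W_increment: "0 \<le> s \<Longrightarrow> s < t \<Longrightarrow> distributed M lborel (\<lambda>\<omega>. W t \<omega> - W s \<omega>) (normal_density 0 (sqrt (t - s)))"
  using bm by (simp add: standard_brownian_motion_def)

lemma W_indep: "0 \<le> t 0 \<Longrightarrow> (\<And>i. i < n \<Longrightarrow> t i \<le> t (Suc i)) \<Longrightarrow>
    indep_vars (\<lambda>_. borel) (\<lambda>i \<omega>. W (t (Suc i)) \<omega> - W (t i) \<omega>) {..<n::nat}"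
  using bm by (simp add: standard_brownian_motion_def)

lemma drifted_path_paths: "\<omega> \<in> space M \<Longrightarrow> drifted_path c W \<omega> \<in> paths"
  unfolding paths_def drifted_path_def
  by (auto intro!: continuous_intros continuous_on_compose2[OF W_continuous, of \<omega> UNIV "max 0"])

lemma measurable_drifted_path [measurable]: "drifted_path c W \<in> M \<rightarrow>\<^sub>M path_space"
proof (rule measurable_path_spaceI)
  fix t
  have [measurable]: "W (max 0 t) \<in> borel_measurable M" "W 0 \<in> borel_measurable M"
    by (auto intro: W_measurable)
  show "(\<lambda>\<omega>. drifted_path c W \<omega> t) \<in> borel_measurable M"
    unfolding drifted_path_def by measurable
qed (rule drifted_path_paths)

text \<open>Stationarity: the joint law of \<open>m\<close> consecutive grid increments is the same
  product of normal laws for every starting index \<open>k\<close>. The product criterion for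
  independence is stated for nonempty index sets, whence \<open>0 < m\<close>.\<close>

lemma indep_increments_shift:
  assumes h: "0 < h" and m: "0 < m"
  shows "distr M (\<Pi>\<^sub>M i\<in>{..<m}. borel) (\<lambda>\<omega>. \<lambda>i\<in>{..<m}. W (real (k + i + 1) * h) \<omega> - W (real (k + i) * h) \<omega>) =
    (\<Pi>\<^sub>M i\<in>{..<m}. density lborel (normal_density 0 (sqrt h)))"
proof -
  let ?\<xi> = "\<lambda>i \<omega>. W (real (k + i + 1) * h) \<omega> - W (real (k + i) * h) \<omega>"
  have law: "distr M borel (?\<xi> i) = density lborel (normal_density 0 (sqrt h))" for i
  proof -
    have "distributed M lborel (?\<xi> i) (normal_density 0 (sqrt (real (k + i + 1) * h - real (k + i) * h)))"
      using h by (intro W_increment) auto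
    moreover have "real (k + i + 1) * h - real (k + i) * h = h" by (simp add: algebra_simps)
    ultimately have "distr M lborel (?\<xi> i) = density lborel (normal_density 0 (sqrt h))"
      by (metis distributed_distr_eq_density)
    moreover have "distr M borel (?\<xi> i) = distr M lborel (?\<xi> i)" by (rule distr_cong) auto
    ultimately show ?thesis by simp
  qed
  have rv: "?\<xi> i \<in> borel_measurable M" for i
    using h by (intro borel_measurable_diff W_measurable) auto
  have "indep_vars (\<lambda>_. borel) (\<lambda>i \<omega>. W ((\<lambda>i. real (k + i) * h) (Suc i)) \<omega> - W ((\<lambda>i. real (k + i) * h) i) \<omega>) {..<m}"
    using h by (intro W_indep) auto
  then have "indep_vars (\<lambda>_. borel) ?\<xi> {..<m}" by (simp add: add.assoc)
  then have "distr M (\<Pi>\<^sub>M i\<in>{..<m}. borel) (\<lambda>\<omega>. \<lambda>i\<in>{..<m}. ?\<xi> i \<omega>) = (\<Pi>\<^sub>M i\<in>{..<m}. distr M borel (?\<xi> i))"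
    using indep_vars_iff_distr_eq_PiM[where I="{..<m}" and M'="\<lambda>_. borel" and X="?\<xi>"] rv m by (auto simp: lessThan_empty_iff)
  then show ?thesis by (simp only: law)
qed

lemma drifted_path_grid:
  "drifted_path c W \<omega> (real i * h) = (\<Sum>j<i. (W (real (j + 1) * h) \<omega> - W (real j * h) \<omega>) + c * h)" if "0 \<le> h"
proof -
  have "(\<Sum>j<i. W (real (j + 1) * h) \<omega> - W (real j * h) \<omega>) = W (real i * h) \<omega> - W 0 \<omega>"
    using sum_lessThan_telescope[of "\<lambda>j. W (real j * h) \<omega>" i] by simp
  moreover have "max 0 (real i * h) = real i * h" using that by simp
  ultimately show ?thesis
    unfolding drifted_path_def sum.distrib by (simp add: mult_ac)
qed

lemma drifted_path_grid_diff:
  assumes "0 \<le> h"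
  shows "drifted_path c W \<omega> (real (k + i) * h) - drifted_path c W \<omega> (real k * h) =
    (\<Sum>j<i. (W (real (k + j + 1) * h) \<omega> - W (real (k + j) * h) \<omega>) + c * h)"
proof -
  let ?f = "\<lambda>j. (W (real (j + 1) * h) \<omega> - W (real j * h) \<omega>) + c * h"
  have "(\<Sum>j<k + i. ?f j) = (\<Sum>j<k. ?f j) + (\<Sum>j<i. ?f (k + j))"
    by (induction i) (simp_all add: add.assoc)
  then show ?thesis unfolding drifted_path_grid[OF assms] by simp
qed

text \<open>All times are placed on one dyadic grid. The past event depends on the first
  \<open>k\<close> increments and the future event on the next \<open>m\<close>; independence gives
  the product, and stationarity identifies the second factor with the probability for the unshifted
  path.\<close>

lemma markov_cylinder_path:
  fixes c :: real
  assumes t: "t \<in> dyadics" and F: "finite F" "fst ` F \<subseteq> dyadics" and G: "finite G" "fst ` G \<subseteq> dyadics"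
  defines "\<pi> \<equiv> drifted_path c W"
  shows "emeasure (distr M path_space \<pi>) {x\<in>paths. stopped t x \<in> cylinder F \<and> shift t x \<in> cylinder G} =
    emeasure (distr M path_space \<pi>) {x\<in>paths. stopped t x \<in> cylinder F} * emeasure (distr M path_space \<pi>) (cylinder G)"
proof -
  have "\<exists>n. \<forall>s\<in>insert t (fst ` F \<union> fst ` G). \<exists>i::nat. s = real i / 2 ^ n"
    by (rule dyadics_common_grid) (use t F G in auto)
  then obtain n where n: "\<And>s. s \<in> insert t (fst ` F \<union> fst ` G) \<Longrightarrow> \<exists>i::nat. s = real i / 2 ^ n" by blast
  define h where "h = (1 / 2 ^ n :: real)"
  have h: "0 < h" "0 \<le> h" by (auto simp: h_def)
  have "\<exists>\<iota>. \<forall>s\<in>insert t (fst ` F \<union> fst ` G). s = real (\<iota> s) * h"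
    by (rule bchoice) (use n in \<open>simp add: h_def\<close>)
  then obtain \<iota> where \<iota>: "\<And>s. s \<in> insert t (fst ` F \<union> fst ` G) \<Longrightarrow> s = real (\<iota> s) * h" by blast
  define k where "k = \<iota> t"
  have tk: "t = real k * h" using \<iota>[of t] by (simp add: k_def)
  \<comment> \<open>The sum bounds every grid index occurring in \<open>G\<close>;
    \<open>Suc\<close> keeps \<open>m\<close> positive when \<open>G\<close> is empty.\<close>
  define m where "m = Suc (\<Sum>p\<in>G. \<iota> (fst p))"
  have m: "\<iota> (fst p) \<le> m" if "p \<in> G" for p
    unfolding m_def by (rule le_SucI, rule member_le_sum) (use that G in auto)
  let ?\<xi> = "\<lambda>i \<omega>. W (real (i + 1) * h) \<omega> - W (real i * h) \<omega>"
  have rv [measurable]: "(\<lambda>\<omega>. W (real i * h) \<omega>) \<in> borel_measurable M" for i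
    using h by (intro W_measurable) auto
  let ?d = "c * h"
  define E1 where "E1 = {u\<in>space (\<Pi>\<^sub>M i\<in>{..<k}. borel :: real measure). \<forall>p\<in>F. (\<Sum>j<min (\<iota> (fst p)) k. u j + ?d) < snd p}"
  \<comment> \<open>\<open>E2\<close> and \<open>E3\<close> describe the same future event: in
    increments indexed from \<open>k\<close> for the independence step, and from 0 for the
    comparison of laws.\<close>
  define E2 where "E2 = {u\<in>space (\<Pi>\<^sub>M i\<in>{k..<k+m}. borel :: real measure). \<forall>p\<in>G. (\<Sum>j<\<iota> (fst p). u (k + j) + ?d) < snd p}"
  define E3 where "E3 = {u\<in>space (\<Pi>\<^sub>M i\<in>{..<m}. borel :: real measure). \<forall>p\<in>G. (\<Sum>j<\<iota> (fst p). u j + ?d) < snd p}"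
  have sE1 [measurable]: "E1 \<in> sets (\<Pi>\<^sub>M i\<in>{..<k}. borel)"
  proof -
    have c [measurable]: "j < k \<Longrightarrow> (\<lambda>u. u j) \<in> borel_measurable (\<Pi>\<^sub>M i\<in>{..<k}. borel :: real measure)" for j
      by (rule measurable_component_singleton) simp
    have [measurable]: "(\<lambda>u. \<Sum>j<min (\<iota> (fst p)) k. u j + ?d) \<in> borel_measurable (\<Pi>\<^sub>M i\<in>{..<k}. borel :: real measure)" for p :: "real \<times> real"
      by (intro borel_measurable_sum borel_measurable_add c borel_measurable_const) simp
    show ?thesis unfolding E1_def using F(1) by measurable
  qed
  have sE2 [measurable]: "E2 \<in> sets (\<Pi>\<^sub>M i\<in>{k..<k+m}. borel)"
  proof -
    have c: "j < m \<Longrightarrow> (\<lambda>u. u (k + j)) \<in> borel_measurable (\<Pi>\<^sub>M i\<in>{k..<k+m}. borel :: real measure)" for j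
      by (rule measurable_component_singleton) simp
    have "(\<lambda>u. \<Sum>j<\<iota> (fst p). u (k + j) + ?d) \<in> borel_measurable (\<Pi>\<^sub>M i\<in>{k..<k+m}. borel :: real measure)" if "p \<in> G" for p
      by (intro borel_measurable_sum borel_measurable_add c borel_measurable_const) (use m[OF that] in simp)
    then show ?thesis unfolding E2_def by (intro sets.sets_Collect_finite_All borel_measurable_less borel_measurable_const G(1))
  qed
  have sE3 [measurable]: "E3 \<in> sets (\<Pi>\<^sub>M i\<in>{..<m}. borel)"
  proof -
    have c: "j < m \<Longrightarrow> (\<lambda>u. u j) \<in> borel_measurable (\<Pi>\<^sub>M i\<in>{..<m}. borel :: real measure)" for j
      by (rule measurable_component_singleton) simp
    have "(\<lambda>u. \<Sum>j<\<iota> (fst p). u j + ?d) \<in> borel_measurable (\<Pi>\<^sub>M i\<in>{..<m}. borel :: real measure)" if "p \<in> G" for p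
      by (intro borel_measurable_sum borel_measurable_add c borel_measurable_const) (use m[OF that] in simp)
    then show ?thesis unfolding E3_def by (intro sets.sets_Collect_finite_All borel_measurable_less borel_measurable_const G(1))
  qed
  let ?X1 = "\<lambda>\<omega>. restrict (\<lambda>i. ?\<xi> i \<omega>) {..<k}" and ?X2 = "\<lambda>\<omega>. restrict (\<lambda>i. ?\<xi> i \<omega>) {k..<k+m}"
  let ?Y = "\<lambda>k' \<omega>. \<lambda>i\<in>{..<m}. W (real (k' + i + 1) * h) \<omega> - W (real (k' + i) * h) \<omega>"
  have mY [measurable]: "?Y k' \<in> M \<rightarrow>\<^sub>M (\<Pi>\<^sub>M i\<in>{..<m}. borel)" for k' by measurable
  have Fst: "stopped t (\<pi> \<omega>) \<in> cylinder F \<longleftrightarrow> ?X1 \<omega> \<in> E1" if \<omega>: "\<omega> \<in> space M" for \<omega>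
  proof -
    have "stopped t (\<pi> \<omega>) (fst p) = (\<Sum>j<min (\<iota> (fst p)) k. ?X1 \<omega> j + ?d)" if "p \<in> F" for p
    proof -
      have p: "fst p = real (\<iota> (fst p)) * h" using \<iota>[of "fst p"] that by simp
      have "min (fst p) t = real (min (\<iota> (fst p)) k) * h"
        using h(1) by (subst p, subst tk) (auto simp: min_def)
      then have "stopped t (\<pi> \<omega>) (fst p) = \<pi> \<omega> (real (min (\<iota> (fst p)) k) * h)" by (simp add: stopped_def)
      also have "\<dots> = (\<Sum>j<min (\<iota> (fst p)) k. ?\<xi> j \<omega> + ?d)"
        unfolding \<pi>_def by (rule drifted_path_grid[OF h(2)])
      also have "\<dots> = (\<Sum>j<min (\<iota> (fst p)) k. ?X1 \<omega> j + ?d)" by (intro sum.cong) auto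
      finally show ?thesis .
    qed
    then show ?thesis
      using drifted_path_paths[OF \<omega>, of c] by (auto simp: cylinder_def E1_def space_PiM \<pi>_def)
  qed
  have Gsh: "shift t (\<pi> \<omega>) (fst p) = (\<Sum>j<\<iota> (fst p). (W (real (k + j + 1) * h) \<omega> - W (real (k + j) * h) \<omega>) + ?d)" if "p \<in> G" for p \<omega>
  proof -
    have p: "fst p = real (\<iota> (fst p)) * h" using \<iota>[of "fst p"] that by simp
    have "max 0 (fst p) = real (\<iota> (fst p)) * h" using h by (subst p) simp
    then have "shift t (\<pi> \<omega>) (fst p) = \<pi> \<omega> (real (k + \<iota> (fst p)) * h) - \<pi> \<omega> (real k * h)"
      by (simp add: shift_def tk algebra_simps)
    also have "\<dots> = (\<Sum>j<\<iota> (fst p). (W (real (k + j + 1) * h) \<omega> - W (real (k + j) * h) \<omega>) + ?d)"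
      unfolding \<pi>_def by (rule drifted_path_grid_diff[OF h(2)])
    finally show ?thesis .
  qed
  have Gst: "shift t (\<pi> \<omega>) \<in> cylinder G \<longleftrightarrow> ?X2 \<omega> \<in> E2" "shift t (\<pi> \<omega>) \<in> cylinder G \<longleftrightarrow> ?Y k \<omega> \<in> E3"
    if \<omega>: "\<omega> \<in> space M" for \<omega>
  proof -
    have 2: "shift t (\<pi> \<omega>) (fst p) = (\<Sum>j<\<iota> (fst p). ?X2 \<omega> (k + j) + ?d)"
      and 3: "shift t (\<pi> \<omega>) (fst p) = (\<Sum>j<\<iota> (fst p). ?Y k \<omega> j + ?d)" if "p \<in> G" for p
      unfolding Gsh[OF that] using m[OF that] by (intro sum.cong; simp)+
    have pth: "shift t (\<pi> \<omega>) \<in> paths" using drifted_path_paths[OF \<omega>, of c] by (simp add: \<pi>_def)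
    show "shift t (\<pi> \<omega>) \<in> cylinder G \<longleftrightarrow> ?X2 \<omega> \<in> E2"
      using 2 pth by (auto simp: cylinder_def E2_def space_PiM)
    show "shift t (\<pi> \<omega>) \<in> cylinder G \<longleftrightarrow> ?Y k \<omega> \<in> E3"
      using 3 pth by (auto simp: cylinder_def E3_def space_PiM)
  qed
  have G0: "\<pi> \<omega> \<in> cylinder G \<longleftrightarrow> ?Y 0 \<omega> \<in> E3" if \<omega>: "\<omega> \<in> space M" for \<omega>
  proof -
    have "\<pi> \<omega> (fst p) = (\<Sum>j<\<iota> (fst p). ?Y 0 \<omega> j + ?d)" if "p \<in> G" for p
    proof -
      have p: "fst p = real (\<iota> (fst p)) * h" using \<iota>[of "fst p"] that by simp
      have "\<pi> \<omega> (fst p) = (\<Sum>j<\<iota> (fst p). ?\<xi> j \<omega> + ?d)"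
        unfolding \<pi>_def by (subst p) (rule drifted_path_grid[OF h(2)])
      also have "\<dots> = (\<Sum>j<\<iota> (fst p). ?Y 0 \<omega> j + ?d)" using m[OF that] by (intro sum.cong) auto
      finally show ?thesis .
    qed
    then show ?thesis using drifted_path_paths[OF \<omega>, of c] by (auto simp: cylinder_def E3_def space_PiM \<pi>_def)
  qed
  have "indep_vars (\<lambda>_. borel) (\<lambda>i \<omega>. W ((\<lambda>i. real i * h) (Suc i)) \<omega> - W ((\<lambda>i. real i * h) i) \<omega>) {..<k+m}"
    using h by (intro W_indep) auto
  then have ind: "indep_vars (\<lambda>_. borel) ?\<xi> {..<k+m}" by simp
  have iv: "indep_var (\<Pi>\<^sub>M i\<in>{..<k}. borel) ?X1 (\<Pi>\<^sub>M i\<in>{k..<k+m}. borel) ?X2"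
    by (rule indep_var_restrict[OF ind]) auto
  have pr: "prob ((\<lambda>\<omega>. (?X1 \<omega>, ?X2 \<omega>)) -` (E1 \<times> E2) \<inter> space M) = prob (?X1 -` E1 \<inter> space M) * prob (?X2 -` E2 \<inter> space M)"
    by (rule indep_varD[OF iv sE1 sE2])
  have "emeasure (distr M (\<Pi>\<^sub>M i\<in>{..<m}. borel) (?Y k)) E3 = emeasure (distr M (\<Pi>\<^sub>M i\<in>{..<m}. borel) (?Y 0)) E3"
    using indep_increments_shift[OF h(1), of m k] indep_increments_shift[OF h(1), of m 0] by (simp add: m_def)
  then have yy: "emeasure M (?Y k -` E3 \<inter> space M) = emeasure M (?Y 0 -` E3 \<inter> space M)"
    by (simp only: emeasure_distr[OF mY sE3])
  have \<pi>M [measurable]: "\<pi> \<in> M \<rightarrow>\<^sub>M path_space" unfolding \<pi>_def by measurable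
  have [measurable]: "cylinder F \<in> sets path_space" "cylinder G \<in> sets path_space" using F G by auto
  have s1: "{x\<in>paths. stopped t x \<in> cylinder F} \<in> sets path_space"
    "{x\<in>paths. stopped t x \<in> cylinder F \<and> shift t x \<in> cylinder G} \<in> sets path_space"
  proof -
    have "{x\<in>space path_space. stopped t x \<in> cylinder F} \<in> sets path_space"
      "{x\<in>space path_space. stopped t x \<in> cylinder F \<and> shift t x \<in> cylinder G} \<in> sets path_space"
      by measurable
    then show "{x\<in>paths. stopped t x \<in> cylinder F} \<in> sets path_space"
      "{x\<in>paths. stopped t x \<in> cylinder F \<and> shift t x \<in> cylinder G} \<in> sets path_space" by simp_all
  qed
  have "emeasure (distr M path_space \<pi>) {x\<in>paths. stopped t x \<in> cylinder F \<and> shift t x \<in> cylinder G} =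
      emeasure M ((\<lambda>\<omega>. (?X1 \<omega>, ?X2 \<omega>)) -` (E1 \<times> E2) \<inter> space M)"
    using Fst Gst(1) drifted_path_paths[of _ c] by (subst emeasure_distr[OF \<pi>M s1(2)]) (auto simp: \<pi>_def intro!: arg_cong[where f="emeasure M"])
  also have "\<dots> = emeasure M (?X1 -` E1 \<inter> space M) * emeasure M (?X2 -` E2 \<inter> space M)"
    using pr by (simp add: emeasure_eq_measure ennreal_mult)
  also have "?X1 -` E1 \<inter> space M = \<pi> -` {x\<in>paths. stopped t x \<in> cylinder F} \<inter> space M"
    using Fst drifted_path_paths[of _ c] by (auto simp: \<pi>_def)
  also have "emeasure M \<dots> = emeasure (distr M path_space \<pi>) {x\<in>paths. stopped t x \<in> cylinder F}"
    by (rule emeasure_distr[OF \<pi>M s1(1), symmetric])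
  also have "?X2 -` E2 \<inter> space M = ?Y k -` E3 \<inter> space M"
    using Gst by blast
  also have "emeasure M \<dots> = emeasure M (?Y 0 -` E3 \<inter> space M)" by (rule yy)
  also have "?Y 0 -` E3 \<inter> space M = \<pi> -` cylinder G \<inter> space M" using G0 by blast
  also have "emeasure M \<dots> = emeasure (distr M path_space \<pi>) (cylinder G)"
    by (rule emeasure_distr[OF \<pi>M, symmetric]) measurable
  finally show ?thesis .
qed

lemma markov_path_law: "markov_path (distr M path_space (drifted_path c W)) c"
proof (intro markov_path.intro markov_path_axioms.intro)
  show "prob_space (distr M path_space (drifted_path c W))" by (rule prob_space_distr) measurable
  show "sets (distr M path_space (drifted_path c W)) = sets path_space" by simp
  show "emeasure (distr M path_space (drifted_path c W)) {x\<in>paths. stopped t x \<in> cylinder F \<and> shift t x \<in> cylinder G} =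
    emeasure (distr M path_space (drifted_path c W)) {x\<in>paths. stopped t x \<in> cylinder F} * emeasure (distr M path_space (drifted_path c W)) (cylinder G)"
    if "t \<in> dyadics" "finite F" "finite G" "fst ` F \<subseteq> dyadics" "fst ` G \<subseteq> dyadics" for t F G
    using that by (intro markov_cylinder_path)
  show "distr (distr M path_space (drifted_path c W)) borel (\<lambda>x. x s) = density lborel (normal_density (c * s) (sqrt s))"
    if s: "0 < s" for s
  proof -
    have "distributed M lborel (\<lambda>\<omega>. c * s + 1 * (W s \<omega> - W 0 \<omega>)) (normal_density (c * s + 1 * 0) (\<bar>1\<bar> * sqrt (s - 0)))"
      by (rule normal_density_affine[OF W_increment]) (use s in auto)
    then have "distr M lborel (\<lambda>\<omega>. c * s + 1 * (W s \<omega> - W 0 \<omega>)) = density lborel (normal_density (c * s) (sqrt s))"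
      by (simp add: distributed_distr_eq_density)
    moreover have "distr (distr M path_space (drifted_path c W)) borel (\<lambda>x. x s) = distr M borel ((\<lambda>x. x s) \<circ> drifted_path c W)"
      by (rule distr_distr) measurable
    moreover have "\<dots> = distr M lborel (\<lambda>\<omega>. c * s + 1 * (W s \<omega> - W 0 \<omega>))"
      by (rule distr_cong) (use s in \<open>auto simp: drifted_path_def\<close>)
    ultimately show ?thesis by simp
  qed
qed

text \<open>Independence is given for the sigma-algebra generated by \<open>W\<close> at nonnegative
  times. The path map uses only these coordinates, so it is measurable with respect to that
  sigma-algebra, and the joint law is a product.\<close>

lemma joint_law:
  assumes \<alpha>: "distributed M lborel \<alpha> (exponential_density \<eta>)" and ind: "indep_of_process M \<alpha> W"
  shows "distr M (path_space \<Otimes>\<^sub>M lborel) (\<lambda>\<omega>. (drifted_path c W \<omega>, \<alpha> \<omega>)) =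
    distr M path_space (drifted_path c W) \<Otimes>\<^sub>M density lborel (exponential_density \<eta>)"
proof -
  let ?\<pi> = "drifted_path c W"
  let ?Wr = "\<lambda>\<omega>. \<lambda>t\<in>{0..}. W t \<omega>"
  let ?V = "vimage_algebra (space M) ?Wr (\<Pi>\<^sub>M t\<in>{0..}. borel :: real measure)"
  have [measurable]: "\<alpha> \<in> borel_measurable M" using distributed_measurable[OF \<alpha>] by simp
  have law: "distr M lborel \<alpha> = density lborel (exponential_density \<eta>)" by (rule distributed_distr_eq_density[OF \<alpha>])
  have Wr: "?Wr \<in> ?V \<rightarrow>\<^sub>M (\<Pi>\<^sub>M t\<in>{0..}. borel)"
    by (rule measurable_vimage_algebra1) (auto simp: space_PiM)
  have co: "(\<lambda>\<omega>. W s \<omega>) \<in> borel_measurable ?V" if "0 \<le> s" for s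
  proof -
    have "(\<lambda>\<omega>. ?Wr \<omega> s) \<in> borel_measurable ?V"
      by (rule measurable_compose[OF Wr measurable_component_singleton]) (use that in simp)
    then show ?thesis using that by simp
  qed
  have \<pi>V: "?\<pi> \<in> ?V \<rightarrow>\<^sub>M path_space"
  proof (rule measurable_path_spaceI)
    fix w assume "w \<in> space ?V"
    then show "?\<pi> w \<in> paths" by (intro drifted_path_paths) simp
  next
    fix t
    show "(\<lambda>\<omega>. ?\<pi> \<omega> t) \<in> borel_measurable ?V"
      unfolding drifted_path_def by (intro borel_measurable_add borel_measurable_diff co borel_measurable_const) auto
  qed
  have "distr M path_space ?\<pi> \<Otimes>\<^sub>M distr M lborel \<alpha> = distr M (path_space \<Otimes>\<^sub>M lborel) (\<lambda>\<omega>. (?\<pi> \<omega>, \<alpha> \<omega>))"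
  proof (rule pair_measure_eqI)
    interpret P1: prob_space "distr M path_space ?\<pi>" by (rule prob_space_distr) measurable
    interpret P2: prob_space "distr M lborel \<alpha>" by (rule prob_space_distr) measurable
    show "sigma_finite_measure (distr M path_space ?\<pi>)" "sigma_finite_measure (distr M lborel \<alpha>)" by unfold_locales
    show "sets (distr M path_space ?\<pi> \<Otimes>\<^sub>M distr M lborel \<alpha>) = sets (distr M (path_space \<Otimes>\<^sub>M lborel) (\<lambda>\<omega>. (?\<pi> \<omega>, \<alpha> \<omega>)))"
      by (simp cong: sets_pair_measure_cong)
    fix A B assume "A \<in> sets (distr M path_space ?\<pi>)" "B \<in> sets (distr M lborel \<alpha>)"
    then have A: "A \<in> sets path_space" and B: "B \<in> sets borel" by auto
    have "\<alpha> -` B \<inter> space M \<in> sets (vimage_algebra (space M) \<alpha> borel)"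
      by (rule in_vimage_algebra[OF B])
    moreover have "?\<pi> -` A \<inter> space M \<in> sets ?V"
      using measurable_sets[OF \<pi>V A] by simp
    ultimately have "prob ((\<alpha> -` B \<inter> space M) \<inter> (?\<pi> -` A \<inter> space M)) = prob (\<alpha> -` B \<inter> space M) * prob (?\<pi> -` A \<inter> space M)"
      using ind unfolding indep_of_process_def by (intro indep_setD)
    moreover have "(\<lambda>\<omega>. (?\<pi> \<omega>, \<alpha> \<omega>)) -` (A \<times> B) \<inter> space M = (\<alpha> -` B \<inter> space M) \<inter> (?\<pi> -` A \<inter> space M)" by auto
    moreover have "A \<times> B \<in> sets (path_space \<Otimes>\<^sub>M lborel)" using A B by (intro pair_measureI) auto
    ultimately show "emeasure (distr M path_space ?\<pi>) A * emeasure (distr M lborel \<alpha>) B =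
        emeasure (distr M (path_space \<Otimes>\<^sub>M lborel) (\<lambda>\<omega>. (?\<pi> \<omega>, \<alpha> \<omega>))) (A \<times> B)"
      using A B by (simp add: emeasure_distr emeasure_eq_measure ennreal_mult mult.commute)
  qed
  then show ?thesis unfolding law by simp
qed

end

section \<open>The theorem\<close>

lemma running_max_add:
  assumes "continuous_on {s..t} x" "s \<le> t" and y: "\<And>u. u \<in> {s..t} \<Longrightarrow> y u = k + x u"
  shows "running_max y s t = k + running_max x s t"
proof -
  obtain u where u: "u \<in> {s..t}" "x u = running_max x s t" "\<And>v. v \<in> {s..t} \<Longrightarrow> x v \<le> x u"
    using running_max_attained[OF assms(1,2)] by metis
  have "running_max y s t = y u" by (rule running_max_eqI) (use u y in auto)
  then show ?thesis using u y by simp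
qed

text \<open>On nonnegative times \<open>X\<close> is the path in \<open>paths\<close> plus the
  constant \<open>W 0 \<omega>\<close>. The comparison is made for every \<open>\<omega>\<close> and
  not only almost surely, because integrability of the original functions includes their
  measurability.\<close>

locale translated_path =
  fixes x y :: "real \<Rightarrow> real" and k a :: real
  assumes x: "x \<in> paths" and a: "0 < a" and y: "\<And>t. 0 \<le> t \<Longrightarrow> y t = k + x t"
begin

lemma max_eq: "0 \<le> s \<Longrightarrow> s \<le> t \<Longrightarrow> running_max y s t = k + running_max x s t"
  by (rule running_max_add[OF pathsD(1)[OF x]]) (auto intro: y)

lemma lag_time_translated:
  assumes "0 \<le> s" shows "lag_time a y s = lag_time a x s"
proof -
  have "running_max y (t - a) t = y (t - a) \<longleftrightarrow> running_max x (t - a) t = x (t - a)" if t: "s + ereal a \<le> ereal t" for t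
  proof -
    have "0 + ereal a \<le> ereal t" using add_right_mono[OF assms, of "ereal a"] t by (rule order_trans)
    then have "a \<le> t" by simp
    then show ?thesis using max_eq[of "t - a" t] y[of "t - a"] a by simp
  qed
  then have "{ereal t |t. s + ereal a \<le> ereal t \<and> running_max y (t - a) t = y (t - a)} =
      {ereal t |t. s + ereal a \<le> ereal t \<and> running_max x (t - a) t = x (t - a)}"
    by (intro Collect_cong ex_cong1 conj_cong refl)
  then show ?thesis unfolding lag_time_def by (rule arg_cong)
qed

lemma restart_nonneg: "0 \<le> restart_time a x j"
proof -
  have "0 \<le> ereal (real j * a)" using a by simp
  also have "\<dots> \<le> restart_time a x j" using restart_time_facts[OF x a] by blast
  finally show ?thesis .
qed

lemma restart_time_translated: "restart_time a y j = restart_time a x j"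
proof (induction j)
  case (Suc j)
  then show ?case using lag_time_translated[OF restart_nonneg[of j]] by simp
qed simp

lemma stop_cond_translated: "stop_cond a q y T j \<longleftrightarrow> stop_cond a q x T j"
proof (cases "restart_time a x (Suc j)")
  case (real r)
  have le: "restart_time a x j \<le> restart_time a x (Suc j)" using restart_time_facts[OF x a] by blast
  obtain r' where r': "restart_time a x j = ereal r'" "0 \<le> r'" "r' \<le> r"
    using restart_nonneg[of j] le unfolding real by (cases "restart_time a x j") auto
  have m: "running_max y r' r = k + running_max x r' r" by (rule max_eq[OF r'(2,3)])
  have v: "y r = k + x r" using r' by (intro y) simp
  have 1: "stop_cond a q y T j \<longleftrightarrow> T < r \<or> y r - running_max y r' r < q"
    by (simp only: stop_cond_def restart_time_translated max_since_restart_def Let_def real r'(1) real_of_ereal.simps less_ereal.simps)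
  have 2: "stop_cond a q x T j \<longleftrightarrow> T < r \<or> x r - running_max x r' r < q"
    by (simp only: stop_cond_def max_since_restart_def Let_def real r'(1) real_of_ereal.simps less_ereal.simps)
  show ?thesis unfolding 1 2 m v by simp
next
  case PInf
  then show ?thesis unfolding stop_cond_def restart_time_translated PInf by (simp only: less_ereal.simps simp_thms)
next
  case MInf
  have "0 \<le> (- \<infinity> :: ereal)" using restart_nonneg[of "Suc j"] unfolding MInf .
  then show ?thesis by simp
qed

lemma stop_index_translated: "stop_index a q y T = stop_index a q x T"
  by (simp add: stop_index_eq stop_cond_translated)

lemma reward_translated:
  assumes T: "0 \<le> T"
  shows "reward a q y T = exp k * reward a q x T"
proof -
  define N where "N = stop_index a q x T"
  have le: "restart_time a x N \<le> ereal T"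
  proof (cases N)
    case 0
    then show ?thesis using T by simp
  next
    case (Suc m)
    then have "m < (LEAST k. stop_cond a q x T k)" by (simp add: N_def stop_index_eq)
    then have "\<not> stop_cond a q x T m" by (rule not_less_Least)
    then show ?thesis using Suc by (simp add: stop_cond_def not_less)
  qed
  obtain r' where r': "restart_time a x N = ereal r'" "0 \<le> r'" "r' \<le> T"
    using le restart_nonneg[of N] by (cases "restart_time a x N") auto
  have le2: "restart_time a x N \<le> restart_time a x (Suc N)" using restart_time_facts[OF x a] by blast
  have "\<exists>v. min (restart_time a x (Suc N)) (ereal T) = ereal v \<and> r' \<le> v"
  proof (cases "restart_time a x (Suc N)")
    case (real r)
    then have "r' \<le> r" using le2 r'(1) by (simp del: restart_time.simps)
    then show ?thesis unfolding real using r' by (intro exI[of _ "min r T"]) (auto simp: min_def)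
  next
    case PInf
    then show ?thesis unfolding PInf using r' by (intro exI[of _ T]) (auto simp: min_def)
  next
    case MInf
    then show ?thesis using le2 r'(1) by (simp del: restart_time.simps)
  qed
  then obtain v where v: "min (restart_time a x (Suc N)) (ereal T) = ereal v" "r' \<le> v" by blast
  have "reward a q y T = exp (running_max y r' v)"
    by (simp only: reward_def Let_def stop_index_translated N_def[symmetric] max_since_restart_def restart_time_translated r'(1) v(1) real_of_ereal.simps)
  moreover have "reward a q x T = exp (running_max x r' v)"
    by (simp only: reward_def Let_def N_def[symmetric] max_since_restart_def r'(1) v(1) real_of_ereal.simps)
  ultimately show ?thesis by (simp add: max_eq[OF r'(2) v(2)] exp_add)
qed

text \<open>A negative terminal time precedes the first restart, and the maximum is over an empty
  interval. The resulting default is the same for all paths, which keeps the reward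
  measurable.\<close>

lemma reward_negative:
  assumes T: "T < 0"
  shows "reward a q y T = exp (Sup {})"
proof -
  have "ereal T < 0" using T by simp
  then have lt: "ereal T < restart_time a x (Suc 0)" using restart_nonneg by (rule less_le_trans)
  then have "stop_cond a q x T 0" unfolding stop_cond_def by (rule disjI1)
  from stop_index_0[OF x a this] have "stop_index a q y T = 0" by (simp only: stop_index_translated)
  moreover have "min (restart_time a y (Suc 0)) (ereal T) = ereal T"
    unfolding restart_time_translated by (rule min_absorb2[OF less_imp_le[OF lt]])
  ultimately show ?thesis
    using T by (simp add: reward_def max_since_restart_def running_max_def del: restart_time.simps(2))
qed

end

text \<open>Strict and weak inequality at \<open>L\<close> differ by a null set; the rest is the
  tail of the exponential clock.\<close>

lemma nn_integral_exp_atLeast_shift: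
  assumes \<eta>: "0 < \<eta>" and L: "0 \<le> L"
  shows "(\<integral>\<^sup>+T. (if 0 \<le> T then ennreal (\<eta> * exp (- \<eta> * T)) else 0) * (if L < T then v else 0) \<partial>lborel) = v * ennreal (exp (- \<eta> * L))"
proof -
  have "(\<integral>\<^sup>+T. (if 0 \<le> T then ennreal (\<eta> * exp (- \<eta> * T)) else 0) * (if L < T then v else 0) \<partial>lborel) =
     (\<integral>\<^sup>+T. v * (if L \<le> T then ennreal (\<eta> * exp (- \<eta> * T)) else 0) \<partial>lborel)"
  proof (rule nn_integral_cong_AE)
    show "AE T in lborel. (if 0 \<le> T then ennreal (\<eta> * exp (- \<eta> * T)) else 0) * (if L < T then v else 0) = v * (if L \<le> T then ennreal (\<eta> * exp (- \<eta> * T)) else 0)"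
      using AE_lborel_singleton[of L] by eventually_elim (use L in \<open>auto simp: mult.commute\<close>)
  qed
  also have "\<dots> = v * (\<integral>\<^sup>+T. (if L \<le> T then ennreal (\<eta> * exp (- \<eta> * T)) else 0) \<partial>lborel)"
    by (rule nn_integral_cmult) measurable
  also have "(\<integral>\<^sup>+T. (if L \<le> T then ennreal (\<eta> * exp (- \<eta> * T)) else 0) \<partial>lborel) =
      (\<integral>\<^sup>+U. ennreal (exp (- \<eta> * L)) * (if 0 \<le> U then ennreal (\<eta> * exp (- \<eta> * U)) else 0) \<partial>lborel)"
  proof -
    have "ennreal (\<eta> * exp (- \<eta> * (L + 1 * U))) = ennreal (exp (- \<eta> * L)) * ennreal (\<eta> * exp (- \<eta> * U))" for U
      using \<eta> by (simp add: ennreal_mult'[symmetric] mult.left_commute exp_add[symmetric] algebra_simps)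
    then show ?thesis
      by (subst nn_integral_real_affine[where c=1 and t=L]) (auto intro!: nn_integral_cong)
  qed
  also have "\<dots> = ennreal (exp (- \<eta> * L))"
    using nn_integral_exp_atLeast[of \<eta> \<eta>] \<eta> by (subst nn_integral_cmult) auto
  finally show ?thesis .
qed

context brownian
begin

text \<open>\<open>\<alpha>\<close> is nonnegative and \<open>W 0\<close> vanishes only almost surely, but a Bochner integral needs measurability
  everywhere; \<open>\<kappa>\<close> is the junk value of the payoff for \<open>\<alpha> < 0\<close>.\<close>

lemma path_integral_transfer:
  fixes g :: "(real \<Rightarrow> real) \<Rightarrow> real \<Rightarrow> real"
  assumes \<alpha>: "distributed M lborel \<alpha> (exponential_density \<eta>)" and ind: "indep_of_process M \<alpha> W"
    and g [measurable]: "(\<lambda>p. g (fst p) (snd p)) \<in> borel_measurable (path_space \<Otimes>\<^sub>M borel)" and g0: "\<And>x T. 0 \<le> g x T"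
    and f: "\<And>\<omega>. \<omega> \<in> space M \<Longrightarrow> f \<omega> = (if \<alpha> \<omega> < 0 then \<kappa> else exp (W 0 \<omega>) * g (drifted_path c W \<omega>) (\<alpha> \<omega>))"
    and v: "(\<integral>\<^sup>+x. \<integral>\<^sup>+T. (if 0 \<le> T then ennreal (\<eta> * exp (- \<eta> * T)) else 0) * ennreal (g x T) \<partial>lborel \<partial>distr M path_space (drifted_path c W)) = ennreal v" "0 \<le> v"
  shows "integrable M f \<and> integral\<^sup>L M f = v"
proof -
  let ?\<pi> = "drifted_path c W"
  have [measurable]: "\<alpha> \<in> borel_measurable M" using distributed_measurable[OF \<alpha>] by simp
  have [measurable]: "W 0 \<in> borel_measurable M" by (rule W_measurable) simp
  have gm [measurable]: "(\<lambda>\<omega>. g (?\<pi> \<omega>) (\<alpha> \<omega>)) \<in> borel_measurable M"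
    by (rule measurable_compose[OF _ g, of "\<lambda>\<omega>. (?\<pi> \<omega>, \<alpha> \<omega>)", simplified]) measurable
  have "f \<in> borel_measurable M \<longleftrightarrow> (\<lambda>\<omega>. if \<alpha> \<omega> < 0 then \<kappa> else exp (W 0 \<omega>) * g (?\<pi> \<omega>) (\<alpha> \<omega>)) \<in> borel_measurable M"
    by (rule measurable_cong) (rule f)
  then have fm [measurable]: "f \<in> borel_measurable M" by simp
  have "AE \<omega> in M. 0 \<le> \<alpha> \<omega>"
  proof -
    have "emeasure M (\<alpha> -` {..<0} \<inter> space M) = (\<integral>\<^sup>+T. ennreal (exponential_density \<eta> T) * indicator {..<0} T \<partial>lborel)"
      by (rule distributed_emeasure[OF \<alpha>]) simp
    also have "\<dots> = (\<integral>\<^sup>+T. 0 \<partial>(lborel :: real measure))"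
      by (intro nn_integral_cong) (auto simp: exponential_density_def indicator_def)
    finally have "emeasure M {\<omega>\<in>space M. \<alpha> \<omega> < 0} = 0"
      by (simp add: vimage_def Int_def conj_commute)
    then show ?thesis by (intro AE_I[where N="{\<omega>\<in>space M. \<alpha> \<omega> < 0}"]) auto
  qed
  with W_0 have ae: "AE \<omega> in M. f \<omega> = g (?\<pi> \<omega>) (\<alpha> \<omega>)"
    using AE_space by eventually_elim (simp add: f)
  have "(\<integral>\<^sup>+\<omega>. f \<omega> \<partial>M) = (\<integral>\<^sup>+\<omega>. ennreal (g (?\<pi> \<omega>) (\<alpha> \<omega>)) \<partial>M)"
    by (rule nn_integral_cong_AE) (use ae in eventually_elim, simp)
  also have "\<dots> = (\<integral>\<^sup>+p. ennreal (g (fst p) (snd p)) \<partial>distr M (path_space \<Otimes>\<^sub>M lborel) (\<lambda>\<omega>. (?\<pi> \<omega>, \<alpha> \<omega>)))"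
    by (subst nn_integral_distr) (auto cong: measurable_cong_sets)
  also have "\<dots> = (\<integral>\<^sup>+x. \<integral>\<^sup>+T. ennreal (g x T) \<partial>density lborel (exponential_density \<eta>) \<partial>distr M path_space ?\<pi>)"
  proof -
    have "distr M lborel \<alpha> = density lborel (exponential_density \<eta>)" by (rule distributed_distr_eq_density[OF \<alpha>])
    moreover have "prob_space (distr M lborel \<alpha>)" by (rule prob_space_distr) measurable
    ultimately interpret E: prob_space "density lborel (exponential_density \<eta>)" by simp
    show ?thesis unfolding joint_law[OF \<alpha> ind]
      by (subst E.nn_integral_fst[symmetric]) (auto cong: measurable_cong_sets sets_pair_measure_cong)
  qed
  also have "\<dots> = (\<integral>\<^sup>+x. \<integral>\<^sup>+T. (if 0 \<le> T then ennreal (\<eta> * exp (- \<eta> * T)) else 0) * ennreal (g x T) \<partial>lborel \<partial>distr M path_space ?\<pi>)"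
  proof (intro nn_integral_cong)
    fix x assume "x \<in> space (distr M path_space ?\<pi>)" then have x: "x \<in> paths" by simp
    have [measurable]: "(\<lambda>T. g x T) \<in> borel_measurable borel"
      by (rule measurable_compose[OF _ g, of "\<lambda>T. (x, T)", simplified]) (use x in simp)
    have "(\<integral>\<^sup>+T. ennreal (g x T) \<partial>density lborel (exponential_density \<eta>)) = (\<integral>\<^sup>+T. ennreal (exponential_density \<eta> T) * ennreal (g x T) \<partial>lborel)"
      by (rule nn_integral_density) auto
    also have "\<dots> = (\<integral>\<^sup>+T. (if 0 \<le> T then ennreal (\<eta> * exp (- \<eta> * T)) else 0) * ennreal (g x T) \<partial>lborel)"
      by (intro nn_integral_cong) (auto simp: exponential_density_def mult.commute)
    finally show "(\<integral>\<^sup>+T. ennreal (g x T) \<partial>density lborel (exponential_density \<eta>)) =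
      (\<integral>\<^sup>+T. (if 0 \<le> T then ennreal (\<eta> * exp (- \<eta> * T)) else 0) * ennreal (g x T) \<partial>lborel)" .
  qed
  also have "\<dots> = ennreal v" by (rule v)
  finally have "(\<integral>\<^sup>+\<omega>. f \<omega> \<partial>M) = ennreal v" .
  moreover have "AE \<omega> in M. 0 \<le> f \<omega>" using ae by eventually_elim (simp add: g0)
  ultimately show ?thesis using nn_integral_eq_integrable[OF fm _ v(2)] by blast
qed

end

theorem theorem1:
  fixes M :: "'a measure"
    and W X :: "real \<Rightarrow> 'a \<Rightarrow> real"
    and \<alpha> :: "'a \<Rightarrow> real"
    and a \<eta> q c :: real
  assumes "a > 0" and "\<eta> > 0" and "q < 0" and "c = - 1 / 2"
    and "standard_brownian_motion M W"
    and "X = (\<lambda>t \<omega>. W t \<omega> + c * t)"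
    and "distributed M lborel \<alpha> (exponential_density \<eta>)"
    and "indep_of_process M \<alpha> W"
  shows "expectations_exist M X \<alpha> a q
    \<and> A_plus M X \<alpha> a q \<noteq> 1
    \<and> rule_value M X \<alpha> a q
        = (A_0 M X \<alpha> a + A_minus M X \<alpha> a q) / (1 - A_plus M X \<alpha> a q)
    \<and> (A_0 M X \<alpha> a + A_minus M X \<alpha> a q) / (1 - A_plus M X \<alpha> a q)
        = (nu_alpha c \<eta> a + (1 - exp (- \<eta> * a)) * nu_a c a + psi_0 c \<eta> a q)
          / (nu c \<eta> a - 1 - psi_1 c \<eta> a q)
    \<and> nu c \<eta> a - 1 - psi_1 c \<eta> a q > 0"
proof -
  note a = \<open>a > 0\<close> and \<eta> = \<open>\<eta> > 0\<close> and q = \<open>q < 0\<close>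
  have q': "q \<le> 0" using q by simp
  interpret brownian M W using assms(5) by (rule brownian.intro)
  let ?\<pi> = "drifted_path c W"
  interpret Q: half_drift "distr M path_space ?\<pi>"
    using markov_path_law[of c] assms(4) by (simp add: half_drift_def)
  let ?P = "distr M path_space ?\<pi>"
  \<comment> \<open>The common denominator of \<open>A_0\<close>, \<open>A_minus\<close> and
    \<open>A_plus\<close>; it is positive because it exceeds \<open>psi_1\<close>, which is
    nonnegative.\<close>
  define \<gamma> where "\<gamma> = nu c \<eta> a - 1"
  have den: "0 < \<gamma> - psi_1 c \<eta> a q" using denominator_pos[OF \<eta> a q'] assms(4) by (simp add: \<gamma>_def)
  have psi0: "0 \<le> psi_0 c \<eta> a q"
    using excursion_tail_pos[OF a q', of c] by (simp add: psi_0_eq)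
  have psi1: "0 \<le> psi_1 c \<eta> a q"
    using excursion_tail_mono[OF a q order_refl, of "c + 1"] by (simp add: psi_1_eq[OF a])
  have \<gamma>: "0 < \<gamma>" using den psi1 by simp
  have rr: "0 \<le> ring_rate c \<eta> a" by (rule nn_integral_ring_rate(2)[OF \<eta> a])
  have solve: "I = ennreal (r / \<gamma>)" if "ennreal \<gamma> * I = ennreal r" "0 \<le> r" for I r
  proof -
    have "ennreal (1 / \<gamma>) * (ennreal \<gamma> * I) = I"
      using \<gamma> by (simp add: mult.assoc[symmetric] ennreal_mult'[symmetric])
    moreover have "ennreal (1 / \<gamma>) * ennreal r = ennreal (r / \<gamma>)"
      using \<gamma> that(2) by (simp add: ennreal_mult[symmetric])
    ultimately show ?thesis using that(1) by simp
  qed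
  have run: "(\<integral>\<^sup>+x. running_payoff a \<eta> x \<partial>?P) = ennreal (ring_rate c \<eta> a / \<gamma>)"
    by (rule solve[OF _ rr]) (use Q.running_payoff_expectation(1)[OF a \<eta>] assms(4) in \<open>simp add: \<gamma>_def\<close>)
  have lagE: "ennreal \<gamma> * (\<integral>\<^sup>+x. lag_payoff a \<eta> h x \<partial>?P) = ennreal (exp (- \<eta> * a)) * (\<integral>\<^sup>+y. h y * excursion_density c a y \<partial>lborel)"
    if "h \<in> borel_measurable borel" for h
    using Q.lag_payoff_expectation[OF a \<eta> that] assms(4) by (simp add: \<gamma>_def)
  have minus: "(\<integral>\<^sup>+x. lag_payoff a \<eta> (\<lambda>y. if y < q then 1 else 0) x \<partial>?P) = ennreal (psi_0 c \<eta> a q / \<gamma>)"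
  proof (rule solve[OF _ psi0])
    show "ennreal \<gamma> * (\<integral>\<^sup>+x. lag_payoff a \<eta> (\<lambda>y. if y < q then 1 else 0) x \<partial>?P) = ennreal (psi_0 c \<eta> a q)"
      by (subst lagE, simp) (simp only: nn_integral_excursion_density[OF a q'] psi_0_eq ennreal_mult' exp_ge_zero)
  qed
  \<comment> \<open>Serves two functions of the drop: \<open>continue_gain\<close>, which includes
    the threshold \<open>q\<close>, and the integrand of \<open>A_plus\<close>, which excludes it.
    The limit law of the drop has a density on the negative half-line, so both give the same
    value.\<close>
  have plus_gen: "(\<integral>\<^sup>+x. lag_payoff a \<eta> h x \<partial>?P) = ennreal (psi_1 c \<eta> a q / \<gamma>)"
    if h [measurable]: "h \<in> borel_measurable borel" and hq: "\<And>y. y < 0 \<Longrightarrow> y \<noteq> q \<Longrightarrow> h y = (if q < y then ennreal (exp y) else 0)" for h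
  proof (rule solve[OF _ psi1])
    have "(\<integral>\<^sup>+y. h y * excursion_density c a y \<partial>lborel) = (\<integral>\<^sup>+y. (if q < y then ennreal (exp y) else 0) * ennreal (excursion_density c a y) \<partial>lborel)"
    proof (rule nn_integral_cong_AE)
      show "AE y in lborel. h y * ennreal (excursion_density c a y) = (if q < y then ennreal (exp y) else 0) * ennreal (excursion_density c a y)"
        using AE_lborel_singleton[of q]
      proof eventually_elim
        case (elim y)
        then show ?case using hq[of y] by (cases "y < 0") (auto simp: excursion_density_def)
      qed
    qed
    then show "ennreal \<gamma> * (\<integral>\<^sup>+x. lag_payoff a \<eta> h x \<partial>?P) = ennreal (psi_1 c \<eta> a q)"
      by (subst lagE[OF h]) (simp only: nn_integral_exp_excursion_density[OF a q] psi_1_eq[OF a] ennreal_mult' exp_ge_zero)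
  qed
  let ?e = "\<lambda>T. if 0 \<le> T then ennreal (\<eta> * exp (- \<eta> * T)) else 0"
  let ?g0 = "\<lambda>x T. if has_lag a x \<longrightarrow> T < lag_end a x then exp (running_max x 0 T) else 0"
  let ?gm = "\<lambda>x T. if has_lag a x \<and> lag_end a x < T \<and> x (lag_end a x) - x (first_lag a x) < q then exp (x (first_lag a x)) else 0"
  let ?gp = "\<lambda>x T. if has_lag a x \<and> lag_end a x < T \<and> x (lag_end a x) - x (first_lag a x) > q then exp (x (lag_end a x)) else 0"
  note [measurable] = measurable_has_lag[OF less_imp_le[OF a]] measurable_first_lag[OF less_imp_le[OF a]] measurable_lag_end[OF a]
  have [measurable]: "(\<lambda>p. fst p (lag_end a (fst p))) \<in> borel_measurable (path_space \<Otimes>\<^sub>M borel)"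
    "(\<lambda>p. fst p (first_lag a (fst p))) \<in> borel_measurable (path_space \<Otimes>\<^sub>M borel)"
    by (rule measurable_path_eval; measurable)+
  have g0m: "(\<lambda>p. ?g0 (fst p) (snd p)) \<in> borel_measurable (path_space \<Otimes>\<^sub>M borel)" by measurable
  have gmm: "(\<lambda>p. ?gm (fst p) (snd p)) \<in> borel_measurable (path_space \<Otimes>\<^sub>M borel)" by measurable
  have gpm: "(\<lambda>p. ?gp (fst p) (snd p)) \<in> borel_measurable (path_space \<Otimes>\<^sub>M borel)" by measurable
  have v0: "(\<integral>\<^sup>+x. \<integral>\<^sup>+T. ?e T * ennreal (?g0 x T) \<partial>lborel \<partial>?P) = ennreal (ring_rate c \<eta> a / \<gamma>)"
    unfolding run[symmetric] running_payoff_def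
  proof (intro nn_integral_cong)
    fix x :: "real \<Rightarrow> real" and T :: real
    have "ennreal (\<eta> * exp (- \<eta> * T)) * ennreal (exp (running_max x 0 T)) = ennreal (\<eta> * exp (running_max x 0 T - \<eta> * T))"
      using \<eta> by (simp add: ennreal_mult'[symmetric] mult.assoc exp_add[symmetric])
    then show "?e T * ennreal (?g0 x T) = (if 0 \<le> T \<and> (has_lag a x \<longrightarrow> T < first_lag a x + a)
       then ennreal (\<eta> * exp (running_max x 0 T - \<eta> * T)) else 0)"
      by (auto simp: lag_end_def)
  qed
  have vm: "(\<integral>\<^sup>+x. \<integral>\<^sup>+T. ?e T * ennreal (?gm x T) \<partial>lborel \<partial>?P) = ennreal (psi_0 c \<eta> a q / \<gamma>)"
    unfolding minus[symmetric]
  proof (intro nn_integral_cong)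
    fix x assume "x \<in> space ?P" then have x: "x \<in> paths" by simp
    show "(\<integral>\<^sup>+T. ?e T * ennreal (?gm x T) \<partial>lborel) = lag_payoff a \<eta> (\<lambda>y. if y < q then 1 else 0) x"
    proof (cases "has_lag a x \<and> x (lag_end a x) - x (first_lag a x) < q")
      case True
      then have "(\<integral>\<^sup>+T. ?e T * ennreal (?gm x T) \<partial>lborel) = (\<integral>\<^sup>+T. ?e T * (if lag_end a x < T then ennreal (exp (x (first_lag a x))) else 0) \<partial>lborel)"
        by (intro nn_integral_cong) auto
      also have "\<dots> = ennreal (exp (x (first_lag a x))) * ennreal (exp (- \<eta> * lag_end a x))"
        by (rule nn_integral_exp_atLeast_shift[OF \<eta> lag_end_nonneg[OF x a]])
      finally show ?thesis using True lag_end_max(4)[OF x a]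
        by (simp add: lag_payoff_def Let_def ennreal_mult'[symmetric] exp_add[symmetric])
    next
      case False
      then have "?gm x T = 0" for T by auto
      then have "(\<integral>\<^sup>+T. ?e T * ennreal (?gm x T) \<partial>lborel) = 0" by simp
      then show ?thesis using False by (auto simp: lag_payoff_def lag_end_def)
    qed
  qed
  have vp: "(\<integral>\<^sup>+x. \<integral>\<^sup>+T. ?e T * ennreal (?gp x T) \<partial>lborel \<partial>?P) = ennreal (psi_1 c \<eta> a q / \<gamma>)"
  proof -
    let ?h = "\<lambda>y. if q < y then ennreal (exp (min 0 y)) else 0"
    have "(\<integral>\<^sup>+x. \<integral>\<^sup>+T. ?e T * ennreal (?gp x T) \<partial>lborel \<partial>?P) = (\<integral>\<^sup>+x. lag_payoff a \<eta> ?h x \<partial>?P)"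
    proof (intro nn_integral_cong)
      fix x assume "x \<in> space ?P" then have x: "x \<in> paths" by simp
      show "(\<integral>\<^sup>+T. ?e T * ennreal (?gp x T) \<partial>lborel) = lag_payoff a \<eta> ?h x"
      proof (cases "has_lag a x \<and> x (lag_end a x) - x (first_lag a x) > q")
        case True
        then have "(\<integral>\<^sup>+T. ?e T * ennreal (?gp x T) \<partial>lborel) = (\<integral>\<^sup>+T. ?e T * (if lag_end a x < T then ennreal (exp (x (lag_end a x))) else 0) \<partial>lborel)"
          by (intro nn_integral_cong) auto
        also have "\<dots> = ennreal (exp (x (lag_end a x))) * ennreal (exp (- \<eta> * lag_end a x))"
          by (rule nn_integral_exp_atLeast_shift[OF \<eta> lag_end_nonneg[OF x a]])
        finally show ?thesis using True lag_end_max[OF x a]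
          by (simp add: lag_payoff_def Let_def ennreal_mult'[symmetric] exp_add[symmetric] min_def)
      next
        case False
        then have "?gp x T = 0" for T by auto
        then have "(\<integral>\<^sup>+T. ?e T * ennreal (?gp x T) \<partial>lborel) = 0" by simp
        then show ?thesis using False by (auto simp: lag_payoff_def lag_end_def)
      qed
    qed
    also have "\<dots> = ennreal (psi_1 c \<eta> a q / \<gamma>)" by (rule plus_gen) auto
    finally show ?thesis .
  qed
  \<comment> \<open>\<open>?A\<close> is \<open>A_plus\<close> and \<open>?B\<close> is
    \<open>A_0 + A_minus\<close>; \<open>?A < 1\<close> is equivalent to positivity of the final
    denominator.\<close>
  let ?A = "psi_1 c \<eta> a q / \<gamma>" and ?B = "ring_rate c \<eta> a / \<gamma> + psi_0 c \<eta> a q / \<gamma>"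
  have A: "0 \<le> ?A" "?A < 1" using psi1 \<gamma> den by auto
  have B: "0 \<le> ?B" using rr psi0 \<gamma> by simp
  have vr: "(\<integral>\<^sup>+x. \<integral>\<^sup>+T. ?e T * ennreal (reward a q x T) \<partial>lborel \<partial>?P) = ennreal (?B / (1 - ?A))"
  proof (rule Q.reward_expectation[OF a \<eta> _ A _ B])
    show "(\<integral>\<^sup>+x. lag_payoff a \<eta> (continue_gain q) x \<partial>?P) = ennreal ?A"
      by (rule plus_gen) (auto simp: continue_gain_def)
    show "Q.stop_gain a \<eta> q = ennreal ?B"
      unfolding Q.stop_gain_def run minus using rr psi0 \<gamma> by (simp add: ennreal_plus)
  qed
  have tr: "translated_path (?\<pi> \<omega>) (\<lambda>t. X t \<omega>) (W 0 \<omega>) a" if "\<omega> \<in> space M" for \<omega>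
    using drifted_path_paths[OF that] a by unfold_locales (auto simp: drifted_path_def assms(6))
  have tau: "tau0 X a \<omega> = (if has_lag a (?\<pi> \<omega>) then ereal (lag_end a (?\<pi> \<omega>)) else \<infinity>)" if \<omega>: "\<omega> \<in> space M" for \<omega>
    using translated_path.lag_time_translated[OF tr[OF \<omega>] order_refl] lag_time_0[OF drifted_path_paths[OF \<omega>] a]
    by (simp add: tau0_def)
  have Xm: "Xmax X t \<omega> = W 0 \<omega> + running_max (?\<pi> \<omega>) 0 t" if \<omega>: "\<omega> \<in> space M" and "0 \<le> t" for \<omega> t
    using translated_path.max_eq[OF tr[OF \<omega>] order_refl that(2)] by (simp add: Xmax_def)
  have Xt: "X t \<omega> = W 0 \<omega> + ?\<pi> \<omega> t" if "0 \<le> t" for \<omega> t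
    using that by (simp add: drifted_path_def assms(6))
  have at_tau: "X_tau0 X a \<omega> = W 0 \<omega> + ?\<pi> \<omega> (lag_end a (?\<pi> \<omega>))" "Xmax_tau0 X a \<omega> = W 0 \<omega> + ?\<pi> \<omega> (first_lag a (?\<pi> \<omega>))"
    if \<omega>: "\<omega> \<in> space M" and l: "has_lag a (?\<pi> \<omega>)" for \<omega>
  proof -
    note p = drifted_path_paths[OF \<omega>, of c]
    have "real_of_ereal (tau0 X a \<omega>) = lag_end a (?\<pi> \<omega>)" using tau[OF \<omega>] l by simp
    then show "X_tau0 X a \<omega> = W 0 \<omega> + ?\<pi> \<omega> (lag_end a (?\<pi> \<omega>))" "Xmax_tau0 X a \<omega> = W 0 \<omega> + ?\<pi> \<omega> (first_lag a (?\<pi> \<omega>))"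
      using Xm[OF \<omega> lag_end_nonneg[OF p a]] Xt[OF lag_end_nonneg[OF p a]] lag_end_max(1)[OF p a l]
      by (simp_all add: X_tau0_def Xmax_tau0_def)
  qed
  note transfer = path_integral_transfer[OF assms(7,8), where c=c]
  have I0: "integrable M (\<lambda>\<omega>. indicator (event_0 M X \<alpha> a) \<omega> *\<^sub>R exp (Xmax X (\<alpha> \<omega>) \<omega>)) \<and>
      integral\<^sup>L M (\<lambda>\<omega>. indicator (event_0 M X \<alpha> a) \<omega> *\<^sub>R exp (Xmax X (\<alpha> \<omega>) \<omega>)) = ring_rate c \<eta> a / \<gamma>"
  proof (rule transfer[OF g0m _ _ v0, where \<kappa>="exp (Sup {})"])
    fix \<omega> assume \<omega>: "\<omega> \<in> space M"
    show "indicator (event_0 M X \<alpha> a) \<omega> *\<^sub>R exp (Xmax X (\<alpha> \<omega>) \<omega>) = (if \<alpha> \<omega> < 0 then exp (Sup {}) else exp (W 0 \<omega>) * ?g0 (?\<pi> \<omega>) (\<alpha> \<omega>))"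
    proof (cases "\<alpha> \<omega> < 0")
      \<comment> \<open>A negative \<open>\<alpha>\<close> precedes tau_0, so such
        \<open>\<omega>\<close> belong to \<open>event_0\<close>, and the maximum over an empty
        interval is the default \<open>Sup {}\<close>.\<close>
      case True
      have "\<alpha> \<omega> < lag_end a (?\<pi> \<omega>)" using True lag_end_nonneg[OF drifted_path_paths[OF \<omega>] a] by (rule less_le_trans)
      then have "\<omega> \<in> event_0 M X \<alpha> a" using \<omega> tau[OF \<omega>] by (simp add: event_0_def)
      moreover have "Xmax X (\<alpha> \<omega>) \<omega> = Sup {}" using True by (simp add: Xmax_def running_max_def)
      ultimately show ?thesis using True by simp
    next
      case False
      have "\<omega> \<in> event_0 M X \<alpha> a \<longleftrightarrow> (has_lag a (?\<pi> \<omega>) \<longrightarrow> \<alpha> \<omega> < lag_end a (?\<pi> \<omega>))"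
        using \<omega> tau[OF \<omega>] by (simp add: event_0_def)
      then show ?thesis using False Xm[OF \<omega>, of "\<alpha> \<omega>"] by (auto simp: exp_add indicator_def)
    qed
  qed (use rr \<gamma> in auto)
  have Im: "integrable M (\<lambda>\<omega>. indicator (event_minus M X \<alpha> a q) \<omega> *\<^sub>R exp (Xmax_tau0 X a \<omega>)) \<and>
      integral\<^sup>L M (\<lambda>\<omega>. indicator (event_minus M X \<alpha> a q) \<omega> *\<^sub>R exp (Xmax_tau0 X a \<omega>)) = psi_0 c \<eta> a q / \<gamma>"
  proof (rule transfer[OF gmm _ _ vm, where \<kappa>=0])
    fix \<omega> assume \<omega>: "\<omega> \<in> space M"
    have iff: "\<omega> \<in> event_minus M X \<alpha> a q \<longleftrightarrow> has_lag a (?\<pi> \<omega>) \<and> lag_end a (?\<pi> \<omega>) < \<alpha> \<omega> \<and>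
        ?\<pi> \<omega> (lag_end a (?\<pi> \<omega>)) - ?\<pi> \<omega> (first_lag a (?\<pi> \<omega>)) < q"
      using \<omega> tau[OF \<omega>] at_tau[OF \<omega>] by (auto simp: event_minus_def)
    show "indicator (event_minus M X \<alpha> a q) \<omega> *\<^sub>R exp (Xmax_tau0 X a \<omega>) = (if \<alpha> \<omega> < 0 then 0 else exp (W 0 \<omega>) * ?gm (?\<pi> \<omega>) (\<alpha> \<omega>))"
      using iff at_tau(2)[OF \<omega>] lag_end_nonneg[OF drifted_path_paths[OF \<omega>, of c] a] by (auto simp: exp_add indicator_def)
  qed (use psi0 \<gamma> in auto)
  have Ip: "integrable M (\<lambda>\<omega>. indicator (event_plus M X \<alpha> a q) \<omega> *\<^sub>R exp (X_tau0 X a \<omega>)) \<and>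
      integral\<^sup>L M (\<lambda>\<omega>. indicator (event_plus M X \<alpha> a q) \<omega> *\<^sub>R exp (X_tau0 X a \<omega>)) = psi_1 c \<eta> a q / \<gamma>"
  proof (rule transfer[OF gpm _ _ vp, where \<kappa>=0])
    fix \<omega> assume \<omega>: "\<omega> \<in> space M"
    have iff: "\<omega> \<in> event_plus M X \<alpha> a q \<longleftrightarrow> has_lag a (?\<pi> \<omega>) \<and> lag_end a (?\<pi> \<omega>) < \<alpha> \<omega> \<and>
        ?\<pi> \<omega> (lag_end a (?\<pi> \<omega>)) - ?\<pi> \<omega> (first_lag a (?\<pi> \<omega>)) > q"
      using \<omega> tau[OF \<omega>] at_tau[OF \<omega>] by (auto simp: event_plus_def)
    show "indicator (event_plus M X \<alpha> a q) \<omega> *\<^sub>R exp (X_tau0 X a \<omega>) = (if \<alpha> \<omega> < 0 then 0 else exp (W 0 \<omega>) * ?gp (?\<pi> \<omega>) (\<alpha> \<omega>))"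
      using iff at_tau(1)[OF \<omega>] lag_end_nonneg[OF drifted_path_paths[OF \<omega>, of c] a] by (auto simp: exp_add indicator_def)
  qed (use psi1 \<gamma> in auto)
  have Ir: "integrable M (\<lambda>\<omega>. reward a q (\<lambda>t. X t \<omega>) (\<alpha> \<omega>)) \<and>
      integral\<^sup>L M (\<lambda>\<omega>. reward a q (\<lambda>t. X t \<omega>) (\<alpha> \<omega>)) = ?B / (1 - ?A)"
  proof (rule transfer[OF measurable_reward[OF a] reward_nonneg _ vr, where \<kappa>="exp (Sup {})"])
    fix \<omega> assume \<omega>: "\<omega> \<in> space M"
    show "reward a q (\<lambda>t. X t \<omega>) (\<alpha> \<omega>) = (if \<alpha> \<omega> < 0 then exp (Sup {}) else exp (W 0 \<omega>) * reward a q (?\<pi> \<omega>) (\<alpha> \<omega>))"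
      using translated_path.reward_translated[OF tr[OF \<omega>]] translated_path.reward_negative[OF tr[OF \<omega>]] by simp
  qed (use A B in simp)
  have ex: "expectations_exist M X \<alpha> a q"
    using I0 Im Ip Ir by (simp add: expectations_exist_def set_integrable_def)
  have val: "A_0 M X \<alpha> a = ring_rate c \<eta> a / \<gamma>" "A_minus M X \<alpha> a q = psi_0 c \<eta> a q / \<gamma>"
    "A_plus M X \<alpha> a q = ?A" "rule_value M X \<alpha> a q = ?B / (1 - ?A)"
    using I0 Im Ip Ir by (simp_all add: A_0_def A_minus_def A_plus_def rule_value_def set_lebesgue_integral_def)
  have "?B / (1 - ?A) = (ring_rate c \<eta> a + psi_0 c \<eta> a q) / (\<gamma> - psi_1 c \<eta> a q)"
    using \<gamma> den A by (simp add: field_simps)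
  with ex val A den show ?thesis by (simp add: \<gamma>_def ring_rate_def)
qed

end
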